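(* Let $X$ be a quasi-affine variety, not necessarily irreducible, over an arbitrary field $\mathbf{k}$. If $\mathscr{L}$ is a solvable Lie subalgebra of $\operatorname{Der}_{\mathbf{k}}(\mathscr{O}_X(X))$ consisting of locally finite derivations, then $\mathscr{L}$ is weakly locally finite and admits a countable increasing filtration by locally finite Lie subalgebras, i.e., $\mathscr{L}$ is the union of a sequence $\mathscr{L}_0\subseteq\mathscr{L}_1\subseteq\mathscr{L}_2\subseteq\cdots$ of locally finite Lie subalgebras.
   Context: $\mathscr{O}_X(X)$ is the $\mathbf{k}$-algebra of global sections of the structure sheaf (regular functions) of $X$. A quasi-affine variety over $\mathbf{k}$ is in particular (isomorphic to) an open subscheme of $\operatorname{Spec}A$ for some finitely generated commutative, associative, unital $\mathbf{k}$-algebra $A$. For a $\mathbf{k}$-algebra $B$, $\operatorname{Der}_{\mathbf{k}}(B)$ is the Lie algebra of $\mathbf{k}$-derivations of $B$, with bracket $[D,E]=D\circ E-E\circ D$. A subset $\Delta$ of $\operatorname{Der}_{\mathbf{k}}(B)$ is locally finite if for each $b\in B$ there exists a finite dimensional $\mathbf{k}$-linear subspace $U$ of $B$ such that $b\in U$ and $D(U)\subseteq U$ for all $D\in\Delta$. It is weakly locally finite if every finite subset of $\Delta$ is locally finite. A derivation $D\in\operatorname{Der}_{\mathbf{k}}(B)$ is locally finite if $\{D\}$ is a locally finite set. For a Lie algebra $\mathscr{L}$, $\mathscr{L}'$ denotes the Lie subalgebra of $\mathscr{L}$ generated by $\{[x,y]\mid x,y\in\mathscr{L}\}$; $\mathscr{L}^{(0)}=\mathscr{L}$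 and $\mathscr{L}^{(n+1)}=(\mathscr{L}^{(n)})'$ for $n\ge 0$. $\mathscr{L}$ is solvable if $\mathscr{L}^{(d)}=0$ for some $d\in\mathbb{N}$. *)

theory Defs
  imports "HOL.Hull" "HOL-Algebra.Ideal" "HOL-Algebra.Module" "HOL-Algebra.Subrings"
begin

section \<open>Finitely generated commutative algebras\<close>

definition subalg :: "('k, 'm) ring_scheme \<Rightarrow> ('k, 'a, 'n) module_scheme \<Rightarrow> 'a set \<Rightarrow> bool"
  where "subalg K A S \<longleftrightarrow> subring S A \<and> submodule S K A"

definition fin_gen_algebra :: "('k, 'm) ring_scheme \<Rightarrow> ('k, 'a, 'n) module_scheme \<Rightarrow> bool"
  where "fin_gen_algebra K A \<longleftrightarrow>
    algebra K A \<and> (\<exists>S. finite S \<and> S \<subseteq> carrier A \<and> subalg K A hull S = carrier A)"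


section \<open>The prime spectrum and its structure sheaf\<close>

definition Spec :: "('a, 'm) ring_scheme \<Rightarrow> 'a set set"
  where "Spec A = {P. primeideal P A}"

definition zariski_open :: "('a, 'm) ring_scheme \<Rightarrow> 'a set set \<Rightarrow> bool"
  where "zariski_open A U \<longleftrightarrow> (\<exists>I. ideal I A \<and> U = {P \<in> Spec A. \<not> I \<subseteq> P})"

text \<open>The fraction \<open>a / s\<close> in the localization of \<open>A\<close> at the prime \<open>P\<close>, as an equivalence class of
  pairs.\<close>

definition loc_frac :: "('a, 'm) ring_scheme \<Rightarrow> 'a set \<Rightarrow> 'a \<Rightarrow> 'a \<Rightarrow> ('a \<times> 'a) set"
  where "loc_frac A P a s = {(b, t). b \<in> carrier A \<and> t \<in> carrier A - P \<and>
    (\<exists>u \<in> carrier A - P. u \<otimes>\<^bsub>A\<^esub> (a \<otimes>\<^bsub>A\<^esub> t) = u \<otimes>\<^bsub>A\<^esub> (b \<otimes>\<^bsub>A\<^esub> s))}"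

text \<open>The operations are unions over all representatives; \<open>localization_simps\<close> below confirms that
  they do not depend on the representatives.\<close>

definition localization :: "('k, 'a, 'n) module_scheme \<Rightarrow> 'a set \<Rightarrow> ('k, ('a \<times> 'a) set) module"
  where "localization A P =
    \<lparr>carrier = {loc_frac A P a s | a s. a \<in> carrier A \<and> s \<in> carrier A - P},
     mult = (\<lambda>X Y. \<Union>(a, s)\<in>X. \<Union>(b, t)\<in>Y. loc_frac A P (a \<otimes>\<^bsub>A\<^esub> b) (s \<otimes>\<^bsub>A\<^esub> t)),
     one = loc_frac A P \<one>\<^bsub>A\<^esub> \<one>\<^bsub>A\<^esub>,
     zero = loc_frac A P \<zero>\<^bsub>A\<^esub> \<one>\<^bsub>A\<^esub>,
     add = (\<lambda>X Y. \<Union>(a, s)\<in>X. \<Union>(b, t)\<in>Y.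
       loc_frac A P (a \<otimes>\<^bsub>A\<^esub> t \<oplus>\<^bsub>A\<^esub> b \<otimes>\<^bsub>A\<^esub> s) (s \<otimes>\<^bsub>A\<^esub> t)),
     smult = (\<lambda>c X. \<Union>(a, s)\<in>X. loc_frac A P (c \<odot>\<^bsub>A\<^esub> a) s)\<rparr>"

definition regular_functions ::
    "('k, 'a, 'n) module_scheme \<Rightarrow> 'a set set \<Rightarrow> ('a set \<Rightarrow> ('a \<times> 'a) set) set"
  where "regular_functions A U =
    {f \<in> (\<Pi>\<^sub>E P\<in>U. carrier (localization A P)).
       \<forall>P\<in>U. \<exists>V. zariski_open A V \<and> P \<in> V \<and> V \<subseteq> U \<and>
         (\<exists>a \<in> carrier A. \<exists>s \<in> carrier A. \<forall>Q\<in>V. s \<notin> Q \<and> f Q = loc_frac A Q a s)}"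

text \<open>The algebra of sections of the structure sheaf of \<open>Spec A\<close> over the open set \<open>U\<close>, that is, the
  algebra of global sections of the open subscheme \<open>U\<close>.\<close>

definition structure_sheaf ::
    "('k, 'a, 'n) module_scheme \<Rightarrow> 'a set set \<Rightarrow> ('k, 'a set \<Rightarrow> ('a \<times> 'a) set) module"
  where "structure_sheaf A U =
    \<lparr>carrier = regular_functions A U,
     mult = (\<lambda>f g. \<lambda>P\<in>U. f P \<otimes>\<^bsub>localization A P\<^esub> g P),
     one = (\<lambda>P\<in>U. \<one>\<^bsub>localization A P\<^esub>),
     zero = (\<lambda>P\<in>U. \<zero>\<^bsub>localization A P\<^esub>),
     add = (\<lambda>f g. \<lambda>P\<in>U. f P \<oplus>\<^bsub>localization A P\<^esub> g P),
     smult = (\<lambda>c f. \<lambda>P\<in>U. c \<odot>\<^bsub>localization A P\<^esub> f P)\<rparr>"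


section \<open>Lie algebras of derivations\<close>

text \<open>Derivations are \<^const>\<open>undefined\<close> outside the carrier, so that equality of derivations is
  equality of functions.\<close>

definition derivation :: "('k, 'm) ring_scheme \<Rightarrow> ('k, 'b, 'n) module_scheme \<Rightarrow> ('b \<Rightarrow> 'b) \<Rightarrow> bool"
  where "derivation K B D \<longleftrightarrow>
    D \<in> carrier B \<rightarrow>\<^sub>E carrier B \<and>
    (\<forall>x\<in>carrier B. \<forall>y\<in>carrier B. D (x \<oplus>\<^bsub>B\<^esub> y) = D x \<oplus>\<^bsub>B\<^esub> D y) \<and>
    (\<forall>c\<in>carrier K. \<forall>x\<in>carrier B. D (c \<odot>\<^bsub>B\<^esub> x) = c \<odot>\<^bsub>B\<^esub> D x) \<and>
    (\<forall>x\<in>carrier B. \<forall>y\<in>carrier B. D (x \<otimes>\<^bsub>B\<^esub> y) = D x \<otimes>\<^bsub>B\<^esub> y \<oplus>\<^bsub>B\<^esub> x \<otimes>\<^bsub>B\<^esub> D y)"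

text \<open>A Lie algebra is stored as a \<^typ>\<open>('k, 'a) module\<close> record whose \<open>mult\<close> field is the bracket; the
  \<open>one\<close> field has no meaning.\<close>

definition Der :: "('k, 'm) ring_scheme \<Rightarrow> ('k, 'b, 'n) module_scheme \<Rightarrow> ('k, 'b \<Rightarrow> 'b) module"
  where "Der K B =
    \<lparr>carrier = {D. derivation K B D},
     mult = (\<lambda>D E. \<lambda>x\<in>carrier B. D (E x) \<ominus>\<^bsub>B\<^esub> E (D x)),
     one = undefined,
     zero = (\<lambda>x\<in>carrier B. \<zero>\<^bsub>B\<^esub>),
     add = (\<lambda>D E. \<lambda>x\<in>carrier B. D x \<oplus>\<^bsub>B\<^esub> E x),
     smult = (\<lambda>c D. \<lambda>x\<in>carrier B. c \<odot>\<^bsub>B\<^esub> D x)\<rparr>"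

definition lie_subalgebra :: "('k, 'm) ring_scheme \<Rightarrow> ('k, 'a, 'n) module_scheme \<Rightarrow> 'a set \<Rightarrow> bool"
  where "lie_subalgebra K G L \<longleftrightarrow>
    submodule L K G \<and> (\<forall>x\<in>L. \<forall>y\<in>L. x \<otimes>\<^bsub>G\<^esub> y \<in> L)"

definition lie_derived :: "('k, 'm) ring_scheme \<Rightarrow> ('k, 'a, 'n) module_scheme \<Rightarrow> 'a set \<Rightarrow> 'a set"
  where "lie_derived K G L = lie_subalgebra K G hull {x \<otimes>\<^bsub>G\<^esub> y | x y. x \<in> L \<and> y \<in> L}"

definition lie_solvable :: "('k, 'm) ring_scheme \<Rightarrow> ('k, 'a, 'n) module_scheme \<Rightarrow> 'a set \<Rightarrow> bool"
  where "lie_solvable K G L \<longleftrightarrow> (\<exists>d. (lie_derived K G ^^ d) L = {\<zero>\<^bsub>G\<^esub>})"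


section \<open>Local finiteness\<close>

definition fin_dim_subspace ::
    "('k, 'm) ring_scheme \<Rightarrow> ('k, 'b, 'n) module_scheme \<Rightarrow> 'b set \<Rightarrow> bool"
  where "fin_dim_subspace K B U \<longleftrightarrow>
    (\<exists>S. finite S \<and> S \<subseteq> carrier B \<and> U = (\<lambda>W. submodule W K B) hull S)"

definition locally_finite ::
    "('k, 'm) ring_scheme \<Rightarrow> ('k, 'b, 'n) module_scheme \<Rightarrow> ('b \<Rightarrow> 'b) set \<Rightarrow> bool"
  where "locally_finite K B \<Delta> \<longleftrightarrow> \<Delta> \<subseteq> carrier (Der K B) \<and>
    (\<forall>b\<in>carrier B. \<exists>U. fin_dim_subspace K B U \<and> b \<in> U \<and> (\<forall>D\<in>\<Delta>. D ` U \<subseteq> U))"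

definition weakly_locally_finite ::
    "('k, 'm) ring_scheme \<Rightarrow> ('k, 'b, 'n) module_scheme \<Rightarrow> ('b \<Rightarrow> 'b) set \<Rightarrow> bool"
  where "weakly_locally_finite K B \<Delta> \<longleftrightarrow> \<Delta> \<subseteq> carrier (Der K B) \<and>
    (\<forall>F. finite F \<and> F \<subseteq> \<Delta> \<longrightarrow> locally_finite K B F)"


section \<open>The records above are algebras and Lie algebras\<close>

context primeideal
begin

lemma one_notin: "\<one> \<notin> I"
  using I_notcarr one_imp_carrier by blast

lemma mult_notin: "s \<in> carrier R - I \<Longrightarrow> t \<in> carrier R - I \<Longrightarrow> s \<otimes> t \<in> carrier R - I"
  using I_prime[of s t] by auto

lemma loc_frac_refl: "a \<in> carrier R \<Longrightarrow> s \<in> carrier R - I \<Longrightarrow> (a, s) \<in> loc_frac R I a s"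
  using one_notin unfolding loc_frac_def by auto

lemma loc_frac_eqI:
  assumes "a \<in> carrier R" "s \<in> carrier R - I" "b \<in> carrier R" "t \<in> carrier R - I"
    "u \<in> carrier R - I" "u \<otimes> (a \<otimes> t) = u \<otimes> (b \<otimes> s)"
  shows "loc_frac R I a s = loc_frac R I b t"
proof -
  have *: "loc_frac R I a s \<subseteq> loc_frac R I b t"
    if a: "a \<in> carrier R" "s \<in> carrier R - I" "b \<in> carrier R" "t \<in> carrier R - I"
      "u \<in> carrier R - I" and eq: "u \<otimes> (a \<otimes> t) = u \<otimes> (b \<otimes> s)" for a s b t
  proof (rule subsetI)
    fix x assume "x \<in> loc_frac R I a s"
    then obtain c v w where x: "x = (c, v)" and c: "c \<in> carrier R" "v \<in> carrier R" "v \<notin> I"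
      "w \<in> carrier R - I" "w \<otimes> (a \<otimes> v) = w \<otimes> (c \<otimes> s)"
      unfolding loc_frac_def by auto
    have "(w \<otimes> u \<otimes> s) \<otimes> (b \<otimes> v) = w \<otimes> v \<otimes> (u \<otimes> (b \<otimes> s))" using a c(1-4) by (simp add: m_ac)
    also have "\<dots> = u \<otimes> t \<otimes> (w \<otimes> (a \<otimes> v))" unfolding eq[symmetric] using a c(1-4) by (simp add: m_ac)
    also have "\<dots> = (w \<otimes> u \<otimes> s) \<otimes> (c \<otimes> t)" unfolding c(5) using a c(1-4) by (simp add: m_ac)
    finally show "x \<in> loc_frac R I b t"
      unfolding x loc_frac_def using mult_notin[OF mult_notin[OF c(4) a(5)] a(2)] c by blast
  qed
  show ?thesis using *[of a s b t] *[of b t a s] assms by auto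
qed

lemma loc_frac_eq_iff:
  assumes "a \<in> carrier R" "s \<in> carrier R - I" "b \<in> carrier R" "t \<in> carrier R - I"
  shows "loc_frac R I a s = loc_frac R I b t \<longleftrightarrow>
    (\<exists>u \<in> carrier R - I. u \<otimes> (a \<otimes> t) = u \<otimes> (b \<otimes> s))"
proof
  assume "loc_frac R I a s = loc_frac R I b t"
  then have "(b, t) \<in> loc_frac R I a s" using loc_frac_refl[OF assms(3,4)] by simp
  then show "\<exists>u \<in> carrier R - I. u \<otimes> (a \<otimes> t) = u \<otimes> (b \<otimes> s)"
    unfolding loc_frac_def by auto
qed (use loc_frac_eqI[OF assms] in blast)

lemma loc_frac_memD:
  assumes "(b, t) \<in> loc_frac R I a s"
  shows "b \<in> carrier R" "t \<in> carrier R - I"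
    "\<exists>u \<in> carrier R - I. u \<otimes> (a \<otimes> t) = u \<otimes> (b \<otimes> s)"
  using assms unfolding loc_frac_def by auto

lemma loc_frac_UN:
  assumes "a \<in> carrier R" "s \<in> carrier R - I"
    and "\<And>b t. (b, t) \<in> loc_frac R I a s \<Longrightarrow> F b t = F a s"
  shows "(\<Union>(b, t)\<in>loc_frac R I a s. F b t) = F a s"
proof -
  have "(\<Union>(b, t)\<in>loc_frac R I a s. F b t) = (\<Union>x\<in>loc_frac R I a s. F a s)"
    using assms(3) by (intro SUP_cong) auto
  thus ?thesis using loc_frac_refl[OF assms(1,2)] by auto
qed

lemma loc_frac_mult_cong:
  assumes "a \<in> carrier R" "s \<in> carrier R - I" "b \<in> carrier R" "t \<in> carrier R - I"
    "(a', s') \<in> loc_frac R I a s" "(b', t') \<in> loc_frac R I b t"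
  shows "loc_frac R I (a' \<otimes> b') (s' \<otimes> t') = loc_frac R I (a \<otimes> b) (s \<otimes> t)"
proof -
  note d = loc_frac_memD[OF assms(5)] loc_frac_memD[OF assms(6)]
  obtain u where u: "u \<in> carrier R - I" "u \<otimes> (a \<otimes> s') = u \<otimes> (a' \<otimes> s)" using d(3) by auto
  obtain v where v: "v \<in> carrier R - I" "v \<otimes> (b \<otimes> t') = v \<otimes> (b' \<otimes> t)" using d(6) by auto
  have "(u \<otimes> v) \<otimes> (a' \<otimes> b' \<otimes> (s \<otimes> t)) = (u \<otimes> (a' \<otimes> s)) \<otimes> (v \<otimes> (b' \<otimes> t))"
    using d assms(1-4) u(1) v(1) by (simp add: m_ac)
  also have "\<dots> = (u \<otimes> v) \<otimes> (a \<otimes> b \<otimes> (s' \<otimes> t'))"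
    unfolding u(2)[symmetric] v(2)[symmetric] using d assms(1-4) u(1) v(1) by (simp add: m_ac)
  finally show ?thesis
    using d assms(1-4) mult_notin[OF u(1) v(1)] mult_notin[OF assms(2,4)] mult_notin[OF d(2,5)]
    by (intro loc_frac_eqI[where u = "u \<otimes> v"]) auto
qed

lemma loc_frac_add_cong:
  assumes "a \<in> carrier R" "s \<in> carrier R - I" "b \<in> carrier R" "t \<in> carrier R - I"
    "(a', s') \<in> loc_frac R I a s" "(b', t') \<in> loc_frac R I b t"
  shows "loc_frac R I (a' \<otimes> t' \<oplus> b' \<otimes> s') (s' \<otimes> t') = loc_frac R I (a \<otimes> t \<oplus> b \<otimes> s) (s \<otimes> t)"
proof -
  note d = loc_frac_memD[OF assms(5)] loc_frac_memD[OF assms(6)]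
  obtain u where u: "u \<in> carrier R - I" "u \<otimes> (a \<otimes> s') = u \<otimes> (a' \<otimes> s)" using d(3) by auto
  obtain v where v: "v \<in> carrier R - I" "v \<otimes> (b \<otimes> t') = v \<otimes> (b' \<otimes> t)" using d(6) by auto
  have "(u \<otimes> v) \<otimes> ((a' \<otimes> t' \<oplus> b' \<otimes> s') \<otimes> (s \<otimes> t)) =
      (u \<otimes> (a' \<otimes> s)) \<otimes> (v \<otimes> t \<otimes> t') \<oplus> (v \<otimes> (b' \<otimes> t)) \<otimes> (u \<otimes> s \<otimes> s')"
    using d assms(1-4) u(1) v(1) by (simp add: m_ac l_distr r_distr)
  also have "\<dots> = (u \<otimes> v) \<otimes> ((a \<otimes> t \<oplus> b \<otimes> s) \<otimes> (s' \<otimes> t'))"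
    unfolding u(2)[symmetric] v(2)[symmetric] using d assms(1-4) u(1) v(1)
    by (simp add: m_ac l_distr r_distr)
  finally show ?thesis
    using d assms(1-4) mult_notin[OF u(1) v(1)] mult_notin[OF assms(2,4)] mult_notin[OF d(2,5)]
    by (intro loc_frac_eqI[where u = "u \<otimes> v"]) auto
qed

end

lemma localization_carrierI:
  "a \<in> carrier A \<Longrightarrow> s \<in> carrier A - P \<Longrightarrow> loc_frac A P a s \<in> carrier (localization A P)"
  unfolding localization_def by auto

lemma localization_carrierE:
  assumes "X \<in> carrier (localization A P)"
  obtains a s where "a \<in> carrier A" "s \<in> carrier A - P" "X = loc_frac A P a s"
  using assms unfolding localization_def by auto

lemma localization_simps:
  assumes "algebra K A" "primeideal P A" "a \<in> carrier A" "s \<in> carrier A - P"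
  shows "b \<in> carrier A \<Longrightarrow> t \<in> carrier A - P \<Longrightarrow>
      loc_frac A P a s \<otimes>\<^bsub>localization A P\<^esub> loc_frac A P b t =
        loc_frac A P (a \<otimes>\<^bsub>A\<^esub> b) (s \<otimes>\<^bsub>A\<^esub> t)"
    and "b \<in> carrier A \<Longrightarrow> t \<in> carrier A - P \<Longrightarrow>
      loc_frac A P a s \<oplus>\<^bsub>localization A P\<^esub> loc_frac A P b t =
        loc_frac A P (a \<otimes>\<^bsub>A\<^esub> t \<oplus>\<^bsub>A\<^esub> b \<otimes>\<^bsub>A\<^esub> s) (s \<otimes>\<^bsub>A\<^esub> t)"
    and "c \<in> carrier K \<Longrightarrow>
      c \<odot>\<^bsub>localization A P\<^esub> loc_frac A P a s = loc_frac A P (c \<odot>\<^bsub>A\<^esub> a) s"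
proof -
  interpret A: cring A using assms(1) by (rule algebra.M_cring)
  interpret algebra K A by fact
  interpret P: primeideal P A by fact
  show "loc_frac A P a s \<otimes>\<^bsub>localization A P\<^esub> loc_frac A P b t =
      loc_frac A P (a \<otimes>\<^bsub>A\<^esub> b) (s \<otimes>\<^bsub>A\<^esub> t)" if bt: "b \<in> carrier A" "t \<in> carrier A - P" for b t
  proof -
    have "(\<Union>(b', t')\<in>loc_frac A P b t. loc_frac A P (a' \<otimes>\<^bsub>A\<^esub> b') (s' \<otimes>\<^bsub>A\<^esub> t')) =
        loc_frac A P (a \<otimes>\<^bsub>A\<^esub> b) (s \<otimes>\<^bsub>A\<^esub> t)" if "(a', s') \<in> loc_frac A P a s" for a' s'
      using P.loc_frac_mult_cong[OF assms(3,4) bt that] P.loc_frac_refl[OF bt] bt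
      by (subst P.loc_frac_UN) auto
    then show ?thesis unfolding localization_def
      using P.loc_frac_refl[OF assms(3,4)]
      by (simp, subst P.loc_frac_UN) (use assms in auto)
  qed
  show "loc_frac A P a s \<oplus>\<^bsub>localization A P\<^esub> loc_frac A P b t =
      loc_frac A P (a \<otimes>\<^bsub>A\<^esub> t \<oplus>\<^bsub>A\<^esub> b \<otimes>\<^bsub>A\<^esub> s) (s \<otimes>\<^bsub>A\<^esub> t)" if bt: "b \<in> carrier A" "t \<in> carrier A - P" for b t
  proof -
    have "(\<Union>(b', t')\<in>loc_frac A P b t. loc_frac A P (a' \<otimes>\<^bsub>A\<^esub> t' \<oplus>\<^bsub>A\<^esub> b' \<otimes>\<^bsub>A\<^esub> s') (s' \<otimes>\<^bsub>A\<^esub> t')) =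
        loc_frac A P (a \<otimes>\<^bsub>A\<^esub> t \<oplus>\<^bsub>A\<^esub> b \<otimes>\<^bsub>A\<^esub> s) (s \<otimes>\<^bsub>A\<^esub> t)" if "(a', s') \<in> loc_frac A P a s" for a' s'
      using P.loc_frac_add_cong[OF assms(3,4) bt that] P.loc_frac_refl[OF bt] bt
      by (subst P.loc_frac_UN) auto
    then show ?thesis unfolding localization_def
      using P.loc_frac_refl[OF assms(3,4)]
      by (simp, subst P.loc_frac_UN) (use assms in auto)
  qed
  show "c \<odot>\<^bsub>localization A P\<^esub> loc_frac A P a s = loc_frac A P (c \<odot>\<^bsub>A\<^esub> a) s" if c: "c \<in> carrier K"
  proof -
    have "loc_frac A P (c \<odot>\<^bsub>A\<^esub> a') s' = loc_frac A P (c \<odot>\<^bsub>A\<^esub> a) s" if as: "(a', s') \<in> loc_frac A P a s" for a' s'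
    proof -
      note d = P.loc_frac_memD[OF as]
      obtain u where u: "u \<in> carrier A - P" "u \<otimes>\<^bsub>A\<^esub> (a \<otimes>\<^bsub>A\<^esub> s') = u \<otimes>\<^bsub>A\<^esub> (a' \<otimes>\<^bsub>A\<^esub> s)" using d(3) by auto
      have sm: "u \<otimes>\<^bsub>A\<^esub> (c \<odot>\<^bsub>A\<^esub> x) = c \<odot>\<^bsub>A\<^esub> (u \<otimes>\<^bsub>A\<^esub> x)" if "x \<in> carrier A" for x
        using smult_assoc2[of c x u] c u(1) that by (simp add: A.m_comm)
      have "u \<otimes>\<^bsub>A\<^esub> ((c \<odot>\<^bsub>A\<^esub> a') \<otimes>\<^bsub>A\<^esub> s) = u \<otimes>\<^bsub>A\<^esub> ((c \<odot>\<^bsub>A\<^esub> a) \<otimes>\<^bsub>A\<^esub> s')"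
        using d assms c u by (simp add: smult_assoc2 sm)
      thus ?thesis using d assms c u by (intro P.loc_frac_eqI) auto
    qed
    then show ?thesis unfolding localization_def by (simp, subst P.loc_frac_UN) (use assms in auto)
  qed
qed

lemma algebra_localization:
  assumes "algebra K A" "primeideal P A"
  shows "algebra K (localization A P)"
proof -
  interpret A: cring A using assms(1) by (rule algebra.M_cring)
  interpret algebra K A by fact
  interpret P: primeideal P A by fact
  note S = localization_simps[OF assms]
  note I = localization_carrierI[of _ A _ P]
  note mn = P.mult_notin P.one_notin
  have eqI: "loc_frac A P a s = loc_frac A P b t"
    if "a \<in> carrier A" "s \<in> carrier A - P" "b \<in> carrier A" "t \<in> carrier A - P" "a \<otimes>\<^bsub>A\<^esub> t = b \<otimes>\<^bsub>A\<^esub> s"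
    for a s b t
    using that P.one_notin by (intro P.loc_frac_eqI[where u = "\<one>\<^bsub>A\<^esub>"]) auto
  have z: "\<zero>\<^bsub>localization A P\<^esub> = loc_frac A P \<zero>\<^bsub>A\<^esub> \<one>\<^bsub>A\<^esub>"
    and o: "\<one>\<^bsub>localization A P\<^esub> = loc_frac A P \<one>\<^bsub>A\<^esub> \<one>\<^bsub>A\<^esub>"
    unfolding localization_def by auto
  have one: "\<one>\<^bsub>A\<^esub> \<in> carrier A - P" using P.one_notin by auto
  have sm: "x \<otimes>\<^bsub>A\<^esub> (c \<odot>\<^bsub>A\<^esub> y) = c \<odot>\<^bsub>A\<^esub> (x \<otimes>\<^bsub>A\<^esub> y)"
    if "c \<in> carrier K" "x \<in> carrier A" "y \<in> carrier A" for c x y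
    using smult_assoc2[of c y x] that by (simp add: A.m_comm)
  show ?thesis
  proof (rule algebraI)
    show "cring K" ..
    show "cring (localization A P)"
    proof (rule cringI)
      show "abelian_group (localization A P)"
      proof (rule abelian_groupI)
        fix X assume X: "X \<in> carrier (localization A P)"
        then obtain a s where a: "a \<in> carrier A" "s \<in> carrier A - P" "X = loc_frac A P a s"
          by (rule localization_carrierE)
        show "\<zero>\<^bsub>localization A P\<^esub> \<oplus>\<^bsub>localization A P\<^esub> X = X"
          unfolding z a(3) using a one by (simp add: S)
        show "\<exists>Y\<in>carrier (localization A P). Y \<oplus>\<^bsub>localization A P\<^esub> X = \<zero>\<^bsub>localization A P\<^esub>"
        proof (rule bexI)
          show "loc_frac A P (\<ominus>\<^bsub>A\<^esub> a) s \<oplus>\<^bsub>localization A P\<^esub> X = \<zero>\<^bsub>localization A P\<^esub>"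
            unfolding z a(3) using a one P.mult_notin[of s s]
            by (simp add: S, intro eqI) (auto simp: A.l_minus A.l_neg)
          show "loc_frac A P (\<ominus>\<^bsub>A\<^esub> a) s \<in> carrier (localization A P)" using a by (intro I) auto
        qed
        fix Y assume Y: "Y \<in> carrier (localization A P)"
        then obtain b t where b: "b \<in> carrier A" "t \<in> carrier A - P" "Y = loc_frac A P b t"
          by (rule localization_carrierE)
        show "X \<oplus>\<^bsub>localization A P\<^esub> Y \<in> carrier (localization A P)"
          unfolding a(3) b(3) using a b P.mult_notin[of s t] by (subst S(2)) (auto intro!: I)
        show "X \<oplus>\<^bsub>localization A P\<^esub> Y = Y \<oplus>\<^bsub>localization A P\<^esub> X"
          unfolding a(3) b(3) using a b P.mult_notin[of s t] by (simp add: S A.m_ac A.a_ac)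
        fix Z assume Z: "Z \<in> carrier (localization A P)"
        then obtain c u where c: "c \<in> carrier A" "u \<in> carrier A - P" "Z = loc_frac A P c u"
          by (rule localization_carrierE)
        show "X \<oplus>\<^bsub>localization A P\<^esub> Y \<oplus>\<^bsub>localization A P\<^esub> Z = X \<oplus>\<^bsub>localization A P\<^esub> (Y \<oplus>\<^bsub>localization A P\<^esub> Z)"
          unfolding a(3) b(3) c(3) using a b c P.mult_notin[of s t] P.mult_notin[of t u]
          by (simp add: S A.m_ac A.a_ac A.l_distr A.r_distr)
      next
        show "\<zero>\<^bsub>localization A P\<^esub> \<in> carrier (localization A P)"
          unfolding z using one by (auto intro!: I)
      qed
      show "Group.comm_monoid (localization A P)"
      proof (rule comm_monoidI)
        show "\<one>\<^bsub>localization A P\<^esub> \<in> carrier (localization A P)"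
          unfolding o using one by (auto intro!: I)
        fix X assume X: "X \<in> carrier (localization A P)"
        then obtain a s where a: "a \<in> carrier A" "s \<in> carrier A - P" "X = loc_frac A P a s"
          by (rule localization_carrierE)
        show "\<one>\<^bsub>localization A P\<^esub> \<otimes>\<^bsub>localization A P\<^esub> X = X"
          unfolding o a(3) using a one by (simp add: S)
        fix Y assume Y: "Y \<in> carrier (localization A P)"
        then obtain b t where b: "b \<in> carrier A" "t \<in> carrier A - P" "Y = loc_frac A P b t"
          by (rule localization_carrierE)
        show "X \<otimes>\<^bsub>localization A P\<^esub> Y \<in> carrier (localization A P)"
          unfolding a(3) b(3) using a b P.mult_notin[of s t] by (subst S(1)) (auto intro!: I)
        show "X \<otimes>\<^bsub>localization A P\<^esub> Y = Y \<otimes>\<^bsub>localization A P\<^esub> X"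
          unfolding a(3) b(3) using a b P.mult_notin[of s t] by (simp add: S A.m_ac)
        fix Z assume Z: "Z \<in> carrier (localization A P)"
        then obtain c u where c: "c \<in> carrier A" "u \<in> carrier A - P" "Z = loc_frac A P c u"
          by (rule localization_carrierE)
        show "X \<otimes>\<^bsub>localization A P\<^esub> Y \<otimes>\<^bsub>localization A P\<^esub> Z = X \<otimes>\<^bsub>localization A P\<^esub> (Y \<otimes>\<^bsub>localization A P\<^esub> Z)"
          unfolding a(3) b(3) c(3) using a b c P.mult_notin[of s t] P.mult_notin[of t u]
          by (simp add: S A.m_ac)
      qed
      fix X Y Z assume "X \<in> carrier (localization A P)" "Y \<in> carrier (localization A P)"
        "Z \<in> carrier (localization A P)"
      then obtain a s b t c u where a: "a \<in> carrier A" "s \<in> carrier A - P" "X = loc_frac A P a s"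
        and b: "b \<in> carrier A" "t \<in> carrier A - P" "Y = loc_frac A P b t"
        and c: "c \<in> carrier A" "u \<in> carrier A - P" "Z = loc_frac A P c u"
        by (elim localization_carrierE) blast
      show "(X \<oplus>\<^bsub>localization A P\<^esub> Y) \<otimes>\<^bsub>localization A P\<^esub> Z =
          X \<otimes>\<^bsub>localization A P\<^esub> Z \<oplus>\<^bsub>localization A P\<^esub> Y \<otimes>\<^bsub>localization A P\<^esub> Z"
        unfolding a(3) b(3) c(3)
        using a b c P.mult_notin[of s t] P.mult_notin[of t u] P.mult_notin[of s u]
          P.mult_notin[OF P.mult_notin[of s t] c(2)] P.mult_notin[OF P.mult_notin[of s u] P.mult_notin[of t u]]
        by (simp add: S, intro eqI) (auto simp: A.m_ac A.a_ac A.l_distr A.r_distr)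
    qed
  next
    fix k X assume k: "k \<in> carrier K" and "X \<in> carrier (localization A P)"
    then obtain a s where a: "a \<in> carrier A" "s \<in> carrier A - P" "X = loc_frac A P a s"
      by (elim localization_carrierE)
    show "k \<odot>\<^bsub>localization A P\<^esub> X \<in> carrier (localization A P)"
      unfolding a(3) using a k by (subst S(3)) (auto intro!: I)
    fix l assume l: "l \<in> carrier K"
    show "(k \<oplus>\<^bsub>K\<^esub> l) \<odot>\<^bsub>localization A P\<^esub> X = k \<odot>\<^bsub>localization A P\<^esub> X \<oplus>\<^bsub>localization A P\<^esub> l \<odot>\<^bsub>localization A P\<^esub> X"
      unfolding a(3) using a k l P.mult_notin[of s s]
      by (simp add: S, intro eqI) (auto simp: smult_l_distr smult_assoc2 sm A.m_ac A.l_distr A.r_distr)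
    show "(k \<otimes>\<^bsub>K\<^esub> l) \<odot>\<^bsub>localization A P\<^esub> X = k \<odot>\<^bsub>localization A P\<^esub> (l \<odot>\<^bsub>localization A P\<^esub> X)"
      unfolding a(3) using a k l by (simp add: S smult_assoc1)
  next
    fix X assume "X \<in> carrier (localization A P)"
    then obtain a s where a: "a \<in> carrier A" "s \<in> carrier A - P" "X = loc_frac A P a s"
      by (elim localization_carrierE)
    show "\<one>\<^bsub>K\<^esub> \<odot>\<^bsub>localization A P\<^esub> X = X" unfolding a(3) using a by (simp add: S)
  next
    fix k X Y assume k: "k \<in> carrier K" and "X \<in> carrier (localization A P)" "Y \<in> carrier (localization A P)"
    then obtain a s b t where a: "a \<in> carrier A" "s \<in> carrier A - P" "X = loc_frac A P a s"
      and b: "b \<in> carrier A" "t \<in> carrier A - P" "Y = loc_frac A P b t"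
      by (elim localization_carrierE) blast
    show "k \<odot>\<^bsub>localization A P\<^esub> (X \<oplus>\<^bsub>localization A P\<^esub> Y) = k \<odot>\<^bsub>localization A P\<^esub> X \<oplus>\<^bsub>localization A P\<^esub> k \<odot>\<^bsub>localization A P\<^esub> Y"
      unfolding a(3) b(3) using a b k P.mult_notin[of s t] by (simp add: S smult_r_distr smult_assoc2)
    show "(k \<odot>\<^bsub>localization A P\<^esub> X) \<otimes>\<^bsub>localization A P\<^esub> Y = k \<odot>\<^bsub>localization A P\<^esub> (X \<otimes>\<^bsub>localization A P\<^esub> Y)"
      unfolding a(3) b(3) using a b k P.mult_notin[of s t] by (simp add: S smult_assoc2)
  qed
qed

lemma zariski_open_Int:
  assumes "zariski_open A V" "zariski_open A W"
  shows "zariski_open A (V \<inter> W)"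
proof -
  obtain I J where I: "ideal I A" "V = {P \<in> Spec A. \<not> I \<subseteq> P}"
    and J: "ideal J A" "W = {P \<in> Spec A. \<not> J \<subseteq> P}"
    using assms unfolding zariski_open_def by auto
  interpret I: ideal I A by fact
  interpret J: ideal J A by fact
  have "I \<subseteq> P \<or> J \<subseteq> P" if P: "P \<in> Spec A" and IJ: "I \<inter> J \<subseteq> P" for P
  proof (rule ccontr)
    interpret P: primeideal P A using P by (simp add: Spec_def)
    assume "\<not> (I \<subseteq> P \<or> J \<subseteq> P)"
    then obtain i j where ij: "i \<in> I" "i \<notin> P" "j \<in> J" "j \<notin> P" by auto
    then have c: "i \<in> carrier A" "j \<in> carrier A" using I.a_subset J.a_subset by auto
    have "i \<otimes>\<^bsub>A\<^esub> j \<in> I \<inter> J" using I.I_r_closed J.I_l_closed ij c by auto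
    then show False using P.I_prime[OF c] IJ ij by auto
  qed
  then have "I \<inter> J \<subseteq> P \<longleftrightarrow> I \<subseteq> P \<or> J \<subseteq> P" if "P \<in> Spec A" for P using that by blast
  then have "V \<inter> W = {P \<in> Spec A. \<not> I \<inter> J \<subseteq> P}" unfolding I(2) J(2) by (simp add: set_eq_iff conj_ac) blast
  moreover have "ideal (I \<inter> J) A" by (rule I.i_intersect[OF I(1) J(1)])
  ultimately show ?thesis unfolding zariski_open_def by blast
qed

lemma regular_functionsI:
  assumes "f \<in> extensional U" "\<And>P. P \<in> U \<Longrightarrow> f P \<in> carrier (localization A P)"
    and "\<And>P. P \<in> U \<Longrightarrow> \<exists>V. zariski_open A V \<and> P \<in> V \<and> V \<subseteq> U \<and>
      (\<exists>a\<in>carrier A. \<exists>s\<in>carrier A. \<forall>Q\<in>V. s \<notin> Q \<and> f Q = loc_frac A Q a s)"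
  shows "f \<in> regular_functions A U"
  unfolding regular_functions_def PiE_def Pi_def using assms by simp

lemma locally_fracI:
  assumes "zariski_open A V" "P \<in> V" "V \<subseteq> U" "a \<in> carrier A" "s \<in> carrier A"
    and "\<And>Q. Q \<in> V \<Longrightarrow> s \<notin> Q" "\<And>Q. Q \<in> V \<Longrightarrow> f Q = loc_frac A Q a s"
  shows "\<exists>V. zariski_open A V \<and> P \<in> V \<and> V \<subseteq> U \<and>
    (\<exists>a\<in>carrier A. \<exists>s\<in>carrier A. \<forall>Q\<in>V. s \<notin> Q \<and> f Q = loc_frac A Q a s)"
  by (rule exI[of _ V]) (use assms in auto)

lemma regular_functionsD:
  assumes "f \<in> regular_functions A U"
  shows "f \<in> extensional U" "\<And>P. P \<in> U \<Longrightarrow> f P \<in> carrier (localization A P)"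
    and "\<And>P. P \<in> U \<Longrightarrow> \<exists>V. zariski_open A V \<and> P \<in> V \<and> V \<subseteq> U \<and>
      (\<exists>a\<in>carrier A. \<exists>s\<in>carrier A. \<forall>Q\<in>V. s \<notin> Q \<and> f Q = loc_frac A Q a s)"
  using assms unfolding regular_functions_def PiE_def Pi_def by simp_all

lemma algebra_structure_sheaf:
  assumes "algebra K A" "zariski_open A U"
  shows "algebra K (structure_sheaf A U)"
proof -
  interpret A: cring A using assms(1) by (rule algebra.M_cring)
  interpret algebra K A by fact
  have prime: "primeideal P A" if "P \<in> U" for P
    using that assms(2) unfolding zariski_open_def Spec_def by auto
  have alg: "algebra K (localization A P)" if "P \<in> U" for P
    by (rule algebra_localization[OF assms(1) prime[OF that]])
  note S = localization_simps[OF assms(1)]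
  note D = regular_functionsD
  let ?B = "structure_sheaf A U"
  have car: "carrier ?B = regular_functions A U"
    and m: "\<And>f g. f \<otimes>\<^bsub>?B\<^esub> g = (\<lambda>P\<in>U. f P \<otimes>\<^bsub>localization A P\<^esub> g P)"
    and pl: "\<And>f g. f \<oplus>\<^bsub>?B\<^esub> g = (\<lambda>P\<in>U. f P \<oplus>\<^bsub>localization A P\<^esub> g P)"
    and sm: "\<And>c f. c \<odot>\<^bsub>?B\<^esub> f = (\<lambda>P\<in>U. c \<odot>\<^bsub>localization A P\<^esub> f P)"
    and z: "\<zero>\<^bsub>?B\<^esub> = (\<lambda>P\<in>U. \<zero>\<^bsub>localization A P\<^esub>)"
    and o: "\<one>\<^bsub>?B\<^esub> = (\<lambda>P\<in>U. \<one>\<^bsub>localization A P\<^esub>)"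
    unfolding structure_sheaf_def by simp_all
  have eqI: "f = g" if "f \<in> extensional U" "g \<in> extensional U" "\<And>P. P \<in> U \<Longrightarrow> f P = g P" for f g :: "'c set \<Rightarrow> ('c \<times> 'c) set"
    using extensionalityI[OF that] .
  have binary: "(\<lambda>P\<in>U. op P (f P) (g P)) \<in> regular_functions A U"
    if f: "f \<in> regular_functions A U" and g: "g \<in> regular_functions A U"
      and cl: "\<And>P X Y. P \<in> U \<Longrightarrow> X \<in> carrier (localization A P) \<Longrightarrow> Y \<in> carrier (localization A P) \<Longrightarrow>
        op P X Y \<in> carrier (localization A P)"
      and n: "\<And>a s b t. a \<in> carrier A \<Longrightarrow> s \<in> carrier A \<Longrightarrow> b \<in> carrier A \<Longrightarrow> t \<in> carrier A \<Longrightarrow>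
        num a s b t \<in> carrier A"
      and op: "\<And>P a s b t. P \<in> U \<Longrightarrow> a \<in> carrier A \<Longrightarrow> s \<in> carrier A - P \<Longrightarrow> b \<in> carrier A \<Longrightarrow>
        t \<in> carrier A - P \<Longrightarrow>
        op P (loc_frac A P a s) (loc_frac A P b t) = loc_frac A P (num a s b t) (s \<otimes>\<^bsub>A\<^esub> t)"
    for f g op num
  proof (rule regular_functionsI)
    fix P assume P: "P \<in> U"
    show "(\<lambda>P\<in>U. op P (f P) (g P)) P \<in> carrier (localization A P)"
      using P cl D(2)[OF f P] D(2)[OF g P] by simp
    obtain V a s where V: "zariski_open A V" "P \<in> V" "V \<subseteq> U" "a \<in> carrier A" "s \<in> carrier A"
      "\<forall>Q\<in>V. s \<notin> Q \<and> f Q = loc_frac A Q a s" using D(3)[OF f P] by auto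
    obtain W b t where W: "zariski_open A W" "P \<in> W" "W \<subseteq> U" "b \<in> carrier A" "t \<in> carrier A"
      "\<forall>Q\<in>W. t \<notin> Q \<and> g Q = loc_frac A Q b t" using D(3)[OF g P] by auto
    have ex: "s \<otimes>\<^bsub>A\<^esub> t \<notin> Q \<and> (\<lambda>P\<in>U. op P (f P) (g P)) Q = loc_frac A Q (num a s b t) (s \<otimes>\<^bsub>A\<^esub> t)"
      if Q: "Q \<in> V \<inter> W" for Q
    proof -
      have QU: "Q \<in> U" using Q V by auto
      interpret Q: primeideal Q A by (rule prime[OF QU])
      have "s \<notin> Q" "t \<notin> Q" "f Q = loc_frac A Q a s" "g Q = loc_frac A Q b t" using Q V(6) W(6) by auto
      then show ?thesis using QU V W Q.mult_notin[of s t] by (simp add: op)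
    qed
    show "\<exists>V. zariski_open A V \<and> P \<in> V \<and> V \<subseteq> U \<and> (\<exists>a'\<in>carrier A. \<exists>s'\<in>carrier A.
        \<forall>Q\<in>V. s' \<notin> Q \<and> (\<lambda>P\<in>U. op P (f P) (g P)) Q = loc_frac A Q a' s')"
      by (rule locally_fracI[OF zariski_open_Int[OF V(1) W(1)] _ _ n[OF V(4,5) W(4,5)]
            A.m_closed[OF V(5) W(5)]]) (use V(2,3) W(2) ex in blast)+
  qed simp
  have const: "(\<lambda>P\<in>U. loc_frac A P a \<one>\<^bsub>A\<^esub>) \<in> regular_functions A U" if a: "a \<in> carrier A" for a
  proof (rule regular_functionsI)
    fix P assume P: "P \<in> U"
    show "(\<lambda>P\<in>U. loc_frac A P a \<one>\<^bsub>A\<^esub>) P \<in> carrier (localization A P)"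
      using primeideal.one_notin[OF prime[OF P]] P a by (simp add: localization_carrierI)
    show "\<exists>V. zariski_open A V \<and> P \<in> V \<and> V \<subseteq> U \<and> (\<exists>a'\<in>carrier A. \<exists>s'\<in>carrier A.
        \<forall>Q\<in>V. s' \<notin> Q \<and> (\<lambda>P\<in>U. loc_frac A P a \<one>\<^bsub>A\<^esub>) Q = loc_frac A Q a' s')"
      by (rule locally_fracI[OF assms(2) P order_refl a A.one_closed])
        (use primeideal.one_notin[OF prime] in auto)
  qed simp
  have mc: "f \<otimes>\<^bsub>?B\<^esub> g \<in> carrier ?B" if "f \<in> carrier ?B" "g \<in> carrier ?B" for f g
    unfolding m car
  proof (rule binary[OF that[unfolded car], where num = "\<lambda>a s b t. a \<otimes>\<^bsub>A\<^esub> b"])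
    fix P X Y assume "P \<in> U" "X \<in> carrier (localization A P)" "Y \<in> carrier (localization A P)"
    then show "X \<otimes>\<^bsub>localization A P\<^esub> Y \<in> carrier (localization A P)"
      using cring.cring_simprules(5)[OF algebra.M_cring[OF alg]] by blast
  qed (use S(1)[OF prime] in auto)
  have pc: "f \<oplus>\<^bsub>?B\<^esub> g \<in> carrier ?B" if "f \<in> carrier ?B" "g \<in> carrier ?B" for f g
    unfolding pl car
  proof (rule binary[OF that[unfolded car], where num = "\<lambda>a s b t. a \<otimes>\<^bsub>A\<^esub> t \<oplus>\<^bsub>A\<^esub> b \<otimes>\<^bsub>A\<^esub> s"])
    fix P X Y assume "P \<in> U" "X \<in> carrier (localization A P)" "Y \<in> carrier (localization A P)"
    then show "X \<oplus>\<^bsub>localization A P\<^esub> Y \<in> carrier (localization A P)"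
      using cring.cring_simprules(1)[OF algebra.M_cring[OF alg]] by blast
  qed (use S(2)[OF prime] in auto)
  have zc: "\<zero>\<^bsub>?B\<^esub> \<in> carrier ?B" and oc: "\<one>\<^bsub>?B\<^esub> \<in> carrier ?B"
    using const[of "\<zero>\<^bsub>A\<^esub>"] const[of "\<one>\<^bsub>A\<^esub>"] unfolding z o car localization_def by simp_all
  have ext: "f \<in> extensional U" if "f \<in> carrier ?B" for f using D(1) that car by blast
  have val: "f P \<in> carrier (localization A P)" if "f \<in> carrier ?B" "P \<in> U" for f P
    using D(2) that car by blast
  have scal: "c \<odot>\<^bsub>?B\<^esub> f = (\<lambda>P\<in>U. loc_frac A P (c \<odot>\<^bsub>A\<^esub> \<one>\<^bsub>A\<^esub>) \<one>\<^bsub>A\<^esub>) \<otimes>\<^bsub>?B\<^esub> f"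
    if c: "c \<in> carrier K" and f: "f \<in> carrier ?B" for c f
    unfolding sm m
  proof (rule restrict_ext)
    fix P assume P: "P \<in> U"
    interpret P: primeideal P A by (rule prime[OF P])
    obtain a s where a: "a \<in> carrier A" "s \<in> carrier A - P" "f P = loc_frac A P a s"
      using localization_carrierE[OF val[OF f P]] .
    show "c \<odot>\<^bsub>localization A P\<^esub> f P = (\<lambda>P\<in>U. loc_frac A P (c \<odot>\<^bsub>A\<^esub> \<one>\<^bsub>A\<^esub>) \<one>\<^bsub>A\<^esub>) P \<otimes>\<^bsub>localization A P\<^esub> f P"
      using P a c P.one_notin by (simp add: S(1,3)[OF P.primeideal] smult_assoc2)
  qed
  have sc: "c \<odot>\<^bsub>?B\<^esub> f \<in> carrier ?B" if "c \<in> carrier K" "f \<in> carrier ?B" for c f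
    unfolding scal[OF that] using that const[of "c \<odot>\<^bsub>A\<^esub> \<one>\<^bsub>A\<^esub>"] by (intro mc) (auto simp: car)
  note exts = ext[OF mc] ext[OF pc] ext[OF zc] ext[OF oc] ext[OF sc]
  have L: "cring (localization A P)" if "P \<in> U" for P by (rule algebra.M_cring[OF alg[OF that]])
  show ?thesis
  proof (rule algebraI)
    show "cring K" by (rule R_cring)
    show "cring ?B"
    proof (rule cringI)
      show "abelian_group ?B"
      proof (rule abelian_groupI)
        fix f assume f: "f \<in> carrier ?B"
        show "\<zero>\<^bsub>?B\<^esub> \<oplus>\<^bsub>?B\<^esub> f = f"
        proof (rule eqI)
          fix P assume P: "P \<in> U"
          interpret L: cring "localization A P" by (rule L[OF P])
          show "(\<zero>\<^bsub>?B\<^esub> \<oplus>\<^bsub>?B\<^esub> f) P = f P" using P val[OF f P] by (simp add: z pl)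
        qed (rule exts ext f zc)+
        show "\<exists>g\<in>carrier ?B. g \<oplus>\<^bsub>?B\<^esub> f = \<zero>\<^bsub>?B\<^esub>"
        proof (rule bexI)
          show n: "(\<ominus>\<^bsub>K\<^esub> \<one>\<^bsub>K\<^esub>) \<odot>\<^bsub>?B\<^esub> f \<in> carrier ?B" by (rule sc) (use f in auto)
          show "(\<ominus>\<^bsub>K\<^esub> \<one>\<^bsub>K\<^esub>) \<odot>\<^bsub>?B\<^esub> f \<oplus>\<^bsub>?B\<^esub> f = \<zero>\<^bsub>?B\<^esub>"
          proof (rule eqI)
            fix P assume P: "P \<in> U"
            interpret L: algebra K "localization A P" by (rule alg[OF P])
            show "((\<ominus>\<^bsub>K\<^esub> \<one>\<^bsub>K\<^esub>) \<odot>\<^bsub>?B\<^esub> f \<oplus>\<^bsub>?B\<^esub> f) P = \<zero>\<^bsub>?B\<^esub> P"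
              using P val[OF f P] by (simp add: pl sm z L.smult_l_minus L.M.l_neg)
          qed (rule exts n f)+
        qed
        fix g assume g: "g \<in> carrier ?B"
        show "f \<oplus>\<^bsub>?B\<^esub> g \<in> carrier ?B" by (rule pc[OF f g])
        show "f \<oplus>\<^bsub>?B\<^esub> g = g \<oplus>\<^bsub>?B\<^esub> f"
          unfolding pl
        proof (rule restrict_ext)
          fix P assume P: "P \<in> U"
          interpret L: cring "localization A P" by (rule L[OF P])
          show "f P \<oplus>\<^bsub>localization A P\<^esub> g P = g P \<oplus>\<^bsub>localization A P\<^esub> f P"
            by (rule L.a_comm[OF val[OF f P] val[OF g P]])
        qed
        fix h assume h: "h \<in> carrier ?B"
        show "f \<oplus>\<^bsub>?B\<^esub> g \<oplus>\<^bsub>?B\<^esub> h = f \<oplus>\<^bsub>?B\<^esub> (g \<oplus>\<^bsub>?B\<^esub> h)"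
          unfolding pl
        proof (rule restrict_ext)
          fix P assume P: "P \<in> U"
          interpret L: cring "localization A P" by (rule L[OF P])
          show "(\<lambda>P\<in>U. f P \<oplus>\<^bsub>localization A P\<^esub> g P) P \<oplus>\<^bsub>localization A P\<^esub> h P =
              f P \<oplus>\<^bsub>localization A P\<^esub> (\<lambda>P\<in>U. g P \<oplus>\<^bsub>localization A P\<^esub> h P) P"
            using P L.a_assoc[OF val[OF f P] val[OF g P] val[OF h P]] by simp
        qed
      qed (rule zc)
      show "Group.comm_monoid ?B"
      proof (rule comm_monoidI)
        fix f assume f: "f \<in> carrier ?B"
        show "\<one>\<^bsub>?B\<^esub> \<otimes>\<^bsub>?B\<^esub> f = f"
        proof (rule eqI)
          fix P assume P: "P \<in> U"
          interpret L: cring "localization A P" by (rule L[OF P])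
          show "(\<one>\<^bsub>?B\<^esub> \<otimes>\<^bsub>?B\<^esub> f) P = f P" using P val[OF f P] by (simp add: o m)
        qed (rule exts ext f oc)+
        fix g assume g: "g \<in> carrier ?B"
        show "f \<otimes>\<^bsub>?B\<^esub> g \<in> carrier ?B" by (rule mc[OF f g])
        show "f \<otimes>\<^bsub>?B\<^esub> g = g \<otimes>\<^bsub>?B\<^esub> f"
          unfolding m
        proof (rule restrict_ext)
          fix P assume P: "P \<in> U"
          interpret L: cring "localization A P" by (rule L[OF P])
          show "f P \<otimes>\<^bsub>localization A P\<^esub> g P = g P \<otimes>\<^bsub>localization A P\<^esub> f P"
            by (rule L.m_comm[OF val[OF f P] val[OF g P]])
        qed
        fix h assume h: "h \<in> carrier ?B"
        show "f \<otimes>\<^bsub>?B\<^esub> g \<otimes>\<^bsub>?B\<^esub> h = f \<otimes>\<^bsub>?B\<^esub> (g \<otimes>\<^bsub>?B\<^esub> h)"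
          unfolding m
        proof (rule restrict_ext)
          fix P assume P: "P \<in> U"
          interpret L: cring "localization A P" by (rule L[OF P])
          show "(\<lambda>P\<in>U. f P \<otimes>\<^bsub>localization A P\<^esub> g P) P \<otimes>\<^bsub>localization A P\<^esub> h P =
              f P \<otimes>\<^bsub>localization A P\<^esub> (\<lambda>P\<in>U. g P \<otimes>\<^bsub>localization A P\<^esub> h P) P"
            using P L.m_assoc[OF val[OF f P] val[OF g P] val[OF h P]] by simp
        qed
      qed (rule oc)
      fix f g h assume f: "f \<in> carrier ?B" and g: "g \<in> carrier ?B" and h: "h \<in> carrier ?B"
      show "(f \<oplus>\<^bsub>?B\<^esub> g) \<otimes>\<^bsub>?B\<^esub> h = f \<otimes>\<^bsub>?B\<^esub> h \<oplus>\<^bsub>?B\<^esub> g \<otimes>\<^bsub>?B\<^esub> h"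
        unfolding m pl
      proof (rule restrict_ext)
        fix P assume P: "P \<in> U"
        interpret L: cring "localization A P" by (rule L[OF P])
        show "(\<lambda>P\<in>U. f P \<oplus>\<^bsub>localization A P\<^esub> g P) P \<otimes>\<^bsub>localization A P\<^esub> h P =
            (\<lambda>P\<in>U. f P \<otimes>\<^bsub>localization A P\<^esub> h P) P \<oplus>\<^bsub>localization A P\<^esub>
            (\<lambda>P\<in>U. g P \<otimes>\<^bsub>localization A P\<^esub> h P) P"
          using P L.l_distr[OF val[OF f P] val[OF g P] val[OF h P]] by simp
      qed
    qed
  next
    fix c f assume c: "c \<in> carrier K" and f: "f \<in> carrier ?B"
    show "c \<odot>\<^bsub>?B\<^esub> f \<in> carrier ?B" by (rule sc[OF c f])
    fix d assume d: "d \<in> carrier K"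
    show "(c \<oplus>\<^bsub>K\<^esub> d) \<odot>\<^bsub>?B\<^esub> f = c \<odot>\<^bsub>?B\<^esub> f \<oplus>\<^bsub>?B\<^esub> d \<odot>\<^bsub>?B\<^esub> f"
      unfolding sm pl
      using module.smult_l_distr[OF algebra.axioms(1)[OF alg] c d val[OF f]] by (intro restrict_ext) simp
    show "(c \<otimes>\<^bsub>K\<^esub> d) \<odot>\<^bsub>?B\<^esub> f = c \<odot>\<^bsub>?B\<^esub> (d \<odot>\<^bsub>?B\<^esub> f)"
      unfolding sm
      using module.smult_assoc1[OF algebra.axioms(1)[OF alg] c d val[OF f]] by (intro restrict_ext) simp
  next
    fix f assume f: "f \<in> carrier ?B"
    show "\<one>\<^bsub>K\<^esub> \<odot>\<^bsub>?B\<^esub> f = f"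
    proof (rule eqI)
      fix P assume P: "P \<in> U"
      show "(\<one>\<^bsub>K\<^esub> \<odot>\<^bsub>?B\<^esub> f) P = f P"
        using P module.smult_one[OF algebra.axioms(1)[OF alg[OF P]] val[OF f P]] by (simp add: sm)
    qed (rule exts ext f R.one_closed)+
  next
    fix c f g assume c: "c \<in> carrier K" and f: "f \<in> carrier ?B" and g: "g \<in> carrier ?B"
    show "c \<odot>\<^bsub>?B\<^esub> (f \<oplus>\<^bsub>?B\<^esub> g) = c \<odot>\<^bsub>?B\<^esub> f \<oplus>\<^bsub>?B\<^esub> c \<odot>\<^bsub>?B\<^esub> g"
      unfolding sm pl
      using module.smult_r_distr[OF algebra.axioms(1)[OF alg] c val[OF f] val[OF g]]
      by (intro restrict_ext) simp
    show "(c \<odot>\<^bsub>?B\<^esub> f) \<otimes>\<^bsub>?B\<^esub> g = c \<odot>\<^bsub>?B\<^esub> (f \<otimes>\<^bsub>?B\<^esub> g)"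
      unfolding sm m
      using algebra.smult_assoc2[OF alg c val[OF f] val[OF g]] by (intro restrict_ext) simp
  qed
qed

lemma Der_simps:
  "carrier (Der K B) = {D. derivation K B D}"
  "D \<otimes>\<^bsub>Der K B\<^esub> E = (\<lambda>x\<in>carrier B. D (E x) \<ominus>\<^bsub>B\<^esub> E (D x))"
  "D \<oplus>\<^bsub>Der K B\<^esub> E = (\<lambda>x\<in>carrier B. D x \<oplus>\<^bsub>B\<^esub> E x)"
  "\<zero>\<^bsub>Der K B\<^esub> = (\<lambda>x\<in>carrier B. \<zero>\<^bsub>B\<^esub>)"
  "c \<odot>\<^bsub>Der K B\<^esub> D = (\<lambda>x\<in>carrier B. c \<odot>\<^bsub>B\<^esub> D x)"
  unfolding Der_def by simp_all

lemma derivationD: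
  assumes "derivation K B D"
  shows "D \<in> extensional (carrier B)" "x \<in> carrier B \<Longrightarrow> D x \<in> carrier B"
    and "x \<in> carrier B \<Longrightarrow> y \<in> carrier B \<Longrightarrow> D (x \<oplus>\<^bsub>B\<^esub> y) = D x \<oplus>\<^bsub>B\<^esub> D y"
    and "c \<in> carrier K \<Longrightarrow> x \<in> carrier B \<Longrightarrow> D (c \<odot>\<^bsub>B\<^esub> x) = c \<odot>\<^bsub>B\<^esub> D x"
    and "x \<in> carrier B \<Longrightarrow> y \<in> carrier B \<Longrightarrow>
      D (x \<otimes>\<^bsub>B\<^esub> y) = D x \<otimes>\<^bsub>B\<^esub> y \<oplus>\<^bsub>B\<^esub> x \<otimes>\<^bsub>B\<^esub> D y"
  using assms unfolding derivation_def PiE_def Pi_def by simp_all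

lemma derivationI:
  assumes "\<And>x. x \<in> carrier B \<Longrightarrow> F x \<in> carrier B"
    and "\<And>x y. x \<in> carrier B \<Longrightarrow> y \<in> carrier B \<Longrightarrow> x \<oplus>\<^bsub>B\<^esub> y \<in> carrier B \<Longrightarrow>
      F (x \<oplus>\<^bsub>B\<^esub> y) = F x \<oplus>\<^bsub>B\<^esub> F y"
    and "\<And>c x. c \<in> carrier K \<Longrightarrow> x \<in> carrier B \<Longrightarrow> c \<odot>\<^bsub>B\<^esub> x \<in> carrier B \<Longrightarrow>
      F (c \<odot>\<^bsub>B\<^esub> x) = c \<odot>\<^bsub>B\<^esub> F x"
    and "\<And>x y. x \<in> carrier B \<Longrightarrow> y \<in> carrier B \<Longrightarrow> x \<otimes>\<^bsub>B\<^esub> y \<in> carrier B \<Longrightarrow>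
      F (x \<otimes>\<^bsub>B\<^esub> y) = F x \<otimes>\<^bsub>B\<^esub> y \<oplus>\<^bsub>B\<^esub> x \<otimes>\<^bsub>B\<^esub> F y"
    and "algebra K B"
  shows "derivation K B (restrict F (carrier B))"
proof -
  interpret B: cring B using assms(5) by (rule algebra.M_cring)
  interpret algebra K B by fact
  show ?thesis unfolding derivation_def using assms(1-4) by auto
qed

lemma module_Der:
  assumes "algebra K B"
  shows "module K (Der K B)"
    and "D \<in> carrier (Der K B) \<Longrightarrow> E \<in> carrier (Der K B) \<Longrightarrow> D \<otimes>\<^bsub>Der K B\<^esub> E \<in> carrier (Der K B)"
proof -
  interpret B: cring B using assms by (rule algebra.M_cring)
  interpret algebra K B by fact
  note d = derivationD
  have sm: "x \<otimes>\<^bsub>B\<^esub> (c \<odot>\<^bsub>B\<^esub> y) = c \<odot>\<^bsub>B\<^esub> (x \<otimes>\<^bsub>B\<^esub> y)"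
    if "c \<in> carrier K" "x \<in> carrier B" "y \<in> carrier B" for c x y
    using smult_assoc2[of c y x] that by (simp add: B.m_comm)
  have scm: "c \<odot>\<^bsub>B\<^esub> (d \<odot>\<^bsub>B\<^esub> x) = d \<odot>\<^bsub>B\<^esub> (c \<odot>\<^bsub>B\<^esub> x)"
    if "c \<in> carrier K" "d \<in> carrier K" "x \<in> carrier B" for c d x
    using that by (simp add: smult_assoc1[symmetric] R.m_comm)
  have add: "derivation K B (\<lambda>x\<in>carrier B. D x \<oplus>\<^bsub>B\<^esub> E x)" if D: "derivation K B D" and E: "derivation K B E" for D E
    using assms d[OF D] d[OF E]
    by (intro derivationI) (simp_all add: smult_r_distr B.a_ac B.l_distr B.r_distr)
  have scal: "derivation K B (\<lambda>x\<in>carrier B. c \<odot>\<^bsub>B\<^esub> D x)" if D: "derivation K B D" and c: "c \<in> carrier K" for c D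
    using assms d[OF D] c
    by (intro derivationI) (simp_all add: smult_r_distr smult_assoc2 sm scm)
  have zero: "derivation K B (\<lambda>x\<in>carrier B. \<zero>\<^bsub>B\<^esub>)"
    using assms by (intro derivationI) simp_all
  have minus: "\<ominus>\<^bsub>B\<^esub> x = (\<ominus>\<^bsub>K\<^esub> \<one>\<^bsub>K\<^esub>) \<odot>\<^bsub>B\<^esub> x" if "x \<in> carrier B" for x
    using that by (simp add: smult_l_minus)
  have br: "derivation K B (\<lambda>x\<in>carrier B. D (E x) \<ominus>\<^bsub>B\<^esub> E (D x))" if D: "derivation K B D" and E: "derivation K B E" for D E
  proof (rule derivationI[OF _ _ _ _ assms])
    fix c x assume "c \<in> carrier K" "x \<in> carrier B"
    then show "D (E (c \<odot>\<^bsub>B\<^esub> x)) \<ominus>\<^bsub>B\<^esub> E (D (c \<odot>\<^bsub>B\<^esub> x)) = c \<odot>\<^bsub>B\<^esub> (D (E x) \<ominus>\<^bsub>B\<^esub> E (D x))"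
      using d[OF D] d[OF E] by (simp add: a_minus_def smult_r_distr smult_r_minus)
  next
    fix x y assume "x \<in> carrier B" "y \<in> carrier B"
    then show "D (E (x \<otimes>\<^bsub>B\<^esub> y)) \<ominus>\<^bsub>B\<^esub> E (D (x \<otimes>\<^bsub>B\<^esub> y)) =
        (D (E x) \<ominus>\<^bsub>B\<^esub> E (D x)) \<otimes>\<^bsub>B\<^esub> y \<oplus>\<^bsub>B\<^esub> x \<otimes>\<^bsub>B\<^esub> (D (E y) \<ominus>\<^bsub>B\<^esub> E (D y))"
      using d(2)[OF D] d(2)[OF E] by (simp add: d(3,5)[OF D] d(3,5)[OF E]) algebra
  next
    fix x y assume "x \<in> carrier B" "y \<in> carrier B"
    then show "D (E (x \<oplus>\<^bsub>B\<^esub> y)) \<ominus>\<^bsub>B\<^esub> E (D (x \<oplus>\<^bsub>B\<^esub> y)) =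
        D (E x) \<ominus>\<^bsub>B\<^esub> E (D x) \<oplus>\<^bsub>B\<^esub> (D (E y) \<ominus>\<^bsub>B\<^esub> E (D y))"
      using d(2)[OF D] d(2)[OF E] by (simp add: d(3)[OF D] d(3)[OF E]) algebra
  qed (use d(2)[OF D] d(2)[OF E] in auto)
  show "D \<in> carrier (Der K B) \<Longrightarrow> E \<in> carrier (Der K B) \<Longrightarrow> D \<otimes>\<^bsub>Der K B\<^esub> E \<in> carrier (Der K B)"
    by (simp add: Der_simps br)
  have rx: "restrict F (carrier B) = D" if "derivation K B D" "\<And>x. x \<in> carrier B \<Longrightarrow> F x = D x" for F D
    using that d(1) by (intro extensionalityI[of _ "carrier B"]) auto
  show "module K (Der K B)"
  proof (rule moduleI)
    show "cring K" by (rule R_cring)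
    show "abelian_group (Der K B)"
    proof (rule abelian_groupI)
      fix D assume "D \<in> carrier (Der K B)"
      then have D: "derivation K B D" by (simp add: Der_simps)
      show "\<zero>\<^bsub>Der K B\<^esub> \<oplus>\<^bsub>Der K B\<^esub> D = D"
        unfolding Der_simps by (rule rx[OF D]) (use d[OF D] in simp)
      show "\<exists>E\<in>carrier (Der K B). E \<oplus>\<^bsub>Der K B\<^esub> D = \<zero>\<^bsub>Der K B\<^esub>"
        unfolding Der_simps
        by (rule bexI[of _ "\<lambda>x\<in>carrier B. (\<ominus>\<^bsub>K\<^esub> \<one>\<^bsub>K\<^esub>) \<odot>\<^bsub>B\<^esub> D x"])
          (use scal[OF D] d[OF D] in \<open>auto intro!: restrict_ext simp: minus[symmetric] B.l_neg\<close>)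
      fix E assume "E \<in> carrier (Der K B)"
      then have E: "derivation K B E" by (simp add: Der_simps)
      show "D \<oplus>\<^bsub>Der K B\<^esub> E \<in> carrier (Der K B)" by (simp add: Der_simps add D E)
      show "D \<oplus>\<^bsub>Der K B\<^esub> E = E \<oplus>\<^bsub>Der K B\<^esub> D"
        unfolding Der_simps using d[OF D] d[OF E] by (intro restrict_ext) (simp add: B.a_comm)
      fix F assume "F \<in> carrier (Der K B)"
      then have F: "derivation K B F" by (simp add: Der_simps)
      show "D \<oplus>\<^bsub>Der K B\<^esub> E \<oplus>\<^bsub>Der K B\<^esub> F = D \<oplus>\<^bsub>Der K B\<^esub> (E \<oplus>\<^bsub>Der K B\<^esub> F)"
        unfolding Der_simps using d[OF D] d[OF E] d[OF F] by (intro restrict_ext) (simp add: B.a_assoc)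
    qed (simp add: Der_simps zero)
  qed (auto simp: Der_simps scal smult_l_distr smult_r_distr smult_assoc1 d(2) intro!: restrict_ext rx)
qed

lemma lie_subalgebra_carrier_Der:
  assumes "algebra K B"
  shows "lie_subalgebra K (Der K B) (carrier (Der K B))"
  using module.carrier_is_submodule[OF module_Der(1)[OF assms]] module_Der(2)[OF assms]
  unfolding lie_subalgebra_def by blast

end

theory Submission
  imports Defs
begin

text \<open>Let \<open>B\<close> be the algebra of regular functions on the open subset \<open>U\<close> of \<open>Spec A\<close>. Although \<open>B\<close> need
  not be finitely generated, it is controlled by the image of \<open>A\<close>. As \<open>A\<close> is Noetherian (Hilbert's
  basis theorem), \<open>U\<close> is a finite union of sets \<open>D(f)\<close> with \<open>f \<in> F\<close>, every \<open>g \<in> B\<close> has the property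
  that \<open>f\<^sup>n g\<close> comes from \<open>A\<close> for all \<open>f \<in> F\<close> and a suitable \<open>n\<close>, and \<open>g = 0\<close> as soon as
  \<open>f\<^sup>n g = 0\<close> for all these \<open>f\<close> (\<open>quasi_affine_algebra_O\<close>). Two consequences carry the proof.
  First, a derivation of \<open>B\<close> is determined by its values on the finite set \<open>X\<close> of images of
  generators of \<open>A\<close> (\<open>derivation_eq_zeroI\<close>).
  Second, \<open>B\<close> is the union of an increasing sequence of finite-dimensional subspaces
  (\<open>fin_dim_filtration\<close>).

  From the first consequence, \<open>ad x\<close> acts locally finitely on derivations whenever \<open>x\<close> is locally
  finite (\<open>adjoint_locally_finite\<close>). Suppose by induction on the derived length that the derived
  algebra \<open>L'\<close> is weakly locally finite, and add finitely many elements of \<open>L\<close> to a finite subset of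
  \<open>L'\<close> one by one. To add \<open>x\<close> to a locally finite set, enlarge that set by elements of \<open>L'\<close> so that
  its span is stable under \<open>ad x\<close>, which is possible because \<open>[x, L] \<subseteq> L'\<close>. The enlarged set is locally
  finite by the induction hypothesis on the number of added elements. Then the smallest stable subspace
  for it that contains an \<open>x\<close>-stable space \<open>V\<close> is again \<open>x\<close>-stable, and it has finite dimension if \<open>V\<close> has
  (\<open>locally_finite_insert\<close>). Hence \<open>L\<close> is weakly locally finite.

  For the filtration, let \<open>E\<^sub>0 \<subseteq> E\<^sub>1 \<subseteq> \<dots>\<close> be finite-dimensional subspaces that exhaust \<open>B\<close>. The
  elements of \<open>L\<close> that map \<open>X\<close> into \<open>E\<^sub>n\<close> form a finite-dimensional space, and these spaces exhaust \<open>L\<close>.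
  The Lie subalgebra generated by the \<open>n\<close>-th of them is locally finite, because the derivations that
  stabilize a given subspace form a Lie algebra.\<close>

section \<open>Finite-dimensional subspaces\<close>

definition lin_span :: "('k, 'm) ring_scheme \<Rightarrow> ('k, 'b, 'n) module_scheme \<Rightarrow> 'b set \<Rightarrow> 'b set"
  where "lin_span K M T = (\<lambda>W. submodule W K M) hull T"

lemma span_superset: "T \<subseteq> lin_span K M T"
  unfolding lin_span_def by (rule hull_subset)

lemma span_inc: "x \<in> T \<Longrightarrow> x \<in> lin_span K M T"
  by (rule subsetD[OF span_superset])

lemma span_mono: "S \<subseteq> T \<Longrightarrow> lin_span K M S \<subseteq> lin_span K M T"
  unfolding lin_span_def by (rule hull_mono)

lemma span_minimal: "T \<subseteq> W \<Longrightarrow> submodule W K M \<Longrightarrow> lin_span K M T \<subseteq> W"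
  unfolding lin_span_def by (rule hull_minimal)

definition linear_map ::
    "('k, 'm) ring_scheme \<Rightarrow> ('k, 'b, 'n) module_scheme \<Rightarrow> ('k, 'c, 'p) module_scheme \<Rightarrow> ('b \<Rightarrow> 'c) \<Rightarrow> bool"
  where "linear_map K M N f \<longleftrightarrow> f \<in> carrier M \<rightarrow> carrier N \<and>
    (\<forall>x\<in>carrier M. \<forall>y\<in>carrier M. f (x \<oplus>\<^bsub>M\<^esub> y) = f x \<oplus>\<^bsub>N\<^esub> f y) \<and>
    (\<forall>c\<in>carrier K. \<forall>x\<in>carrier M. f (c \<odot>\<^bsub>M\<^esub> x) = c \<odot>\<^bsub>N\<^esub> f x)"

lemma linear_mapD:
  assumes "linear_map K M N f"
  shows "x \<in> carrier M \<Longrightarrow> f x \<in> carrier N"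
    and "x \<in> carrier M \<Longrightarrow> y \<in> carrier M \<Longrightarrow> f (x \<oplus>\<^bsub>M\<^esub> y) = f x \<oplus>\<^bsub>N\<^esub> f y"
    and "c \<in> carrier K \<Longrightarrow> x \<in> carrier M \<Longrightarrow> f (c \<odot>\<^bsub>M\<^esub> x) = c \<odot>\<^bsub>N\<^esub> f x"
  using assms unfolding linear_map_def by auto

context module
begin

lemma a_inv_eq_smult: "x \<in> carrier M \<Longrightarrow> \<ominus>\<^bsub>M\<^esub> x = (\<ominus> \<one>) \<odot>\<^bsub>M\<^esub> x"
  by (simp add: smult_l_minus)

lemma submodule_criterion:
  assumes "H \<subseteq> carrier M" "\<zero>\<^bsub>M\<^esub> \<in> H" "\<And>a b. a \<in> H \<Longrightarrow> b \<in> H \<Longrightarrow> a \<oplus>\<^bsub>M\<^esub> b \<in> H"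
    and "\<And>c x. c \<in> carrier R \<Longrightarrow> x \<in> H \<Longrightarrow> c \<odot>\<^bsub>M\<^esub> x \<in> H"
  shows "submodule H R M"
proof (rule submoduleI)
  fix a assume "a \<in> H"
  then show "\<ominus>\<^bsub>M\<^esub> a \<in> H"
    using assms(1) assms(4)[of "\<ominus> \<one>" a] by (subst a_inv_eq_smult) auto
qed (use assms in auto)

lemma submoduleD:
  assumes "submodule H R M"
  shows "a \<in> H \<Longrightarrow> a \<in> carrier M" "\<zero>\<^bsub>M\<^esub> \<in> H" "a \<in> H \<Longrightarrow> b \<in> H \<Longrightarrow> a \<oplus>\<^bsub>M\<^esub> b \<in> H"
    "c \<in> carrier R \<Longrightarrow> a \<in> H \<Longrightarrow> c \<odot>\<^bsub>M\<^esub> a \<in> H" "a \<in> H \<Longrightarrow> b \<in> H \<Longrightarrow> a \<ominus>\<^bsub>M\<^esub> b \<in> H"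
proof -
  note E = submoduleE[OF assms]
  show "a \<in> H \<Longrightarrow> a \<in> carrier M" using E(1) by auto
  show "a \<in> H \<Longrightarrow> b \<in> H \<Longrightarrow> a \<oplus>\<^bsub>M\<^esub> b \<in> H" by (rule E(5))
  show "c \<in> carrier R \<Longrightarrow> a \<in> H \<Longrightarrow> c \<odot>\<^bsub>M\<^esub> a \<in> H" by (rule E(4))
  show "a \<in> H \<Longrightarrow> b \<in> H \<Longrightarrow> a \<ominus>\<^bsub>M\<^esub> b \<in> H" unfolding a_minus_def using E(3,5) by auto
  obtain h where "h \<in> H" using E(2) by auto
  then show "\<zero>\<^bsub>M\<^esub> \<in> H" using E(1) E(4)[of \<zero> h] by auto
qed

lemma submodule_Int:
  assumes "submodule V R M" "submodule W R M"
  shows "submodule (V \<inter> W) R M"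
  by (rule submodule_criterion) (use submoduleD[OF assms(1)] submoduleD[OF assms(2)] in auto)

lemma submodule_span:
  assumes "T \<subseteq> carrier M"
  shows "submodule (lin_span R M T) R M"
proof (rule submodule_criterion)
  show "lin_span R M T \<subseteq> carrier M"
    by (rule span_minimal[OF assms carrier_is_submodule])
  show "\<zero>\<^bsub>M\<^esub> \<in> lin_span R M T"
    unfolding lin_span_def hull_def using submoduleD(2) by auto
  fix a assume a: "a \<in> lin_span R M T"
  show "a \<oplus>\<^bsub>M\<^esub> b \<in> lin_span R M T" if "b \<in> lin_span R M T" for b
    using a that submoduleD(3) unfolding lin_span_def hull_def by auto
  show "c \<odot>\<^bsub>M\<^esub> a \<in> lin_span R M T" if "c \<in> carrier R" for c
    using a that submoduleD(4) unfolding lin_span_def hull_def by auto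
qed

lemma span_insertE:
  assumes "x \<in> carrier M" "T \<subseteq> carrier M" "y \<in> lin_span R M (insert x T)"
  obtains c t where "c \<in> carrier R" "t \<in> lin_span R M T" "y = c \<odot>\<^bsub>M\<^esub> x \<oplus>\<^bsub>M\<^esub> t"
proof -
  let ?H = "{c \<odot>\<^bsub>M\<^esub> x \<oplus>\<^bsub>M\<^esub> t | c t. c \<in> carrier R \<and> t \<in> lin_span R M T}"
  note D = submoduleD[OF submodule_span[OF assms(2)]]
  have "submodule ?H R M"
  proof (rule submodule_criterion)
    show "?H \<subseteq> carrier M" using assms D(1) by auto
    show "\<zero>\<^bsub>M\<^esub> \<in> ?H" using assms D(2) by (intro CollectI exI[of _ \<zero>] exI[of _ "\<zero>\<^bsub>M\<^esub>"]) auto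
  next
    fix a b assume "a \<in> ?H" "b \<in> ?H"
    then obtain c t d u where *: "c \<in> carrier R" "t \<in> lin_span R M T" "a = c \<odot>\<^bsub>M\<^esub> x \<oplus>\<^bsub>M\<^esub> t"
      "d \<in> carrier R" "u \<in> lin_span R M T" "b = d \<odot>\<^bsub>M\<^esub> x \<oplus>\<^bsub>M\<^esub> u" by blast
    have "a \<oplus>\<^bsub>M\<^esub> b = (c \<oplus> d) \<odot>\<^bsub>M\<^esub> x \<oplus>\<^bsub>M\<^esub> (t \<oplus>\<^bsub>M\<^esub> u)"
      using * assms D(1) by (simp add: smult_l_distr M.a_ac)
    then show "a \<oplus>\<^bsub>M\<^esub> b \<in> ?H" using * D(3) by blast
  next
    fix d a assume d: "d \<in> carrier R" and "a \<in> ?H"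
    then obtain c t where *: "c \<in> carrier R" "t \<in> lin_span R M T" "a = c \<odot>\<^bsub>M\<^esub> x \<oplus>\<^bsub>M\<^esub> t" by blast
    have "d \<odot>\<^bsub>M\<^esub> a = (d \<otimes> c) \<odot>\<^bsub>M\<^esub> x \<oplus>\<^bsub>M\<^esub> d \<odot>\<^bsub>M\<^esub> t"
      using * d assms D(1) by (simp add: smult_r_distr smult_assoc1)
    then show "d \<odot>\<^bsub>M\<^esub> a \<in> ?H" using * d D(4) by blast
  qed
  moreover have "insert x T \<subseteq> ?H"
  proof -
    have "x = \<one> \<odot>\<^bsub>M\<^esub> x \<oplus>\<^bsub>M\<^esub> \<zero>\<^bsub>M\<^esub>" using assms by simp
    then have "x \<in> ?H" using D(2) by blast
    moreover have "t \<in> ?H" if "t \<in> T" for t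
    proof -
      have "t = \<zero> \<odot>\<^bsub>M\<^esub> x \<oplus>\<^bsub>M\<^esub> t" using assms that by auto
      then show ?thesis using span_inc[OF that] by blast
    qed
    ultimately show ?thesis by auto
  qed
  ultimately have "lin_span R M (insert x T) \<subseteq> ?H" by (intro span_minimal)
  then show ?thesis using assms(3) that by blast
qed

lemma span_empty: "lin_span R M {} = {\<zero>\<^bsub>M\<^esub>}"
proof
  show "lin_span R M {} \<subseteq> {\<zero>\<^bsub>M\<^esub>}"
    by (rule span_minimal) (auto intro!: submodule_criterion)
qed (use submoduleD(2)[OF submodule_span[of "{}"]] in auto)

lemma fin_dim_span: "finite T \<Longrightarrow> T \<subseteq> carrier M \<Longrightarrow> fin_dim_subspace R M (lin_span R M T)"
  unfolding fin_dim_subspace_def lin_span_def by blast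

lemma fin_dim_subspaceE:
  assumes "fin_dim_subspace R M U"
  obtains T where "finite T" "T \<subseteq> carrier M" "U = lin_span R M T" "T \<subseteq> U" "submodule U R M"
  proof -
  obtain T where T: "finite T" "T \<subseteq> carrier M" "U = lin_span R M T"
    using assms unfolding fin_dim_subspace_def lin_span_def by blast
  show ?thesis using that[OF T] submodule_span[OF T(2)] span_superset[of T] T(3) by blast
qed

lemma subspace_of_span_fin_dim:
  assumes "field R" "finite T" "T \<subseteq> carrier M" "submodule W R M" "W \<subseteq> lin_span R M T"
  shows "\<exists>F. finite F \<and> F \<subseteq> W \<and> W = lin_span R M F"
  using assms(2-5)
proof (induction T arbitrary: W)
  case empty
  then have "W = {\<zero>\<^bsub>M\<^esub>}" using submoduleD(2) span_empty by blast
  then show ?case using span_empty by (intro exI[of _ "{}"]) auto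
next
  case (insert s T)
  have s: "s \<in> carrier M" and T: "T \<subseteq> carrier M" using insert.prems by auto
  note DT = submoduleD[OF submodule_span[OF T]] and DW = submoduleD[OF insert.prems(2)]
  obtain F where F: "finite F" "F \<subseteq> W \<inter> lin_span R M T" "W \<inter> lin_span R M T = lin_span R M F"
    using insert.IH[OF T submodule_Int[OF insert.prems(2) submodule_span[OF T]]] by auto
  have Fc: "F \<subseteq> carrier M" using F(2) DW(1) by blast
  show ?case
  proof (cases "W \<subseteq> lin_span R M T")
    case True
    then show ?thesis using F by (intro exI[of _ F]) auto
  next
    case False
    then obtain w where w: "w \<in> W" "w \<notin> lin_span R M T" by auto
    then obtain c t where ct: "c \<in> carrier R" "t \<in> lin_span R M T" "w = c \<odot>\<^bsub>M\<^esub> s \<oplus>\<^bsub>M\<^esub> t"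
      using span_insertE[OF s T] insert.prems(3) by blast
    have "c \<noteq> \<zero>" using ct w(2) s DT(1) by auto
    then have c: "inv c \<in> carrier R" "inv c \<otimes> c = \<one>"
      using field.field_Units[OF assms(1)] ct(1) by auto
    let ?F = "insert w F"
    have wF: "?F \<subseteq> carrier M" using Fc w DW(1) by auto
    note DF = submoduleD[OF submodule_span[OF wF]]
    have "y \<in> lin_span R M ?F" if y: "y \<in> W" for y
    proof -
      obtain d u where du: "d \<in> carrier R" "u \<in> lin_span R M T" "y = d \<odot>\<^bsub>M\<^esub> s \<oplus>\<^bsub>M\<^esub> u"
        using span_insertE[OF s T] insert.prems(3) y by blast
      let ?e = "d \<otimes> inv c"
      have e: "?e \<in> carrier R" using c du by auto
      \<comment> \<open>The multiple of \<open>w\<close> is chosen to cancel the component of \<open>y\<close> along \<open>s\<close>.\<close>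
      have ec: "?e \<otimes> c = d" using c du ct by (simp add: R.m_assoc)
      have "?e \<odot>\<^bsub>M\<^esub> w = d \<odot>\<^bsub>M\<^esub> s \<oplus>\<^bsub>M\<^esub> ?e \<odot>\<^bsub>M\<^esub> t"
        using ct e s DT(1) by (simp add: smult_r_distr smult_assoc1[symmetric] ec)
      then have "y \<ominus>\<^bsub>M\<^esub> ?e \<odot>\<^bsub>M\<^esub> w = u \<ominus>\<^bsub>M\<^esub> ?e \<odot>\<^bsub>M\<^esub> t"
        using du e s ct DT(1) unfolding a_minus_def
        by (simp add: M.minus_add M.a_ac M.r_neg1 M.r_neg2)
      moreover have "u \<ominus>\<^bsub>M\<^esub> ?e \<odot>\<^bsub>M\<^esub> t \<in> lin_span R M T" by (rule DT(5)[OF du(2) DT(4)[OF e ct(2)]])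
      moreover have "y \<ominus>\<^bsub>M\<^esub> ?e \<odot>\<^bsub>M\<^esub> w \<in> W" by (rule DW(5)[OF y DW(4)[OF e w(1)]])
      ultimately have "y \<ominus>\<^bsub>M\<^esub> ?e \<odot>\<^bsub>M\<^esub> w \<in> lin_span R M F" using F(3) by auto
      then have "y \<ominus>\<^bsub>M\<^esub> ?e \<odot>\<^bsub>M\<^esub> w \<in> lin_span R M ?F"
        using subsetD[OF span_mono[of F ?F]] by blast
      moreover have "?e \<odot>\<^bsub>M\<^esub> w \<in> lin_span R M ?F" by (intro DF(4) e span_inc) simp
      ultimately have "(y \<ominus>\<^bsub>M\<^esub> ?e \<odot>\<^bsub>M\<^esub> w) \<oplus>\<^bsub>M\<^esub> ?e \<odot>\<^bsub>M\<^esub> w \<in> lin_span R M ?F" by (rule DF(3))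
      moreover have "(y \<ominus>\<^bsub>M\<^esub> ?e \<odot>\<^bsub>M\<^esub> w) \<oplus>\<^bsub>M\<^esub> ?e \<odot>\<^bsub>M\<^esub> w = y"
        using y w e DW(1) by (simp add: a_minus_def M.a_assoc M.l_neg)
      ultimately show ?thesis by simp
    qed
    moreover have "lin_span R M ?F \<subseteq> W" using F(2) w(1) insert.prems(2) by (intro span_minimal) auto
    ultimately show ?thesis using F w by (intro exI[of _ ?F]) auto
  qed
qed

lemma linear_map_zero:
  assumes "module R N" "linear_map R M N f"
  shows "f \<zero>\<^bsub>M\<^esub> = \<zero>\<^bsub>N\<^esub>"
proof -
  interpret N: module R N by fact
  have "f (\<zero> \<odot>\<^bsub>M\<^esub> \<zero>\<^bsub>M\<^esub>) = \<zero> \<odot>\<^bsub>N\<^esub> f \<zero>\<^bsub>M\<^esub>" by (rule linear_mapD(3)[OF assms(2)]) auto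
  then show ?thesis using linear_mapD(1)[OF assms(2)] by simp
qed

lemma linear_map_diff:
  assumes "module R N" "linear_map R M N f" "x \<in> carrier M" "y \<in> carrier M"
  shows "f (x \<ominus>\<^bsub>M\<^esub> y) = f x \<ominus>\<^bsub>N\<^esub> f y"
proof -
  interpret N: module R N by fact
  note f = linear_mapD[OF assms(2)]
  show ?thesis
    unfolding a_minus_def a_inv_eq_smult[OF assms(4)] N.a_inv_eq_smult[OF f(1)[OF assms(4)]]
    using assms(3,4) by (simp add: f)
qed

lemma linear_map_preimage:
  assumes "module R N" "linear_map R M N f" "submodule W R N"
  shows "submodule {x \<in> carrier M. f x \<in> W} R M"
proof -
  interpret N: module R N by fact
  note f = linear_mapD[OF assms(2)] and W = N.submoduleD[OF assms(3)]
  show ?thesis using W by (intro submodule_criterion) (auto simp: f linear_map_zero[OF assms(1,2)])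
qed

lemma linear_map_span:
  assumes "module R N" "linear_map R M N f" "submodule W R N" "T \<subseteq> carrier M" "f ` T \<subseteq> W"
  shows "f ` lin_span R M T \<subseteq> W"
  using span_minimal[OF _ linear_map_preimage[OF assms(1-3)], of T] assms(4,5) by auto

lemma linear_map_image:
  assumes "module R N" "linear_map R M N f" "submodule V R M"
  shows "submodule (f ` V) R N"
proof -
  interpret N: module R N by fact
  note f = linear_mapD[OF assms(2)] and V = submoduleD[OF assms(3)]
  show ?thesis
  proof (rule N.submodule_criterion)
    show "f ` V \<subseteq> carrier N" using f(1) V(1) by auto
    show "\<zero>\<^bsub>N\<^esub> \<in> f ` V" using linear_map_zero[OF assms(1,2)] V(2) by (rule image_eqI[OF sym])
    show "a \<oplus>\<^bsub>N\<^esub> b \<in> f ` V" if ab: "a \<in> f ` V" "b \<in> f ` V" for a b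
    proof -
      obtain x y where "x \<in> V" "y \<in> V" "a = f x" "b = f y" using ab by auto
      then show ?thesis using f(2) V(1,3) by (intro image_eqI[of _ _ "x \<oplus>\<^bsub>M\<^esub> y"]) auto
    qed
    show "c \<odot>\<^bsub>N\<^esub> a \<in> f ` V" if ca: "c \<in> carrier R" "a \<in> f ` V" for c a
    proof -
      obtain x where "x \<in> V" "a = f x" using ca by auto
      then show ?thesis using f(3) V(1,4) ca(1) by (intro image_eqI[of _ _ "c \<odot>\<^bsub>M\<^esub> x"]) auto
    qed
  qed
qed

text \<open>The induction removes one map \<open>f\<close> at a time: the others still separate the points of the
  kernel of \<open>f\<close>, and the image of \<open>f\<close> is a subspace of \<open>U\<close>. Derivations that are known through
  finitely many values, and functions with bounded denominators, are shown in this way to form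
  finite-dimensional spaces.\<close>

lemma jointly_injective_fin_dim:
  assumes "field R" "module R N" "fin_dim_subspace R N U"
    and "finite S" "\<And>s. s \<in> S \<Longrightarrow> linear_map R M N (\<phi> s)"
    and "submodule V R M" "\<And>s v. s \<in> S \<Longrightarrow> v \<in> V \<Longrightarrow> \<phi> s v \<in> U"
    and "\<And>v. v \<in> V \<Longrightarrow> (\<And>s. s \<in> S \<Longrightarrow> \<phi> s v = \<zero>\<^bsub>N\<^esub>) \<Longrightarrow> v = \<zero>\<^bsub>M\<^esub>"
  shows "\<exists>F. finite F \<and> F \<subseteq> V \<and> V = lin_span R M F"
  using assms(4-8)
proof (induction S arbitrary: V)
  case empty
  have "V \<subseteq> {\<zero>\<^bsub>M\<^esub>}" using empty.prems(4) by blast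
  then show ?case using span_empty submoduleD(2)[OF empty.prems(2)] by (intro exI[of _ "{}"]) auto
next
  case (insert s S)
  interpret N: module R N by fact
  let ?f = "\<phi> s"
  note DV = submoduleD[OF insert.prems(2)]
  have lin: "linear_map R M N ?f" by (rule insert.prems(1)) simp
  let ?V0 = "V \<inter> {x \<in> carrier M. ?f x \<in> {\<zero>\<^bsub>N\<^esub>}}"
  have zero: "submodule {\<zero>\<^bsub>N\<^esub>} R N" by (rule N.submodule_criterion) auto
  have V0: "submodule ?V0 R M"
    by (rule submodule_Int[OF insert.prems(2) linear_map_preimage[OF assms(2) lin zero]])
  have "\<exists>F. finite F \<and> F \<subseteq> ?V0 \<and> ?V0 = lin_span R M F"
  proof (rule insert.IH[OF _ V0])
    fix v assume v: "v \<in> ?V0" "\<And>r. r \<in> S \<Longrightarrow> \<phi> r v = \<zero>\<^bsub>N\<^esub>"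
    then show "v = \<zero>\<^bsub>M\<^esub>" by (intro insert.prems(4)) auto
  qed (use insert.prems(1,3) in auto)
  then obtain F where F: "finite F" "F \<subseteq> V" "?V0 = lin_span R M F" by auto
  obtain TU where TU: "finite TU" "TU \<subseteq> carrier N" "U = lin_span R N TU"
    using N.fin_dim_subspaceE[OF assms(3)] by metis
  have "?f ` V \<subseteq> lin_span R N TU" using insert.prems(3) TU(3) by auto
  then obtain G where G: "finite G" "G \<subseteq> ?f ` V" "?f ` V = lin_span R N G"
    using N.subspace_of_span_fin_dim[OF assms(1) TU(1,2) linear_map_image[OF assms(2) lin insert.prems(2)]]
    by metis
  obtain H where H: "finite H" "H \<subseteq> V" "G = ?f ` H"
    using finite_subset_image[OF G(1,2)] by metis
  have Hc: "H \<subseteq> carrier M" and FH: "F \<union> H \<subseteq> carrier M" using F(2) H(2) DV(1) by auto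
  note DFH = submoduleD[OF submodule_span[OF FH]]
  have "G \<subseteq> ?f ` lin_span R M H" unfolding H(3) by (intro image_mono span_superset)
  then have img: "?f ` V \<subseteq> ?f ` lin_span R M H"
    unfolding G(3) by (intro span_minimal linear_map_image[OF assms(2) lin] submodule_span Hc)
  have "v \<in> lin_span R M (F \<union> H)" if v: "v \<in> V" for v
  proof -
    obtain h where h: "h \<in> lin_span R M H" "?f v = ?f h" using img v by blast
    have hV: "h \<in> V" using h(1) span_minimal[OF H(2) insert.prems(2)] by auto
    then have c: "v \<in> carrier M" "h \<in> carrier M" using v DV(1) by auto
    have "?f (v \<ominus>\<^bsub>M\<^esub> h) = \<zero>\<^bsub>N\<^esub>"
      using linear_map_diff[OF assms(2) lin c] h(2) linear_mapD(1)[OF lin c(2)]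
      by (simp add: a_minus_def N.M.r_neg)
    then have "v \<ominus>\<^bsub>M\<^esub> h \<in> lin_span R M F" unfolding F(3)[symmetric] using DV(5)[OF v hV] c by simp
    then have "(v \<ominus>\<^bsub>M\<^esub> h) \<oplus>\<^bsub>M\<^esub> h \<in> lin_span R M (F \<union> H)"
      by (intro DFH(3) subsetD[OF span_mono[of F "F \<union> H"]] subsetD[OF span_mono[of H "F \<union> H"]] h(1)) auto
    then show ?thesis using c by (simp add: a_minus_def M.a_assoc M.l_neg)
  qed
  moreover have "lin_span R M (F \<union> H) \<subseteq> V" using F(2) H(2) by (intro span_minimal insert.prems(2)) auto
  ultimately show ?case using F H by (intro exI[of _ "F \<union> H"]) auto
qed

end

section \<open>Locally finite sets of derivations\<close>

lemma locally_finite_subset: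
  "locally_finite K B \<Delta> \<Longrightarrow> \<Gamma> \<subseteq> \<Delta> \<Longrightarrow> locally_finite K B \<Gamma>"
  unfolding locally_finite_def by (meson subset_iff)

lemma locally_finite_carrier: "locally_finite K B \<Delta> \<Longrightarrow> \<Delta> \<subseteq> carrier (Der K B)"
  unfolding locally_finite_def by (rule conjunct1)

lemma locally_finiteE:
  assumes "locally_finite K B \<Delta>" "b \<in> carrier B"
  obtains U where "fin_dim_subspace K B U" "b \<in> U" "\<And>D. D \<in> \<Delta> \<Longrightarrow> D ` U \<subseteq> U"
  using assms unfolding locally_finite_def by metis

lemma locally_finiteI:
  assumes "\<Delta> \<subseteq> carrier (Der K B)"
    and "\<And>b. b \<in> carrier B \<Longrightarrow> \<exists>U. fin_dim_subspace K B U \<and> b \<in> U \<and> (\<forall>D\<in>\<Delta>. D ` U \<subseteq> U)"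
  shows "locally_finite K B \<Delta>"
  using assms unfolding locally_finite_def by simp

locale field_algebra = B: cring B + algebra K B + field K
  for K :: "('k, 'm) ring_scheme" and B :: "('k, 'a, 'n) module_scheme"

sublocale field_algebra \<subseteq> Der: module K "Der K B"
  by (rule module_Der(1)[OF algebra_axioms])

context field_algebra
begin

lemma field_K: "field K" ..

lemma Der_linear:
  assumes "D \<in> carrier (Der K B)"
  shows "linear_map K B B D"
proof -
  have "derivation K B D" using assms by (simp add: Der_simps)
  from derivationD(2-4)[OF this] show ?thesis unfolding linear_map_def by auto
qed

lemma Der_closed: "D \<in> carrier (Der K B) \<Longrightarrow> x \<in> carrier B \<Longrightarrow> D x \<in> carrier B"
  using linear_mapD(1)[OF Der_linear] .

lemma Der_eqI:
  assumes "D \<in> carrier (Der K B)" "E \<in> carrier (Der K B)" "\<And>x. x \<in> carrier B \<Longrightarrow> D x = E x"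
  shows "D = E"
proof -
  have "D \<in> extensional (carrier B)" "E \<in> extensional (carrier B)"
    using assms(1,2) by (auto simp: Der_simps intro: derivationD(1))
  then show ?thesis using assms(3) by (rule extensionalityI)
qed

lemma eval_linear: "b \<in> carrier B \<Longrightarrow> linear_map K (Der K B) B (\<lambda>D. D b)"
  unfolding linear_map_def by (auto simp: Der_closed) (auto simp: Der_simps)

lemma Der_apply:
  assumes "b \<in> carrier B"
  shows "\<zero>\<^bsub>Der K B\<^esub> b = \<zero>\<^bsub>B\<^esub>" "(D \<oplus>\<^bsub>Der K B\<^esub> E) b = D b \<oplus>\<^bsub>B\<^esub> E b"
    "(c \<odot>\<^bsub>Der K B\<^esub> D) b = c \<odot>\<^bsub>B\<^esub> D b"
  using assms by (simp_all add: Der_simps)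

lemma bracket_apply:
  "b \<in> carrier B \<Longrightarrow> (D \<otimes>\<^bsub>Der K B\<^esub> E) b = D (E b) \<ominus>\<^bsub>B\<^esub> E (D b)"
  by (simp add: Der_simps)

lemma bracket_closed:
  "D \<in> carrier (Der K B) \<Longrightarrow> E \<in> carrier (Der K B) \<Longrightarrow> D \<otimes>\<^bsub>Der K B\<^esub> E \<in> carrier (Der K B)"
  by (rule module_Der(2)[OF algebra_axioms])

lemma maps_between_submodule:
  assumes "U \<subseteq> carrier B" "submodule W K B"
  shows "submodule {D \<in> carrier (Der K B). D ` U \<subseteq> W} K (Der K B)"
proof (rule Der.submodule_criterion)
  note W = submoduleD[OF assms(2)]
  let ?H = "{D \<in> carrier (Der K B). D ` U \<subseteq> W}"
  have U: "u \<in> carrier B" if "u \<in> U" for u using that assms(1) by auto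
  show "\<zero>\<^bsub>Der K B\<^esub> \<in> ?H" using U W(2) by (auto simp: Der_apply image_subset_iff)
  show "D \<oplus>\<^bsub>Der K B\<^esub> E \<in> ?H" if "D \<in> ?H" "E \<in> ?H" for D E
    using that U W(3) by (auto simp: Der_apply image_subset_iff)
  show "c \<odot>\<^bsub>Der K B\<^esub> D \<in> ?H" if "c \<in> carrier K" "D \<in> ?H" for c D
    using that U W(4) by (auto simp: Der_apply image_subset_iff)
qed auto

lemma stabilizer_lie_subalgebra:
  assumes "submodule U K B"
  shows "lie_subalgebra K (Der K B) {D \<in> carrier (Der K B). D ` U \<subseteq> U}"
proof -
  note U = submoduleD[OF assms]
  have "D \<otimes>\<^bsub>Der K B\<^esub> E \<in> {D \<in> carrier (Der K B). D ` U \<subseteq> U}"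
    if DE: "D \<in> carrier (Der K B)" "D ` U \<subseteq> U" "E \<in> carrier (Der K B)" "E ` U \<subseteq> U" for D E
  proof -
    have "(D \<otimes>\<^bsub>Der K B\<^esub> E) u \<in> U" if u: "u \<in> U" for u
    proof -
      have "D (E u) \<in> U" "E (D u) \<in> U" using DE u by auto
      then show ?thesis using U(5) by (simp add: bracket_apply U(1)[OF u])
    qed
    then show ?thesis using bracket_closed[OF DE(1,3)] by auto
  qed
  then show ?thesis
    unfolding lie_subalgebra_def using maps_between_submodule[OF _ assms, of U] U(1) by auto
qed

lemma lie_subalgebra_submodule: "lie_subalgebra K (Der K B) L \<Longrightarrow> submodule L K (Der K B)"
  unfolding lie_subalgebra_def by simp

lemma lie_hull_superset: "X \<subseteq> lie_subalgebra K (Der K B) hull X"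
  by (rule hull_subset)

lemma lie_hull_minimal:
  "X \<subseteq> L \<Longrightarrow> lie_subalgebra K (Der K B) L \<Longrightarrow> lie_subalgebra K (Der K B) hull X \<subseteq> L"
  by (rule hull_minimal)

lemma lie_hull_subset_carrier:
  "X \<subseteq> carrier (Der K B) \<Longrightarrow> lie_subalgebra K (Der K B) hull X \<subseteq> carrier (Der K B)"
  by (rule lie_hull_minimal[OF _ lie_subalgebra_carrier_Der[OF algebra_axioms]])

lemma lie_subalgebra_lie_hull:
  assumes "X \<subseteq> carrier (Der K B)"
  shows "lie_subalgebra K (Der K B) (lie_subalgebra K (Der K B) hull X)"
proof -
  have sub: "submodule L K (Der K B)" if "lie_subalgebra K (Der K B) L" for L
    using that unfolding lie_subalgebra_def by auto
  have br: "D \<otimes>\<^bsub>Der K B\<^esub> E \<in> L" if "lie_subalgebra K (Der K B) L" "D \<in> L" "E \<in> L" for L D E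
    using that unfolding lie_subalgebra_def by auto
  let ?H = "lie_subalgebra K (Der K B) hull X"
  have "submodule ?H K (Der K B)"
  proof (rule Der.submodule_criterion[OF lie_hull_subset_carrier[OF assms]])
    show "\<zero>\<^bsub>Der K B\<^esub> \<in> ?H" unfolding hull_def using Der.submoduleD(2)[OF sub] by auto
    show "D \<oplus>\<^bsub>Der K B\<^esub> E \<in> ?H" if "D \<in> ?H" "E \<in> ?H" for D E
      using that Der.submoduleD(3)[OF sub] unfolding hull_def by auto
    show "c \<odot>\<^bsub>Der K B\<^esub> D \<in> ?H" if "c \<in> carrier K" "D \<in> ?H" for c D
      using that Der.submoduleD(4)[OF sub] unfolding hull_def by auto
  qed
  moreover have "D \<otimes>\<^bsub>Der K B\<^esub> E \<in> ?H" if "D \<in> ?H" "E \<in> ?H" for D E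
    using that br unfolding hull_def by auto
  ultimately show ?thesis unfolding lie_subalgebra_def by auto
qed

lemma span_subset_lie_hull:
  assumes "X \<subseteq> carrier (Der K B)"
  shows "lin_span K (Der K B) X \<subseteq> lie_subalgebra K (Der K B) hull X"
  by (rule span_minimal[OF lie_hull_superset lie_subalgebra_submodule[OF lie_subalgebra_lie_hull[OF assms]]])

lemma locally_finite_lie_hull:
  assumes "locally_finite K B \<Delta>"
  shows "locally_finite K B (lie_subalgebra K (Der K B) hull \<Delta>)"
proof -
  note c = locally_finite_carrier[OF assms]
  have "\<exists>U. fin_dim_subspace K B U \<and> b \<in> U \<and> (\<forall>D\<in>lie_subalgebra K (Der K B) hull \<Delta>. D ` U \<subseteq> U)"
    if b: "b \<in> carrier B" for b
  proof -
    obtain U where U: "fin_dim_subspace K B U" "b \<in> U" "\<And>D. D \<in> \<Delta> \<Longrightarrow> D ` U \<subseteq> U"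
      using locally_finiteE[OF assms b] by metis
    have "submodule U K B" using fin_dim_subspaceE[OF U(1)] by metis
    then have "lie_subalgebra K (Der K B) hull \<Delta> \<subseteq> {D \<in> carrier (Der K B). D ` U \<subseteq> U}"
      using c U(3) by (intro lie_hull_minimal stabilizer_lie_subalgebra) auto
    then show ?thesis using U(1,2) by (intro exI[of _ U]) auto
  qed
  then show ?thesis by (intro locally_finiteI lie_hull_subset_carrier[OF c])
qed

lemma locally_finite_finite_subset:
  assumes "locally_finite K B \<Delta>" "finite C" "C \<subseteq> carrier B"
  shows "\<exists>U. fin_dim_subspace K B U \<and> C \<subseteq> U \<and> (\<forall>D\<in>\<Delta>. D ` U \<subseteq> U)"
  using assms(2,3)
proof (induction C)
  case empty
  show ?case using locally_finiteE[OF assms(1) B.zero_closed] by (metis empty_subsetI)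
next
  case (insert c C)
  have lin: "linear_map K B B D" if "D \<in> \<Delta>" for D
    using that locally_finite_carrier[OF assms(1)] by (intro Der_linear) auto
  obtain U where U: "fin_dim_subspace K B U" "C \<subseteq> U" "\<And>D. D \<in> \<Delta> \<Longrightarrow> D ` U \<subseteq> U"
    using insert.IH insert.prems by auto
  obtain W where W: "fin_dim_subspace K B W" "c \<in> W" "\<And>D. D \<in> \<Delta> \<Longrightarrow> D ` W \<subseteq> W"
    using locally_finiteE[OF assms(1)] insert.prems by (metis insert_subset)
  obtain S where S: "finite S" "S \<subseteq> carrier B" "U = lin_span K B S" "S \<subseteq> U"
    using fin_dim_subspaceE[OF U(1)] .
  obtain T where T: "finite T" "T \<subseteq> carrier B" "W = lin_span K B T" "T \<subseteq> W"
    using fin_dim_subspaceE[OF W(1)] .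
  let ?V = "lin_span K B (S \<union> T)"
  have ST: "S \<union> T \<subseteq> carrier B" using S T by auto
  have sub: "U \<subseteq> ?V" "W \<subseteq> ?V" unfolding S(3) T(3) by (intro span_mono Un_upper1 Un_upper2)+
  have "D ` ?V \<subseteq> ?V" if D: "D \<in> \<Delta>" for D
  proof (rule linear_map_span[OF module lin[OF D] submodule_span[OF ST] ST])
    have "D ` S \<subseteq> U" "D ` T \<subseteq> W" using U(3)[OF D] W(3)[OF D] S(4) T(4) by (auto simp: image_subset_iff)
    then show "D ` (S \<union> T) \<subseteq> ?V" using sub by (auto simp: image_subset_iff)
  qed
  moreover have "fin_dim_subspace K B ?V" using S T by (intro fin_dim_span) auto
  ultimately show ?case using sub U(2) W(2) by (intro exI[of _ ?V]) auto
qed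

text \<open>The smallest \<open>T\<close>-stable subspace \<open>V\<^sub>0\<close> containing an \<open>x\<close>-stable subspace \<open>U\<close> is \<open>x\<close>-stable: by
  \<open>x(t v) = t(x v) + [x, t] v\<close>, where \<open>[x, t]\<close> is a linear combination of \<open>T\<close>, the vectors of \<open>V\<^sub>0\<close> that
  \<open>x\<close> maps into \<open>V\<^sub>0\<close> form a \<open>T\<close>-stable subspace that contains \<open>U\<close>.\<close>

lemma locally_finite_insert:
  assumes "locally_finite K B T" "locally_finite K B {x}"
    and "\<And>t. t \<in> T \<Longrightarrow> x \<otimes>\<^bsub>Der K B\<^esub> t \<in> lin_span K (Der K B) T"
  shows "locally_finite K B (insert x T)"
proof -
  have T: "T \<subseteq> carrier (Der K B)" and x: "x \<in> carrier (Der K B)"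
    using assms(1,2)[THEN locally_finite_carrier] by auto
  have "\<exists>V. fin_dim_subspace K B V \<and> b \<in> V \<and> (\<forall>D\<in>insert x T. D ` V \<subseteq> V)" if b: "b \<in> carrier B" for b
  proof -
    obtain U where U: "fin_dim_subspace K B U" "b \<in> U" "x ` U \<subseteq> U"
      using locally_finiteE[OF assms(2) b] by (metis singletonI)
    obtain S where S: "finite S" "S \<subseteq> carrier B" "U = lin_span K B S"
      using fin_dim_subspaceE[OF U(1)] .
    obtain W where W: "fin_dim_subspace K B W" "S \<subseteq> W" "\<And>t. t \<in> T \<Longrightarrow> t ` W \<subseteq> W"
      using locally_finite_finite_subset[OF assms(1) S(1,2)] by metis
    obtain R where R: "finite R" "R \<subseteq> carrier B" "W = lin_span K B R" "submodule W K B"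
      using fin_dim_subspaceE[OF W(1)] .
    have UW: "U \<subseteq> W" unfolding S(3) by (rule span_minimal[OF W(2) R(4)])
    define stable where "stable V \<longleftrightarrow> submodule V K B \<and> U \<subseteq> V \<and> (\<forall>t\<in>T. t ` V \<subseteq> V)" for V
    define V0 where "V0 = \<Inter>{V. stable V}"
    have W_stable: "stable W" using R(4) UW W(3) unfolding stable_def by auto
    have V0_le: "V0 \<subseteq> V" if "stable V" for V using that unfolding V0_def by auto
    note D = submoduleD
    have V0: "submodule V0 K B"
    proof (rule submodule_criterion)
      show "V0 \<subseteq> carrier B" using V0_le[OF W_stable] D(1)[OF R(4)] by auto
      show "\<zero>\<^bsub>B\<^esub> \<in> V0" unfolding V0_def stable_def using D(2) by auto
      show "v \<oplus>\<^bsub>B\<^esub> w \<in> V0" if "v \<in> V0" "w \<in> V0" for v w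
        using that D(3) unfolding V0_def stable_def by auto
      show "c \<odot>\<^bsub>B\<^esub> v \<in> V0" if "c \<in> carrier K" "v \<in> V0" for c v
        using that D(4) unfolding V0_def stable_def by auto
    qed
    have UV0: "U \<subseteq> V0" unfolding V0_def stable_def by auto
    have TV0: "t v \<in> V0" if "t \<in> T" "v \<in> V0" for t v
      using that unfolding V0_def stable_def by (auto simp: image_subset_iff)
    have span_T: "lin_span K (Der K B) T \<subseteq> {D \<in> carrier (Der K B). D ` V0 \<subseteq> V0}"
      by (rule span_minimal[OF _ maps_between_submodule[OF _ V0]]) (use T TV0 D(1)[OF V0] in auto)
    let ?V1 = "V0 \<inter> {v \<in> carrier B. x v \<in> V0}"
    have "stable ?V1"
      unfolding stable_def
    proof (intro conjI ballI)
      show "submodule ?V1 K B"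
        by (rule submodule_Int[OF V0 linear_map_preimage[OF module Der_linear[OF x] V0]])
      show "U \<subseteq> ?V1" using UV0 U(3) D(1)[OF V0] by auto
      fix t assume t: "t \<in> T"
      have "x (t v) \<in> V0" if v: "v \<in> V0" "x v \<in> V0" for v
      proof -
        have c: "v \<in> carrier B" "x (t v) \<in> carrier B" "t (x v) \<in> carrier B"
          using v D(1)[OF V0] t T x Der_closed by auto
        have "(x \<otimes>\<^bsub>Der K B\<^esub> t) v \<in> V0" using assms(3)[OF t] span_T v(1) by auto
        then have "(x (t v) \<ominus>\<^bsub>B\<^esub> t (x v)) \<oplus>\<^bsub>B\<^esub> t (x v) \<in> V0"
          using TV0[OF t v(2)] D(3)[OF V0] by (simp add: bracket_apply c(1))
        then show ?thesis using c by (simp add: a_minus_def B.a_assoc B.l_neg)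
      qed
      then show "t ` ?V1 \<subseteq> ?V1" using TV0[OF t] D(1)[OF V0] by auto
    qed
    then have "x ` V0 \<subseteq> V0" using V0_le by auto
    moreover have "fin_dim_subspace K B V0"
    proof -
      have "V0 \<subseteq> lin_span K B R" using V0_le[OF W_stable] R(3) by simp
      then obtain F where "finite F" "F \<subseteq> V0" "V0 = lin_span K B F"
        using subspace_of_span_fin_dim[OF field_K R(1,2) V0] by metis
      then show ?thesis using fin_dim_span[of F] D(1)[OF V0] by auto
    qed
    ultimately show ?thesis using UV0 U(2) TV0 by (intro exI[of _ V0]) auto
  qed
  then show ?thesis using T x by (intro locally_finiteI) auto
qed

text \<open>Derivations that are determined by their values on a finite set inherit local finiteness: if
  \<open>x\<close> stabilizes finite-dimensional \<open>U\<close> and \<open>W\<close>, then \<open>ad x\<close> stabilizes the space of derivations that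
  map \<open>U\<close> into \<open>W\<close>, and this space embeds into \<open>Hom(U, W)\<close> once \<open>U\<close> contains the determining set.\<close>

lemma adjoint_locally_finite:
  assumes S: "finite S" "S \<subseteq> carrier B"
    and det: "\<And>D. D \<in> carrier (Der K B) \<Longrightarrow> (\<And>s. s \<in> S \<Longrightarrow> D s = \<zero>\<^bsub>B\<^esub>) \<Longrightarrow> D = \<zero>\<^bsub>Der K B\<^esub>"
    and L: "submodule L K (Der K B)" "\<And>D. D \<in> L \<Longrightarrow> x \<otimes>\<^bsub>Der K B\<^esub> D \<in> L"
    and x: "locally_finite K B {x}" and G: "finite G" "G \<subseteq> L"
  shows "\<exists>T. finite T \<and> T \<subseteq> L \<and> G \<subseteq> lin_span K (Der K B) T \<and>
    (\<forall>t\<in>T. x \<otimes>\<^bsub>Der K B\<^esub> t \<in> lin_span K (Der K B) T)"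
proof -
  have xD: "x \<in> carrier (Der K B)" using locally_finite_carrier[OF x] by auto
  obtain U where U: "fin_dim_subspace K B U" "S \<subseteq> U" "x ` U \<subseteq> U"
    using locally_finite_finite_subset[OF x S] by auto
  obtain R where R: "finite R" "R \<subseteq> carrier B" "U = lin_span K B R" "R \<subseteq> U" "submodule U K B"
    using fin_dim_subspaceE[OF U(1)] .
  have LD: "D \<in> carrier (Der K B)" if "D \<in> L" for D using Der.submoduleD(1)[OF L(1) that] .
  have Uc: "U \<subseteq> carrier B" using submoduleD(1)[OF R(5)] by auto
  obtain W where W: "fin_dim_subspace K B W" "(\<Union>g\<in>G. g ` R) \<subseteq> W" "x ` W \<subseteq> W"
  proof -
    have "finite (\<Union>g\<in>G. g ` R)" "(\<Union>g\<in>G. g ` R) \<subseteq> carrier B"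
      using G R(1,2) LD Der_closed by (auto simp: subset_iff)
    from locally_finite_finite_subset[OF x this] show ?thesis using that by auto
  qed
  have W': "submodule W K B" using fin_dim_subspaceE[OF W(1)] by metis
  let ?V = "L \<inter> {D \<in> carrier (Der K B). D ` U \<subseteq> W}"
  have V: "submodule ?V K (Der K B)"
    by (rule Der.submodule_Int[OF L(1) maps_between_submodule[OF Uc W']])
  have "\<exists>T. finite T \<and> T \<subseteq> ?V \<and> ?V = lin_span K (Der K B) T"
  proof (rule Der.jointly_injective_fin_dim[OF field_K module W(1) R(1) _ V])
    show "linear_map K (Der K B) B (\<lambda>D. D s)" if "s \<in> R" for s using that R(2) eval_linear by auto
    show "D s \<in> W" if "s \<in> R" "D \<in> ?V" for s D using that R(4) by auto
    fix D assume D: "D \<in> ?V" and z: "\<And>s. s \<in> R \<Longrightarrow> D s = \<zero>\<^bsub>B\<^esub>"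
    have DD: "D \<in> carrier (Der K B)" using D by auto
    have zero: "submodule {\<zero>\<^bsub>B\<^esub>} K B" by (rule submodule_criterion) auto
    have "D ` U \<subseteq> {\<zero>\<^bsub>B\<^esub>}"
      unfolding R(3) by (rule linear_map_span[OF module Der_linear[OF DD] zero R(2)]) (use z in auto)
    then show "D = \<zero>\<^bsub>Der K B\<^esub>" using U(2) by (intro det[OF DD]) auto
  qed
  then obtain T where T: "finite T" "T \<subseteq> ?V" "?V = lin_span K (Der K B) T" by metis
  have "G \<subseteq> ?V"
  proof
    fix g assume g: "g \<in> G"
    then have gL: "g \<in> L" using G(2) by auto
    have "g ` U \<subseteq> W"
      unfolding R(3) by (rule linear_map_span[OF module Der_linear[OF LD[OF gL]] W' R(2)]) (use W(2) g in auto)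
    then show "g \<in> ?V" using gL LD[OF gL] by auto
  qed
  moreover have "x \<otimes>\<^bsub>Der K B\<^esub> t \<in> ?V" if t: "t \<in> T" for t
  proof -
    have tV: "t \<in> L" "t ` U \<subseteq> W" using t T(2) by auto
    have "(x \<otimes>\<^bsub>Der K B\<^esub> t) u \<in> W" if u: "u \<in> U" for u
    proof -
      have "x (t u) \<in> W" "t (x u) \<in> W" using tV(2) U(3) W(3) u by auto
      then show ?thesis using submoduleD(5)[OF W'] bracket_apply[of u x t] u Uc by auto
    qed
    then show ?thesis using L(2)[OF tV(1)] bracket_closed[OF xD LD[OF tV(1)]] by auto
  qed
  ultimately show ?thesis using T by (intro exI[of _ T]) auto
qed

lemma lie_derived_subset:
  assumes "lie_subalgebra K (Der K B) L"
  shows "lie_derived K (Der K B) L \<subseteq> L"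
  unfolding lie_derived_def
  by (rule lie_hull_minimal[OF _ assms]) (use assms in \<open>auto simp: lie_subalgebra_def\<close>)

lemma lie_subalgebra_lie_derived:
  assumes "lie_subalgebra K (Der K B) L"
  shows "lie_subalgebra K (Der K B) (lie_derived K (Der K B) L)"
  unfolding lie_derived_def
proof (rule lie_subalgebra_lie_hull)
  have "L \<subseteq> carrier (Der K B)" "\<And>x y. x \<in> L \<Longrightarrow> y \<in> L \<Longrightarrow> x \<otimes>\<^bsub>Der K B\<^esub> y \<in> L"
    using assms Der.submoduleD(1)[OF lie_subalgebra_submodule[OF assms]]
    unfolding lie_subalgebra_def by auto
  then show "{x \<otimes>\<^bsub>Der K B\<^esub> y | x y. x \<in> L \<and> y \<in> L} \<subseteq> carrier (Der K B)" by auto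
qed

lemma bracket_in_lie_derived:
  "x \<in> L \<Longrightarrow> y \<in> L \<Longrightarrow> x \<otimes>\<^bsub>Der K B\<^esub> y \<in> lie_derived K (Der K B) L"
  unfolding lie_derived_def by (rule hull_inc) auto

text \<open>Elements of \<open>L\<close> are added to the weakly locally finite \<open>L'\<close> one at a time. The statement for
  \<open>F\<close> has to be known together with all finite \<open>G \<subseteq> L'\<close>, because adding \<open>x\<close> replaces \<open>G\<close> by a
  larger set whose span is stable under \<open>ad x\<close> and contains the brackets of \<open>x\<close> with \<open>F\<close>. Here \<open>L'\<close> is
  the derived algebra.\<close>

lemma finite_extension_locally_finite:
  assumes S: "finite S" "S \<subseteq> carrier B"
    and det: "\<And>D. D \<in> carrier (Der K B) \<Longrightarrow> (\<And>s. s \<in> S \<Longrightarrow> D s = \<zero>\<^bsub>B\<^esub>) \<Longrightarrow> D = \<zero>\<^bsub>Der K B\<^esub>"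
    and L: "lie_subalgebra K (Der K B) L" and lf: "\<And>D. D \<in> L \<Longrightarrow> locally_finite K B {D}"
    and L': "weakly_locally_finite K B (lie_derived K (Der K B) L)"
    and F: "finite F" "F \<subseteq> L" and G: "finite G" "G \<subseteq> lie_derived K (Der K B) L"
  shows "locally_finite K B (F \<union> G)"
  using F G
proof (induction F arbitrary: G)
  case empty
  then show ?case using L' unfolding weakly_locally_finite_def by auto
next
  case (insert x F)
  let ?L' = "lie_derived K (Der K B) L"
  let ?G = "G \<union> (\<lambda>y. x \<otimes>\<^bsub>Der K B\<^esub> y) ` F"
  have x: "x \<in> L" and FL: "F \<subseteq> L" using insert.prems by auto
  have sub: "submodule ?L' K (Der K B)"
    by (rule lie_subalgebra_submodule[OF lie_subalgebra_lie_derived[OF L]])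
  have G': "?G \<subseteq> ?L'" using bracket_in_lie_derived[OF x] FL insert.prems by auto
  have "x \<otimes>\<^bsub>Der K B\<^esub> D \<in> ?L'" if "D \<in> ?L'" for D
    using bracket_in_lie_derived[OF x] lie_derived_subset[OF L] that by auto
  from adjoint_locally_finite[OF S det sub this lf[OF x] _ G'] insert.hyps(1) insert.prems(2)
  obtain T where T: "finite T" "T \<subseteq> ?L'" "?G \<subseteq> lin_span K (Der K B) T"
    "\<And>t. t \<in> T \<Longrightarrow> x \<otimes>\<^bsub>Der K B\<^esub> t \<in> lin_span K (Der K B) T" by auto
  have FT: "locally_finite K B (F \<union> T)" by (rule insert.IH[OF FL T(1,2)])
  have span_T: "lin_span K (Der K B) T \<subseteq> lin_span K (Der K B) (F \<union> T)" by (rule span_mono) simp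
  have "locally_finite K B (insert x (F \<union> T))"
    by (rule locally_finite_insert[OF FT lf[OF x]]) (use T(3,4) span_T in auto)
  then have hull: "locally_finite K B (lie_subalgebra K (Der K B) hull (insert x (F \<union> T)))"
    and c: "insert x (F \<union> T) \<subseteq> carrier (Der K B)"
    by (rule locally_finite_lie_hull, rule locally_finite_carrier)
  have "G \<subseteq> lin_span K (Der K B) (insert x (F \<union> T))"
    using T(3) span_mono[of T "insert x (F \<union> T)" K "Der K B"] by auto
  then show ?case
    using span_subset_lie_hull[OF c] lie_hull_superset[of "insert x (F \<union> T)"]
    by (intro locally_finite_subset[OF hull]) auto
qed

lemma solvable_weakly_locally_finite:
  assumes S: "finite S" "S \<subseteq> carrier B"
    and det: "\<And>D. D \<in> carrier (Der K B) \<Longrightarrow> (\<And>s. s \<in> S \<Longrightarrow> D s = \<zero>\<^bsub>B\<^esub>) \<Longrightarrow> D = \<zero>\<^bsub>Der K B\<^esub>"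
    and "lie_subalgebra K (Der K B) L" "\<And>D. D \<in> L \<Longrightarrow> locally_finite K B {D}"
    and "lie_solvable K (Der K B) L"
  shows "weakly_locally_finite K B L"
proof -
  obtain d where "(lie_derived K (Der K B) ^^ d) L = {\<zero>\<^bsub>Der K B\<^esub>}"
    using assms(6) unfolding lie_solvable_def by auto
  then show ?thesis using assms(4,5)
  proof (induction d arbitrary: L)
    case 0
    then have L: "L = {\<zero>\<^bsub>Der K B\<^esub>}" by simp
    have "locally_finite K B L" using 0(3)[of "\<zero>\<^bsub>Der K B\<^esub>"] L by simp
    then show ?case
      unfolding weakly_locally_finite_def
      using locally_finite_carrier[of K B L] locally_finite_subset[of K B L] by auto
  next
    case (Suc d)
    let ?L' = "lie_derived K (Der K B) L"
    have "weakly_locally_finite K B ?L'"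
    proof (rule Suc.IH)
      show "(lie_derived K (Der K B) ^^ d) ?L' = {\<zero>\<^bsub>Der K B\<^esub>}" using Suc.prems(1) by (simp add: funpow_swap1)
      show "lie_subalgebra K (Der K B) ?L'" by (rule lie_subalgebra_lie_derived[OF Suc.prems(2)])
      show "locally_finite K B {D}" if "D \<in> ?L'" for D
        using that lie_derived_subset[OF Suc.prems(2)] Suc.prems(3) by auto
    qed
    from finite_extension_locally_finite[OF S det Suc.prems(2,3) this, where G = "{}"]
    have "locally_finite K B F" if "finite F" "F \<subseteq> L" for F using that by simp
    moreover have "L \<subseteq> carrier (Der K B)"
      using Der.submoduleD(1)[OF lie_subalgebra_submodule[OF Suc.prems(2)]] by auto
    ultimately show ?case unfolding weakly_locally_finite_def by auto
  qed
qed

end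

section \<open>Subalgebras\<close>

context field_algebra
begin

lemma subalg_criterion:
  assumes "H \<subseteq> carrier B" "\<one>\<^bsub>B\<^esub> \<in> H" "\<And>a b. a \<in> H \<Longrightarrow> b \<in> H \<Longrightarrow> a \<oplus>\<^bsub>B\<^esub> b \<in> H"
    and "\<And>a b. a \<in> H \<Longrightarrow> b \<in> H \<Longrightarrow> a \<otimes>\<^bsub>B\<^esub> b \<in> H"
    and "\<And>c a. c \<in> carrier K \<Longrightarrow> a \<in> H \<Longrightarrow> c \<odot>\<^bsub>B\<^esub> a \<in> H"
  shows "subalg K B H"
  unfolding subalg_def
proof
  show "submodule H K B"
  proof (rule submodule_criterion[OF assms(1)])
    show "\<zero>\<^bsub>B\<^esub> \<in> H" using assms(5)[of "\<zero>\<^bsub>K\<^esub>" "\<one>\<^bsub>B\<^esub>"] assms(2) by simp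
  qed (use assms in auto)
  show "subring H B"
  proof (rule B.subringI[OF assms(1,2)])
    fix h assume h: "h \<in> H"
    then have "h \<in> carrier B" using assms(1) by auto
    then show "\<ominus>\<^bsub>B\<^esub> h \<in> H" using a_inv_eq_smult[of h] assms(5)[OF _ h] by simp
  qed (use assms in auto)
qed

lemma subalgD:
  assumes "subalg K B H"
  shows "a \<in> H \<Longrightarrow> a \<in> carrier B" "\<one>\<^bsub>B\<^esub> \<in> H" "a \<in> H \<Longrightarrow> b \<in> H \<Longrightarrow> a \<oplus>\<^bsub>B\<^esub> b \<in> H"
    "a \<in> H \<Longrightarrow> b \<in> H \<Longrightarrow> a \<otimes>\<^bsub>B\<^esub> b \<in> H" "c \<in> carrier K \<Longrightarrow> a \<in> H \<Longrightarrow> c \<odot>\<^bsub>B\<^esub> a \<in> H"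
proof -
  have H: "subring H B" "submodule H K B" using assms unfolding subalg_def by auto
  show "a \<in> H \<Longrightarrow> a \<in> carrier B" "a \<in> H \<Longrightarrow> b \<in> H \<Longrightarrow> a \<oplus>\<^bsub>B\<^esub> b \<in> H"
    "c \<in> carrier K \<Longrightarrow> a \<in> H \<Longrightarrow> c \<odot>\<^bsub>B\<^esub> a \<in> H"
    by (fact submoduleD(1,3,4)[OF H(2)])+
  show "\<one>\<^bsub>B\<^esub> \<in> H" by (rule subringE(3)[OF H(1)])
  show "a \<in> H \<Longrightarrow> b \<in> H \<Longrightarrow> a \<otimes>\<^bsub>B\<^esub> b \<in> H" by (rule subringE(6)[OF H(1)])
qed

lemma subalg_hull_minimal: "X \<subseteq> H \<Longrightarrow> subalg K B H \<Longrightarrow> subalg K B hull X \<subseteq> H"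
  by (rule hull_minimal)

lemma subalg_subalg_hull:
  assumes "X \<subseteq> carrier B"
  shows "subalg K B (subalg K B hull X)"
proof (rule subalg_criterion)
  show "subalg K B hull X \<subseteq> carrier B" by (intro subalg_hull_minimal assms subalg_criterion) auto
qed (use subalgD in \<open>auto simp: hull_def\<close>)

lemma subalg_pow: "subalg K B H \<Longrightarrow> a \<in> H \<Longrightarrow> a [^]\<^bsub>B\<^esub> (n::nat) \<in> H"
  by (induction n) (simp_all add: subalgD(2,4))

lemma mult_linear: "a \<in> carrier B \<Longrightarrow> linear_map K B B (\<lambda>x. a \<otimes>\<^bsub>B\<^esub> x)"
  unfolding linear_map_def by (auto simp: B.r_distr smult_assoc2 B.m_comm[of a])

lemma mult_span:
  assumes "S \<subseteq> carrier B" "T \<subseteq> carrier B" "submodule W K B"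
    and "\<And>s t. s \<in> S \<Longrightarrow> t \<in> T \<Longrightarrow> s \<otimes>\<^bsub>B\<^esub> t \<in> W" "x \<in> lin_span K B S" "y \<in> lin_span K B T"
  shows "x \<otimes>\<^bsub>B\<^esub> y \<in> W"
proof -
  have y: "y \<in> carrier B" using submoduleD(1)[OF submodule_span[OF assms(2)] assms(6)] .
  have sy: "s \<otimes>\<^bsub>B\<^esub> y \<in> W" if s: "s \<in> S" for s
  proof -
    have "(\<lambda>t. s \<otimes>\<^bsub>B\<^esub> t) ` lin_span K B T \<subseteq> W"
      using s assms(1,4) by (intro linear_map_span[OF module mult_linear assms(3,2)]) auto
    then show ?thesis using assms(6) by auto
  qed
  have "(\<lambda>s. y \<otimes>\<^bsub>B\<^esub> s) ` S \<subseteq> W" using sy assms(1) y by (auto simp: B.m_comm[of y])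
  then have "(\<lambda>s. y \<otimes>\<^bsub>B\<^esub> s) ` lin_span K B S \<subseteq> W"
    by (rule linear_map_span[OF module mult_linear[OF y] assms(3,1)])
  then have "y \<otimes>\<^bsub>B\<^esub> x \<in> W" using assms(5) by auto
  then show ?thesis
    using y submoduleD(1)[OF submodule_span[OF assms(1)] assms(5)] by (simp add: B.m_comm)
qed

end

section \<open>Derivations of quasi-affine algebras\<close>

text \<open>The algebra of regular functions on \<open>D(f\<^sub>1) \<union> \<dots> \<union> D(f\<^sub>r)\<close>, for \<open>F = {f\<^sub>1, \<dots>, f\<^sub>r}\<close>, need not be
  finitely generated. It is close to the subalgebra generated by the finite set \<open>X\<close> of coordinate
  functions in the sense of the last two assumptions: powers of the \<open>f\<^sub>i\<close> clear denominators, and a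
  function that vanishes on every \<open>D(f\<^sub>i)\<close> is zero.\<close>

locale quasi_affine_algebra = field_algebra +
  fixes X F :: "'c set"
  assumes finite_X: "finite X" and X: "X \<subseteq> carrier B"
    and finite_F: "finite F" and F: "F \<subseteq> subalg K B hull X"
    and clear_denominators:
      "\<And>g. g \<in> carrier B \<Longrightarrow> \<exists>n::nat. \<forall>f\<in>F. f [^]\<^bsub>B\<^esub> n \<otimes>\<^bsub>B\<^esub> g \<in> subalg K B hull X"
    and vanish: "\<And>g n. g \<in> carrier B \<Longrightarrow> (\<And>f. f \<in> F \<Longrightarrow> f [^]\<^bsub>B\<^esub> (n::nat) \<otimes>\<^bsub>B\<^esub> g = \<zero>\<^bsub>B\<^esub>) \<Longrightarrow> g = \<zero>\<^bsub>B\<^esub>"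
begin

lemma F_carrier: "f \<in> F \<Longrightarrow> f \<in> carrier B"
  using F subalgD(1)[OF subalg_subalg_hull[OF X]] by auto

lemma derivation_eq_zeroI:
  assumes D: "D \<in> carrier (Der K B)" and "\<And>x. x \<in> X \<Longrightarrow> D x = \<zero>\<^bsub>B\<^esub>"
  shows "D = \<zero>\<^bsub>Der K B\<^esub>"
proof (rule Der_eqI[OF D])
  have "derivation K B D" using D by (simp add: Der_simps)
  note d = derivationD(3-5)[OF this] and c = Der_closed[OF D]
  let ?H = "{a \<in> carrier B. D a = \<zero>\<^bsub>B\<^esub>}"
  have "D \<one>\<^bsub>B\<^esub> = \<zero>\<^bsub>B\<^esub>"
  proof -
    have "D (\<one>\<^bsub>B\<^esub> \<otimes>\<^bsub>B\<^esub> \<one>\<^bsub>B\<^esub>) = D \<one>\<^bsub>B\<^esub> \<oplus>\<^bsub>B\<^esub> D \<one>\<^bsub>B\<^esub>" by (subst d(3)) (auto simp: c)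
    then have "D \<one>\<^bsub>B\<^esub> \<oplus>\<^bsub>B\<^esub> D \<one>\<^bsub>B\<^esub> = D \<one>\<^bsub>B\<^esub>" by simp
    then show ?thesis using c[OF B.one_closed] B.add.l_cancel_one by simp
  qed
  then have "subalg K B ?H" by (intro subalg_criterion) (auto simp: d)
  then have H: "D a = \<zero>\<^bsub>B\<^esub>" if "a \<in> subalg K B hull X" for a
    using subalg_hull_minimal[of X ?H] assms(2) X that by auto
  fix g assume g: "g \<in> carrier B"
  obtain n :: nat where n: "\<And>f. f \<in> F \<Longrightarrow> f [^]\<^bsub>B\<^esub> n \<otimes>\<^bsub>B\<^esub> g \<in> subalg K B hull X"
    using clear_denominators[OF g] by auto
  have "f [^]\<^bsub>B\<^esub> n \<otimes>\<^bsub>B\<^esub> D g = \<zero>\<^bsub>B\<^esub>" if f: "f \<in> F" for f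
  proof -
    have fn: "f [^]\<^bsub>B\<^esub> n \<in> subalg K B hull X"
      using subalg_pow[OF subalg_subalg_hull[OF X]] F f by auto
    have fc: "f [^]\<^bsub>B\<^esub> n \<in> carrier B" using F_carrier[OF f] by simp
    have "\<zero>\<^bsub>B\<^esub> = D (f [^]\<^bsub>B\<^esub> n) \<otimes>\<^bsub>B\<^esub> g \<oplus>\<^bsub>B\<^esub> f [^]\<^bsub>B\<^esub> n \<otimes>\<^bsub>B\<^esub> D g"
      using H[OF n[OF f]] d(3)[OF fc g] by simp
    then show ?thesis using H[OF fn] g fc c[OF g] by simp
  qed
  then have "D g = \<zero>\<^bsub>B\<^esub>" by (intro vanish[OF c[OF g]])
  then show "D g = \<zero>\<^bsub>Der K B\<^esub> g" using g by (simp add: Der_apply)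
qed auto

text \<open>Every element of the subalgebra generated by \<open>X\<close> is a linear combination of elements of some
  \<open>products n\<close>. The set \<open>F\<close> is included from the start so that multiplication by its elements raises
  the index only by one.\<close>

primrec products :: "nat \<Rightarrow> 'c set"
  where "products 0 = insert \<one>\<^bsub>B\<^esub> (X \<union> F)"
  | "products (Suc n) = products n \<union> (\<lambda>(a, b). a \<otimes>\<^bsub>B\<^esub> b) ` (products n \<times> products n)"

lemma products: "finite (products n)" "products n \<subseteq> carrier B"
proof -
  show "finite (products n)" by (induction n) (auto simp: finite_X finite_F)
  show "products n \<subseteq> carrier B" using X by (induction n) (auto simp: F_carrier)
qed

lemma products_mono: "m \<le> n \<Longrightarrow> products m \<subseteq> products n"
  by (rule lift_Suc_mono_le[of products]) auto

abbreviation span_products :: "nat \<Rightarrow> 'c set"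
  where "span_products n \<equiv> lin_span K B (products n)"

lemma span_products_submodule: "submodule (span_products n) K B"
  by (rule submodule_span[OF products(2)])

lemma span_products_mono: "m \<le> n \<Longrightarrow> span_products m \<subseteq> span_products n"
  by (intro span_mono products_mono)

lemma span_products_mult:
  assumes "a \<in> span_products n" "b \<in> span_products n"
  shows "a \<otimes>\<^bsub>B\<^esub> b \<in> span_products (Suc n)"
  by (rule mult_span[OF products(2) products(2) span_products_submodule _ assms])
    (rule span_inc, auto)

lemma hull_X_subset: "subalg K B hull X \<subseteq> (\<Union>n. span_products n)"
proof (rule subalg_hull_minimal)
  note D = submoduleD[OF span_products_submodule]
  have "X \<subseteq> span_products 0" by (auto intro!: span_inc)
  then show "X \<subseteq> (\<Union>n. span_products n)" by (rule order_trans) (rule UN_upper, rule UNIV_I)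
  have common: "\<exists>n. a \<in> span_products n \<and> b \<in> span_products n"
    if ab: "a \<in> (\<Union>n. span_products n)" "b \<in> (\<Union>n. span_products n)" for a b
  proof -
    obtain i j where "a \<in> span_products i" "b \<in> span_products j" using ab by auto
    then show ?thesis
      using span_products_mono[of i "max i j"] span_products_mono[of j "max i j"] by auto
  qed
  show "subalg K B (\<Union>n. span_products n)"
  proof (rule subalg_criterion)
    show "(\<Union>n. span_products n) \<subseteq> carrier B" using D(1) by auto
    show "\<one>\<^bsub>B\<^esub> \<in> (\<Union>n. span_products n)" by (auto intro!: exI[of _ 0] span_inc)
    show "a \<oplus>\<^bsub>B\<^esub> b \<in> (\<Union>n. span_products n)"
      if "a \<in> (\<Union>n. span_products n)" "b \<in> (\<Union>n. span_products n)" for a b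
      using common[OF that] D(3) by auto
    show "a \<otimes>\<^bsub>B\<^esub> b \<in> (\<Union>n. span_products n)"
      if ab: "a \<in> (\<Union>n. span_products n)" "b \<in> (\<Union>n. span_products n)" for a b
    proof -
      obtain n where "a \<in> span_products n" "b \<in> span_products n" using common[OF ab] by auto
      from span_products_mult[OF this] show ?thesis by (rule UN_I[OF UNIV_I])
    qed
    show "c \<odot>\<^bsub>B\<^esub> a \<in> (\<Union>n. span_products n)"
      if "c \<in> carrier K" "a \<in> (\<Union>n. span_products n)" for c a
      using that D(4) by auto
  qed
qed

definition bounded_poles :: "nat \<Rightarrow> nat \<Rightarrow> 'c set"
  where "bounded_poles n m = {g \<in> carrier B. \<forall>f\<in>F. f [^]\<^bsub>B\<^esub> n \<otimes>\<^bsub>B\<^esub> g \<in> span_products m}"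

lemma bounded_poles_fin_dim: "fin_dim_subspace K B (bounded_poles n m)"
proof -
  note D = submoduleD[OF span_products_submodule]
  have lin: "linear_map K B B (\<lambda>g. f [^]\<^bsub>B\<^esub> n \<otimes>\<^bsub>B\<^esub> g)" if "f \<in> F" for f
    using F_carrier[OF that] by (intro mult_linear) auto
  have sub: "submodule (bounded_poles n m) K B"
  proof (rule submodule_criterion)
    show "\<zero>\<^bsub>B\<^esub> \<in> bounded_poles n m" unfolding bounded_poles_def using D(2) F_carrier by auto
    show "a \<oplus>\<^bsub>B\<^esub> b \<in> bounded_poles n m" if "a \<in> bounded_poles n m" "b \<in> bounded_poles n m" for a b
      using that D(3) linear_mapD(2)[OF lin] unfolding bounded_poles_def by auto
    show "c \<odot>\<^bsub>B\<^esub> a \<in> bounded_poles n m" if "c \<in> carrier K" "a \<in> bounded_poles n m" for a c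
      using that D(4) linear_mapD(3)[OF lin] unfolding bounded_poles_def by auto
  qed (auto simp: bounded_poles_def)
  have "\<exists>T. finite T \<and> T \<subseteq> bounded_poles n m \<and> bounded_poles n m = lin_span K B T"
    by (rule jointly_injective_fin_dim[OF field_K module fin_dim_span[OF products] finite_F lin sub])
      (auto simp: bounded_poles_def intro: vanish)
  then obtain T where "finite T" "T \<subseteq> bounded_poles n m" "bounded_poles n m = lin_span K B T" by auto
  then show ?thesis using fin_dim_span[of T] by (auto simp: bounded_poles_def)
qed

lemma bounded_poles_mono: "m \<le> m' \<Longrightarrow> bounded_poles n m \<subseteq> bounded_poles n m'"
  using span_products_mono unfolding bounded_poles_def by auto

lemma bounded_poles_Suc: "bounded_poles n m \<subseteq> bounded_poles (Suc n) (Suc m)"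
proof
  fix g assume "g \<in> bounded_poles n m"
  then have g: "g \<in> carrier B" "\<And>f. f \<in> F \<Longrightarrow> f [^]\<^bsub>B\<^esub> n \<otimes>\<^bsub>B\<^esub> g \<in> span_products m"
    unfolding bounded_poles_def by auto
  have "f [^]\<^bsub>B\<^esub> Suc n \<otimes>\<^bsub>B\<^esub> g \<in> span_products (Suc m)" if f: "f \<in> F" for f
  proof -
    have "f \<in> products m" using f products_mono[of 0 m] by auto
    then have "f \<otimes>\<^bsub>B\<^esub> (f [^]\<^bsub>B\<^esub> n \<otimes>\<^bsub>B\<^esub> g) \<in> span_products (Suc m)"
      by (intro span_products_mult g(2)[OF f] span_inc)
    then show ?thesis using F_carrier[OF f] g(1) by (simp add: B.m_ac)
  qed
  then show "g \<in> bounded_poles (Suc n) (Suc m)" using g(1) unfolding bounded_poles_def by auto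
qed

text \<open>Raising the exponent by one multiplies by \<open>f\<close> and therefore raises the second index by one.
  The second index \<open>2 n\<close> grows faster than that, so that the filtration is increasing and
  exhaustive.\<close>

lemma fin_dim_filtration:
  obtains E where "\<And>n::nat. fin_dim_subspace K B (E n)" "\<And>n. E n \<subseteq> E (Suc n)"
    "carrier B = (\<Union>n. E n)"
proof
  let ?E = "\<lambda>n. bounded_poles n (2 * n)"
  show "fin_dim_subspace K B (?E n)" for n by (rule bounded_poles_fin_dim)
  show "?E n \<subseteq> ?E (Suc n)" for n
    using bounded_poles_Suc[of n "2 * n"] bounded_poles_mono[of "Suc (2 * n)" "2 * Suc n" "Suc n"] by auto
  show "carrier B = (\<Union>n. ?E n)"
  proof
    show "carrier B \<subseteq> (\<Union>n. ?E n)"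
    proof
      fix g assume g: "g \<in> carrier B"
      obtain n :: nat where n: "\<And>f. f \<in> F \<Longrightarrow> f [^]\<^bsub>B\<^esub> n \<otimes>\<^bsub>B\<^esub> g \<in> subalg K B hull X"
        using clear_denominators[OF g] by auto
      have "\<exists>i. f [^]\<^bsub>B\<^esub> n \<otimes>\<^bsub>B\<^esub> g \<in> span_products i" if "f \<in> F" for f
        using n[OF that] hull_X_subset by auto
      then obtain i where i: "\<And>f. f \<in> F \<Longrightarrow> f [^]\<^bsub>B\<^esub> n \<otimes>\<^bsub>B\<^esub> g \<in> span_products (i f)" by metis
      define m where "m = sum i F"
      have "i f \<le> m" if "f \<in> F" for f
        unfolding m_def using member_le_sum[OF that _ finite_F, of i] by simp
      then have gm: "g \<in> bounded_poles n m"
        using g subsetD[OF span_products_mono i] unfolding bounded_poles_def by auto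
      have "bounded_poles n m \<subseteq> bounded_poles (n + k) (m + k)" for k
        by (induction k) (use bounded_poles_Suc in \<open>auto simp: subset_iff\<close>)
      from subsetD[OF this gm, of m] have "g \<in> ?E (n + m)"
        using bounded_poles_mono[of "m + m" "2 * (n + m)" "n + m"] by auto
      then show "g \<in> (\<Union>n. ?E n)" by (rule UN_I[OF UNIV_I])
    qed
  qed (auto simp: bounded_poles_def)
qed

lemma weakly_locally_finite_filtration:
  assumes L: "lie_subalgebra K (Der K B) L" and w: "weakly_locally_finite K B L"
  obtains G :: "nat \<Rightarrow> _ set" where "\<And>n. lie_subalgebra K (Der K B) (G n)"
    "\<And>n. locally_finite K B (G n)" "\<And>n. G n \<subseteq> G (Suc n)" "L = (\<Union>n. G n)"
proof -
  obtain E where E: "\<And>n::nat. fin_dim_subspace K B (E n)" "\<And>n. E n \<subseteq> E (Suc n)"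
    "carrier B = (\<Union>n. E n)" by (rule fin_dim_filtration) (rule that)
  have mono: "E m \<subseteq> E n" if "m \<le> n" for m n using lift_Suc_mono_le[of E, OF E(2) that] .
  have Lsub: "submodule L K (Der K B)" by (rule lie_subalgebra_submodule[OF L])
  have LD: "D \<in> carrier (Der K B)" if "D \<in> L" for D using Der.submoduleD(1)[OF Lsub that] .
  define V where "V n = L \<inter> {D \<in> carrier (Der K B). D ` X \<subseteq> E n}" for n
  have VL: "V n \<subseteq> L" for n unfolding V_def by auto
  have VD: "V n \<subseteq> carrier (Der K B)" for n unfolding V_def by auto
  let ?G = "\<lambda>n. lie_subalgebra K (Der K B) hull V n"
  have "\<exists>T. finite T \<and> T \<subseteq> V n \<and> V n = lin_span K (Der K B) T" for n
  proof (rule Der.jointly_injective_fin_dim[OF field_K module E(1) finite_X])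
    have "submodule (E n) K B" using fin_dim_subspaceE[OF E(1)] by metis
    then show "submodule (V n) K (Der K B)"
      unfolding V_def by (intro Der.submodule_Int[OF Lsub] maps_between_submodule[OF X])
    show "linear_map K (Der K B) B (\<lambda>D. D x)" if "x \<in> X" for x using that X eval_linear by auto
    show "D x \<in> E n" if "x \<in> X" "D \<in> V n" for x D using that unfolding V_def by auto
    show "D = \<zero>\<^bsub>Der K B\<^esub>" if "D \<in> V n" "\<And>x. x \<in> X \<Longrightarrow> D x = \<zero>\<^bsub>B\<^esub>" for D
      using that VD by (intro derivation_eq_zeroI) auto
  qed
  then obtain T where T: "\<And>n. finite (T n)" "\<And>n. T n \<subseteq> V n" "\<And>n. V n = lin_span K (Der K B) (T n)"
    by metis
  show thesis
  proof
    show "lie_subalgebra K (Der K B) (?G n)" for n by (rule lie_subalgebra_lie_hull[OF VD])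
    show "locally_finite K B (?G n)" for n
    proof -
      have TL: "T n \<subseteq> L" using T(2) VL by (rule subset_trans)
      then have TD: "T n \<subseteq> carrier (Der K B)" using LD by auto
      have "locally_finite K B (T n)" using w T(1) TL unfolding weakly_locally_finite_def by auto
      from locally_finite_lie_hull[OF this] show ?thesis
      proof (rule locally_finite_subset)
        show "?G n \<subseteq> lie_subalgebra K (Der K B) hull T n"
          using span_subset_lie_hull[OF TD] unfolding T(3)[symmetric]
          by (intro lie_hull_minimal lie_subalgebra_lie_hull[OF TD])
      qed
    qed
    show "?G n \<subseteq> ?G (Suc n)" for n
      by (rule hull_mono) (use E(2) in \<open>auto simp: V_def\<close>)
    show "L = (\<Union>n. ?G n)"
    proof
      show "(\<Union>n. ?G n) \<subseteq> L" using lie_hull_minimal[OF VL L] by auto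
      show "L \<subseteq> (\<Union>n. ?G n)"
      proof
        fix D assume D: "D \<in> L"
        have "\<exists>n. D x \<in> E n" if "x \<in> X" for x
        proof -
          have "D x \<in> carrier B" using that X Der_closed[OF LD[OF D]] by auto
          then show ?thesis using E(3) by auto
        qed
        then obtain i where i: "\<And>x. x \<in> X \<Longrightarrow> D x \<in> E (i x)" by metis
        have "i x \<le> sum i X" if "x \<in> X" for x using member_le_sum[OF that _ finite_X, of i] by simp
        then have "D x \<in> E (sum i X)" if "x \<in> X" for x
          using subsetD[OF mono i] that by auto
        then have "D \<in> V (sum i X)" using D LD unfolding V_def by auto
        then show "D \<in> (\<Union>n. ?G n)" using lie_hull_superset[of "V (sum i X)"] by auto
      qed
    qed
  qed
qed

end

section \<open>Finitely generated algebras are Noetherian\<close>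

text \<open>For a subring \<open>R\<close>, closure under negation is implied, because \<open>- 1 \<in> R\<close>.\<close>

definition subring_ideal :: "('a, 'm) ring_scheme \<Rightarrow> 'a set \<Rightarrow> 'a set \<Rightarrow> bool"
  where "subring_ideal A R I \<longleftrightarrow> I \<subseteq> R \<and> \<zero>\<^bsub>A\<^esub> \<in> I \<and>
    (\<forall>x\<in>I. \<forall>y\<in>I. x \<oplus>\<^bsub>A\<^esub> y \<in> I) \<and> (\<forall>r\<in>R. \<forall>x\<in>I. r \<otimes>\<^bsub>A\<^esub> x \<in> I)"

definition ideal_chains_stabilize :: "('a, 'm) ring_scheme \<Rightarrow> 'a set \<Rightarrow> bool"
  where "ideal_chains_stabilize A R \<longleftrightarrow>
    (\<forall>I. (\<forall>n::nat. subring_ideal A R (I n)) \<and> (\<forall>n. I n \<subseteq> I (Suc n)) \<longrightarrow> (\<exists>N. \<forall>n\<ge>N. I n = I N))"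

lemma subring_idealD:
  assumes "subring_ideal A R I"
  shows "x \<in> I \<Longrightarrow> x \<in> R" "\<zero>\<^bsub>A\<^esub> \<in> I" "x \<in> I \<Longrightarrow> y \<in> I \<Longrightarrow> x \<oplus>\<^bsub>A\<^esub> y \<in> I"
    "r \<in> R \<Longrightarrow> x \<in> I \<Longrightarrow> r \<otimes>\<^bsub>A\<^esub> x \<in> I"
  using assms unfolding subring_ideal_def by auto

lemma ideal_chains_stabilizeD:
  assumes "ideal_chains_stabilize A R" "\<And>n::nat. subring_ideal A R (I n)" "\<And>n. I n \<subseteq> I (Suc n)"
  shows "\<exists>N. \<forall>n\<ge>N. I n = I N"
  using assms unfolding ideal_chains_stabilize_def by simp

locale ring_extension = cring A for A (structure) +
  fixes R x
  assumes R: "subring R A" and x: "x \<in> carrier A"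
begin

lemma R_closed:
  "r \<in> R \<Longrightarrow> r \<in> carrier A" "\<zero> \<in> R" "\<one> \<in> R" "r \<in> R \<Longrightarrow> \<ominus> r \<in> R"
  "r \<in> R \<Longrightarrow> s \<in> R \<Longrightarrow> r \<oplus> s \<in> R" "r \<in> R \<Longrightarrow> s \<in> R \<Longrightarrow> r \<otimes> s \<in> R"
  using subringE[OF R] by auto

text \<open>The values at \<open>x\<close> of the polynomials of degree below \<open>d\<close> with coefficients in \<open>R\<close>.\<close>

primrec poly_below :: "nat \<Rightarrow> 'a set"
  where "poly_below 0 = {\<zero>}"
  | "poly_below (Suc d) = {r \<otimes> x [^] d \<oplus> l | r l. r \<in> R \<and> l \<in> poly_below d}"

definition adjoin :: "'a set"
  where "adjoin = (\<Union>d. poly_below d)"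

lemma poly_below_SucI: "r \<in> R \<Longrightarrow> l \<in> poly_below d \<Longrightarrow> r \<otimes> x [^] d \<oplus> l \<in> poly_below (Suc d)"
  by auto

lemma poly_below_SucE:
  assumes "p \<in> poly_below (Suc d)"
  obtains r l where "r \<in> R" "l \<in> poly_below d" "p = r \<otimes> x [^] d \<oplus> l"
  using assms by auto

declare poly_below.simps(2) [simp del]

lemma poly_below_carrier: "p \<in> poly_below d \<Longrightarrow> p \<in> carrier A"
  by (induction d arbitrary: p) (auto elim!: poly_below_SucE simp: R_closed(1) x)

lemma poly_below_Suc: "p \<in> poly_below d \<Longrightarrow> p \<in> poly_below (Suc d)"
  using poly_below_SucI[OF R_closed(2), of p d] poly_below_carrier[of p d] x by simp

lemma poly_below_mono:
  assumes "p \<in> poly_below d" "d \<le> e"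
  shows "p \<in> poly_below e"
proof -
  have "poly_below d \<subseteq> poly_below e"
    by (rule lift_Suc_mono_le[of poly_below, OF _ assms(2)]) (auto intro: poly_below_Suc)
  then show ?thesis using assms(1) by auto
qed

lemma poly_below_zero: "\<zero> \<in> poly_below d"
  using poly_below_mono[of \<zero> 0 d] by simp

lemma poly_below_add: "p \<in> poly_below d \<Longrightarrow> q \<in> poly_below d \<Longrightarrow> p \<oplus> q \<in> poly_below d"
proof (induction d arbitrary: p q)
  case (Suc d)
  obtain r l where p: "r \<in> R" "l \<in> poly_below d" "p = r \<otimes> x [^] d \<oplus> l"
    using poly_below_SucE[OF Suc.prems(1)] .
  obtain s m where q: "s \<in> R" "m \<in> poly_below d" "q = s \<otimes> x [^] d \<oplus> m"
    using poly_below_SucE[OF Suc.prems(2)] .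
  have "p \<oplus> q = (r \<oplus> s) \<otimes> x [^] d \<oplus> (l \<oplus> m)"
    using p q R_closed(1) poly_below_carrier x by (simp add: l_distr a_ac)
  then show ?case using poly_below_SucI[OF R_closed(5)[OF p(1) q(1)] Suc.IH[OF p(2) q(2)]] by simp
qed simp

lemma poly_below_smult: "s \<in> R \<Longrightarrow> p \<in> poly_below d \<Longrightarrow> s \<otimes> p \<in> poly_below d"
proof (induction d arbitrary: p)
  case 0
  then show ?case using R_closed(1) by simp
next
  case (Suc d)
  obtain r l where p: "r \<in> R" "l \<in> poly_below d" "p = r \<otimes> x [^] d \<oplus> l"
    using poly_below_SucE[OF Suc.prems(2)] .
  have "s \<otimes> p = (s \<otimes> r) \<otimes> x [^] d \<oplus> s \<otimes> l"
    using p Suc.prems(1) R_closed(1) poly_below_carrier x by (simp add: r_distr m_assoc)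
  then show ?case
    using poly_below_SucI[OF R_closed(6)[OF Suc.prems(1) p(1)] Suc.IH[OF Suc.prems(1) p(2)]] by simp
qed

lemma poly_below_mult_x: "p \<in> poly_below d \<Longrightarrow> x \<otimes> p \<in> poly_below (Suc d)"
proof (induction d arbitrary: p)
  case 0
  then show ?case using x poly_below_zero by simp
next
  case (Suc d)
  obtain r l where p: "r \<in> R" "l \<in> poly_below d" "p = r \<otimes> x [^] d \<oplus> l"
    using poly_below_SucE[OF Suc.prems] .
  have "x \<otimes> p = r \<otimes> x [^] (Suc d) \<oplus> x \<otimes> l"
    using p R_closed(1) poly_below_carrier x by (simp add: r_distr m_ac)
  then show ?case using poly_below_SucI[OF p(1) Suc.IH[OF p(2)]] by simp
qed

lemma poly_below_mult_pow: "p \<in> poly_below d \<Longrightarrow> x [^] n \<otimes> p \<in> poly_below (n + d)"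
proof (induction n)
  case 0
  then show ?case using poly_below_carrier by simp
next
  case (Suc n)
  have "x [^] Suc n \<otimes> p = x \<otimes> (x [^] n \<otimes> p)"
    using x poly_below_carrier[OF Suc.prems] by (simp add: m_ac)
  then show ?case using poly_below_mult_x[OF Suc.IH[OF Suc.prems]] by simp
qed

lemma poly_below_mult: "p \<in> poly_below d \<Longrightarrow> q \<in> poly_below e \<Longrightarrow> p \<otimes> q \<in> poly_below (d + e)"
proof (induction d arbitrary: p)
  case 0
  then show ?case using poly_below_carrier poly_below_zero by simp
next
  case (Suc d)
  obtain r l where p: "r \<in> R" "l \<in> poly_below d" "p = r \<otimes> x [^] d \<oplus> l"
    using poly_below_SucE[OF Suc.prems(1)] .
  have "p \<otimes> q = r \<otimes> (x [^] d \<otimes> q) \<oplus> l \<otimes> q"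
    using p R_closed(1) poly_below_carrier Suc.prems(2) x by (simp add: l_distr m_assoc)
  moreover have "r \<otimes> (x [^] d \<otimes> q) \<in> poly_below (d + e)"
    by (rule poly_below_smult[OF p(1) poly_below_mult_pow[OF Suc.prems(2)]])
  ultimately have "p \<otimes> q \<in> poly_below (d + e)"
    using poly_below_add Suc.IH[OF p(2) Suc.prems(2)] by simp
  then show ?case using poly_below_Suc by simp
qed

lemma adjoinE:
  assumes "p \<in> adjoin" "q \<in> adjoin"
  obtains d where "p \<in> poly_below d" "q \<in> poly_below d"
proof -
  obtain d e where "p \<in> poly_below d" "q \<in> poly_below e" using assms unfolding adjoin_def by auto
  then show ?thesis
    using that[of "max d e"] poly_below_mono[of p d "max d e"] poly_below_mono[of q e "max d e"] by auto
qed

lemma adjoinI: "p \<in> poly_below d \<Longrightarrow> p \<in> adjoin"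
  unfolding adjoin_def by auto

lemma R_subset_adjoin: "R \<subseteq> adjoin"
proof
  fix r assume r: "r \<in> R"
  have "r = r \<otimes> x [^] (0::nat) \<oplus> \<zero>" using R_closed(1)[OF r] by simp
  then have "r \<in> poly_below (Suc 0)" using poly_below_SucI[OF r poly_below_zero[of 0]] by simp
  then show "r \<in> adjoin" by (rule adjoinI)
qed

lemma x_in_adjoin: "x \<in> adjoin"
  using poly_below_SucI[OF R_closed(3) poly_below_zero, of 1] x by (intro adjoinI[of x "Suc 1"]) simp

lemma subring_adjoin: "subring adjoin A"
proof (rule subringI)
  show "adjoin \<subseteq> carrier A" unfolding adjoin_def using poly_below_carrier by auto
  show "\<one> \<in> adjoin" using R_subset_adjoin R_closed(3) by auto
  show "p \<oplus> q \<in> adjoin" "p \<otimes> q \<in> adjoin" if "p \<in> adjoin" "q \<in> adjoin" for p q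
  proof -
    obtain d where "p \<in> poly_below d" "q \<in> poly_below d" using \<open>p \<in> adjoin\<close> \<open>q \<in> adjoin\<close> by (rule adjoinE)
    then show "p \<oplus> q \<in> adjoin" "p \<otimes> q \<in> adjoin"
      by (rule adjoinI[OF poly_below_add], rule adjoinI[OF poly_below_mult])
  qed
  show "\<ominus> p \<in> adjoin" if p: "p \<in> adjoin" for p
  proof -
    obtain d where d: "p \<in> poly_below d" using p unfolding adjoin_def by auto
    have "\<ominus> p = (\<ominus> \<one>) \<otimes> p" using poly_below_carrier[OF d] by (simp add: l_minus)
    then show ?thesis using poly_below_smult[OF R_closed(4)[OF R_closed(3)] d] by (auto intro: adjoinI)
  qed
qed

definition leading_coeffs :: "nat \<Rightarrow> 'a set \<Rightarrow> 'a set"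
  where "leading_coeffs d I = {r \<in> R. \<exists>l\<in>poly_below d. r \<otimes> x [^] d \<oplus> l \<in> I}"

lemma leading_coeffsI: "r \<in> R \<Longrightarrow> l \<in> poly_below d \<Longrightarrow> r \<otimes> x [^] d \<oplus> l \<in> I \<Longrightarrow> r \<in> leading_coeffs d I"
  unfolding leading_coeffs_def by auto

lemma leading_coeffsE:
  assumes "r \<in> leading_coeffs d I"
  obtains l where "r \<in> R" "l \<in> poly_below d" "r \<otimes> x [^] d \<oplus> l \<in> I"
  using assms unfolding leading_coeffs_def by auto

lemma leading_coeffs_mono: "I \<subseteq> J \<Longrightarrow> leading_coeffs d I \<subseteq> leading_coeffs d J"
  unfolding leading_coeffs_def by auto

context
  fixes I assumes I: "subring_ideal A adjoin I"
begin

lemma I_closed: "p \<in> I \<Longrightarrow> q \<in> I \<Longrightarrow> p \<oplus> q \<in> I" "r \<in> R \<Longrightarrow> p \<in> I \<Longrightarrow> r \<otimes> p \<in> I" "p \<in> I \<Longrightarrow> x \<otimes> p \<in> I"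
  using subring_idealD(3,4)[OF I] R_subset_adjoin x_in_adjoin by auto

lemma subring_ideal_leading_coeffs: "subring_ideal A R (leading_coeffs d I)"
  unfolding subring_ideal_def
proof (intro conjI ballI)
  show "leading_coeffs d I \<subseteq> R" unfolding leading_coeffs_def by auto
  show "\<zero> \<in> leading_coeffs d I"
    using subring_idealD(2)[OF I] x by (intro leading_coeffsI[OF R_closed(2) poly_below_zero]) simp
  show "r \<oplus> s \<in> leading_coeffs d I" if r: "r \<in> leading_coeffs d I" and s: "s \<in> leading_coeffs d I" for r s
  proof -
    obtain l where l: "r \<in> R" "l \<in> poly_below d" "r \<otimes> x [^] d \<oplus> l \<in> I" using leading_coeffsE[OF r] .
    obtain m where m: "s \<in> R" "m \<in> poly_below d" "s \<otimes> x [^] d \<oplus> m \<in> I" using leading_coeffsE[OF s] .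
    have "(r \<oplus> s) \<otimes> x [^] d \<oplus> (l \<oplus> m) = (r \<otimes> x [^] d \<oplus> l) \<oplus> (s \<otimes> x [^] d \<oplus> m)"
      using l m x R_closed(1) poly_below_carrier by (simp add: l_distr a_ac)
    then show ?thesis
      using I_closed(1)[OF l(3) m(3)] R_closed(5)[OF l(1) m(1)] poly_below_add[OF l(2) m(2)]
      by (intro leading_coeffsI) auto
  qed
  show "s \<otimes> r \<in> leading_coeffs d I" if s: "s \<in> R" and r: "r \<in> leading_coeffs d I" for r s
  proof -
    obtain l where l: "r \<in> R" "l \<in> poly_below d" "r \<otimes> x [^] d \<oplus> l \<in> I" using leading_coeffsE[OF r] .
    have "(s \<otimes> r) \<otimes> x [^] d \<oplus> s \<otimes> l = s \<otimes> (r \<otimes> x [^] d \<oplus> l)"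
      using l s x R_closed(1) poly_below_carrier by (simp add: r_distr m_assoc)
    then show ?thesis
      using I_closed(2)[OF s l(3)] R_closed(6)[OF s l(1)] poly_below_smult[OF s l(2)]
      by (intro leading_coeffsI) auto
  qed
qed

text \<open>Multiplication by \<open>x\<close> raises the degree and keeps the leading coefficient.\<close>

lemma leading_coeffs_Suc: "leading_coeffs d I \<subseteq> leading_coeffs (Suc d) I"
proof
  fix r assume r: "r \<in> leading_coeffs d I"
  obtain l where l: "r \<in> R" "l \<in> poly_below d" "r \<otimes> x [^] d \<oplus> l \<in> I" using leading_coeffsE[OF r] .
  have "r \<otimes> x [^] (Suc d) \<oplus> x \<otimes> l = x \<otimes> (r \<otimes> x [^] d \<oplus> l)"
    using l x R_closed(1) poly_below_carrier by (simp add: r_distr m_ac)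
  then show "r \<in> leading_coeffs (Suc d) I"
    using I_closed(3)[OF l(3)] l(1) poly_below_mult_x[OF l(2)] by (intro leading_coeffsI) auto
qed

end

text \<open>The difference of two elements with the same leading coefficient has smaller degree.\<close>

lemma eq_if_leading_coeffs_eq:
  assumes I: "subring_ideal A adjoin I" and J: "subring_ideal A adjoin J" and "I \<subseteq> J"
    and "\<And>d. leading_coeffs d I = leading_coeffs d J"
  shows "I = J"
proof
  have "p \<in> I" if "p \<in> J" "p \<in> poly_below d" for p d
    using that
  proof (induction d arbitrary: p)
    case 0
    then show ?case using subring_idealD(2)[OF I] by simp
  next
    case (Suc d)
    obtain r l where p: "r \<in> R" "l \<in> poly_below d" "p = r \<otimes> x [^] d \<oplus> l"
      using poly_below_SucE[OF Suc.prems(2)] .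
    have "r \<in> leading_coeffs d I"
      unfolding assms(4) using p Suc.prems(1) by (intro leading_coeffsI) auto
    then obtain m where m: "m \<in> poly_below d" "r \<otimes> x [^] d \<oplus> m \<in> I" using leading_coeffsE by metis
    let ?q = "r \<otimes> x [^] d \<oplus> m" and ?n = "\<ominus> \<one>"
    have n: "?n \<in> R" using R_closed(3,4) by auto
    have c: "r \<otimes> x [^] d \<in> carrier A" "l \<in> carrier A" "m \<in> carrier A" "?q \<in> carrier A" "p \<in> carrier A"
      using p m(1) x R_closed(1) poly_below_carrier by auto
    have "p \<oplus> ?n \<otimes> ?q \<in> J"
      using I_closed(1,2)[OF J] n Suc.prems(1) m(2) assms(3) by auto
    moreover have "p \<oplus> ?n \<otimes> ?q = l \<oplus> ?n \<otimes> m"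
      using c(1-3) unfolding p(3) by (simp add: l_minus minus_add a_ac r_neg r_neg1 r_neg2)
    moreover have "l \<oplus> ?n \<otimes> m \<in> poly_below d"
      by (rule poly_below_add[OF p(2) poly_below_smult[OF n m(1)]])
    ultimately have "p \<oplus> ?n \<otimes> ?q \<in> I" using Suc.IH by simp
    then have "(p \<oplus> ?n \<otimes> ?q) \<oplus> ?q \<in> I" using I_closed(1)[OF I] m(2) by simp
    then show ?case using c(4,5) by (simp add: l_minus a_assoc l_neg)
  qed
  moreover have "\<exists>d. p \<in> poly_below d" if "p \<in> J" for p
    using subring_idealD(1)[OF J that] unfolding adjoin_def by auto
  ultimately show "J \<subseteq> I" by (meson subsetI)
qed (rule assms(3))

text \<open>The Hilbert basis theorem. The ideals \<open>leading_coeffs d (I n)\<close> increase with \<open>d\<close> and with \<open>n\<close>.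
  If the diagonal is constant from \<open>N\<close> on, then all of them with \<open>d, n \<ge> N\<close> agree, and for each of
  the finitely many \<open>d < N\<close> the chain in \<open>n\<close> stabilizes as well.\<close>

lemma ideal_chains_stabilize_adjoin:
  assumes "ideal_chains_stabilize A R"
  shows "ideal_chains_stabilize A adjoin"
  unfolding ideal_chains_stabilize_def
proof (intro allI impI, elim conjE)
  fix I :: "nat \<Rightarrow> 'a set"
  assume "\<forall>n. subring_ideal A adjoin (I n)" "\<forall>n. I n \<subseteq> I (Suc n)"
  then have I: "\<And>n. subring_ideal A adjoin (I n)" and I_Suc: "\<And>n. I n \<subseteq> I (Suc n)" by auto
  have I_mono: "I m \<subseteq> I n" if "m \<le> n" for m n using lift_Suc_mono_le[of I, OF I_Suc that] .
  let ?L = "\<lambda>d n. leading_coeffs d (I n)"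
  have L_mono: "?L d m \<subseteq> ?L e n" if "d \<le> e" "m \<le> n" for d e m n
  proof -
    have "?L d m \<subseteq> ?L e m"
      by (rule lift_Suc_mono_le[of "\<lambda>d. ?L d m", OF leading_coeffs_Suc[OF I] that(1)])
    also have "\<dots> \<subseteq> ?L e n" by (rule leading_coeffs_mono[OF I_mono[OF that(2)]])
    finally show ?thesis .
  qed
  have ideal: "subring_ideal A R (?L d n)" for d n by (rule subring_ideal_leading_coeffs[OF I])
  have "\<exists>N. \<forall>n\<ge>N. ?L n n = ?L N N"
    by (rule ideal_chains_stabilizeD[OF assms, of "\<lambda>n. ?L n n", OF ideal]) (simp add: L_mono)
  then obtain N where N: "\<And>n. n \<ge> N \<Longrightarrow> ?L n n = ?L N N" by metis
  have "\<exists>M. \<forall>n\<ge>M. ?L d n = ?L d M" for d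
    by (rule ideal_chains_stabilizeD[OF assms, of "\<lambda>n. ?L d n", OF ideal]) (simp add: L_mono)
  then obtain M where M: "\<And>d n. n \<ge> M d \<Longrightarrow> ?L d n = ?L d (M d)" by metis
  define m where "m = N + sum M {..<N}"
  have Mm: "M d \<le> m" if "d < N" for d
    using member_le_sum[of d "{..<N}" M] that unfolding m_def by auto
  have L_eq: "?L d n = ?L d m" if n: "n \<ge> m" for d n
  proof (cases "d < N")
    case True
    show ?thesis using M[OF order_trans[OF Mm[OF True] n]] M[OF Mm[OF True]] by (rule trans[OF _ sym])
  next
    case False
    have "?L d k = ?L N N" if k: "k \<ge> N" for k
    proof
      show "?L N N \<subseteq> ?L d k" using False k by (intro L_mono) auto
      have "?L d k \<subseteq> ?L (max d k) (max d k)" by (intro L_mono) auto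
      also have "\<dots> = ?L N N" by (rule N) (use k in simp)
      finally show "?L d k \<subseteq> ?L N N" .
    qed
    from this[of n] this[of m] show ?thesis using n unfolding m_def by simp
  qed
  have "I n = I m" if "n \<ge> m" for n
    by (rule eq_if_leading_coeffs_eq[OF I I I_mono[OF that] L_eq[OF that, symmetric], symmetric])
  then show "\<exists>N. \<forall>n\<ge>N. I n = I N" by (intro exI allI impI)
qed

end

context field_algebra
begin

text \<open>The image of \<open>K\<close> in \<open>B\<close> is a field or zero, hence has only trivial ideals.\<close>

lemma ideal_chains_stabilize_field:
  "\<exists>R. subalg K B R \<and> ideal_chains_stabilize B R"
proof (intro exI conjI)
  let ?R = "(\<lambda>c. c \<odot>\<^bsub>B\<^esub> \<one>\<^bsub>B\<^esub>) ` carrier K"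
  show "subalg K B ?R"
  proof (rule subalg_criterion)
    show "\<one>\<^bsub>B\<^esub> \<in> ?R" by (rule image_eqI[of _ _ "\<one>\<^bsub>K\<^esub>"]) auto
    show "a \<oplus>\<^bsub>B\<^esub> b \<in> ?R" if ab: "a \<in> ?R" "b \<in> ?R" for a b
    proof -
      obtain c d where "c \<in> carrier K" "d \<in> carrier K" "a = c \<odot>\<^bsub>B\<^esub> \<one>\<^bsub>B\<^esub>" "b = d \<odot>\<^bsub>B\<^esub> \<one>\<^bsub>B\<^esub>"
        using ab by auto
      then show ?thesis by (intro image_eqI[of _ _ "c \<oplus>\<^bsub>K\<^esub> d"]) (auto simp: smult_l_distr)
    qed
    show "a \<otimes>\<^bsub>B\<^esub> b \<in> ?R" if ab: "a \<in> ?R" "b \<in> ?R" for a b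
    proof -
      obtain c d where "c \<in> carrier K" "d \<in> carrier K" "a = c \<odot>\<^bsub>B\<^esub> \<one>\<^bsub>B\<^esub>" "b = d \<odot>\<^bsub>B\<^esub> \<one>\<^bsub>B\<^esub>"
        using ab by auto
      then show ?thesis
        by (intro image_eqI[of _ _ "c \<otimes>\<^bsub>K\<^esub> d"]) (auto simp: smult_assoc2 smult_assoc1)
    qed
    show "c \<odot>\<^bsub>B\<^esub> a \<in> ?R" if ca: "c \<in> carrier K" "a \<in> ?R" for c a
    proof -
      obtain d where "d \<in> carrier K" "a = d \<odot>\<^bsub>B\<^esub> \<one>\<^bsub>B\<^esub>" using ca by auto
      then show ?thesis using ca(1) by (intro image_eqI[of _ _ "c \<otimes>\<^bsub>K\<^esub> d"]) (auto simp: smult_assoc1)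
    qed
  qed auto
  have trivial: "I = {\<zero>\<^bsub>B\<^esub>} \<or> I = ?R" if I: "subring_ideal B ?R I" for I
  proof (rule disjCI)
    note D = subring_idealD[OF I]
    assume "I \<noteq> ?R"
    show "I = {\<zero>\<^bsub>B\<^esub>}"
    proof (rule ccontr)
      assume "I \<noteq> {\<zero>\<^bsub>B\<^esub>}"
      then obtain a where a: "a \<in> I" "a \<noteq> \<zero>\<^bsub>B\<^esub>" using D(2) by auto
      obtain c where c: "c \<in> carrier K" "a = c \<odot>\<^bsub>B\<^esub> \<one>\<^bsub>B\<^esub>" using D(1)[OF a(1)] by auto
      have "c \<noteq> \<zero>\<^bsub>K\<^esub>" using a(2) c(2) by auto
      then have i: "inv\<^bsub>K\<^esub> c \<in> carrier K" "inv\<^bsub>K\<^esub> c \<otimes>\<^bsub>K\<^esub> c = \<one>\<^bsub>K\<^esub>"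
        using field_Units c(1) by auto
      have "(inv\<^bsub>K\<^esub> c \<odot>\<^bsub>B\<^esub> \<one>\<^bsub>B\<^esub>) \<otimes>\<^bsub>B\<^esub> a \<in> I" using i(1) by (intro D(4) a(1)) auto
      moreover have "(inv\<^bsub>K\<^esub> c \<odot>\<^bsub>B\<^esub> \<one>\<^bsub>B\<^esub>) \<otimes>\<^bsub>B\<^esub> a = \<one>\<^bsub>B\<^esub>"
        using c i by (simp add: smult_assoc2 smult_assoc1[symmetric])
      ultimately have one: "\<one>\<^bsub>B\<^esub> \<in> I" by simp
      have "r \<in> I" if "r \<in> ?R" for r
        using D(4)[OF that one] that by auto
      then show False using \<open>I \<noteq> ?R\<close> D(1) by auto
    qed
  qed
  show "ideal_chains_stabilize B ?R"
    unfolding ideal_chains_stabilize_def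
  proof (intro allI impI, elim conjE)
    fix I :: "nat \<Rightarrow> 'a set"
    assume "\<forall>n. subring_ideal B ?R (I n)" "\<forall>n. I n \<subseteq> I (Suc n)"
    then have I: "\<And>n. I n = {\<zero>\<^bsub>B\<^esub>} \<or> I n = ?R" and I_Suc: "\<And>n. I n \<subseteq> I (Suc n)"
      and sub: "\<And>n. subring_ideal B ?R (I n)" using trivial by auto
    show "\<exists>N. \<forall>n\<ge>N. I n = I N"
    proof (cases "\<forall>n. I n = {\<zero>\<^bsub>B\<^esub>}")
      case True
      then show ?thesis by auto
    next
      case False
      then obtain N where N: "I N = ?R" using I by auto
      have "I n = ?R" if "n \<ge> N" for n
        using lift_Suc_mono_le[of I, OF I_Suc that] subring_idealD(1)[OF sub, of _ n] N by auto
      then have "\<forall>n\<ge>N. I n = I N" using N by simp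
      then show ?thesis by (rule exI)
    qed
  qed
qed

lemma ideal_chains_stabilize_fin_gen:
  assumes "finite T" "T \<subseteq> carrier B"
  shows "\<exists>R. subalg K B R \<and> T \<subseteq> R \<and> ideal_chains_stabilize B R"
  using assms
proof (induction T)
  case empty
  then show ?case using ideal_chains_stabilize_field by auto
next
  case (insert x T)
  then obtain R where R: "subalg K B R" "T \<subseteq> R" "ideal_chains_stabilize B R" by auto
  interpret ext: ring_extension B R x
    using R(1) insert.prems
    by (intro ring_extension.intro ring_extension_axioms.intro B.is_cring) (auto simp: subalg_def)
  have "submodule ext.adjoin K B"
  proof (rule submodule_criterion)
    show "ext.adjoin \<subseteq> carrier B" by (rule subringE(1)[OF ext.subring_adjoin])
    show "\<zero>\<^bsub>B\<^esub> \<in> ext.adjoin" by (rule subringE(2)[OF ext.subring_adjoin])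
    show "a \<oplus>\<^bsub>B\<^esub> b \<in> ext.adjoin" if "a \<in> ext.adjoin" "b \<in> ext.adjoin" for a b
      using subringE(7)[OF ext.subring_adjoin that] .
    fix c a assume c: "c \<in> carrier K" and a: "a \<in> ext.adjoin"
    have "c \<odot>\<^bsub>B\<^esub> \<one>\<^bsub>B\<^esub> \<in> ext.adjoin" using subalgD(5)[OF R(1) c subalgD(2)[OF R(1)]] ext.R_subset_adjoin by auto
    then have "(c \<odot>\<^bsub>B\<^esub> \<one>\<^bsub>B\<^esub>) \<otimes>\<^bsub>B\<^esub> a \<in> ext.adjoin" using a by (rule subringE(6)[OF ext.subring_adjoin])
    then show "c \<odot>\<^bsub>B\<^esub> a \<in> ext.adjoin"
      using c a subringE(1)[OF ext.subring_adjoin] by (auto simp: smult_assoc2 subset_iff)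
  qed
  then have "subalg K B ext.adjoin" using ext.subring_adjoin unfolding subalg_def by auto
  then show ?case
    using R(2) ext.R_subset_adjoin ext.x_in_adjoin ext.ideal_chains_stabilize_adjoin[OF R(3)]
    by (intro exI[of _ ext.adjoin]) auto
qed

lemma fin_gen_ideal_chains_stabilize:
  assumes "fin_gen_algebra K B"
  shows "ideal_chains_stabilize B (carrier B)"
proof -
  obtain S where S: "finite S" "S \<subseteq> carrier B" "subalg K B hull S = carrier B"
    using assms unfolding fin_gen_algebra_def by auto
  obtain R where R: "subalg K B R" "S \<subseteq> R" "ideal_chains_stabilize B R"
    using ideal_chains_stabilize_fin_gen[OF S(1,2)] by auto
  have "R = carrier B" using subalg_hull_minimal[OF R(2,1)] S(3) subalgD(1)[OF R(1)] by auto
  then show ?thesis using R(3) by simp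
qed

end

section \<open>Ideals of Noetherian rings\<close>

locale noetherian_cring = cring A for A (structure) +
  assumes noetherian: "ideal_chains_stabilize A (carrier A)"
begin

lemma ideal_iff_subring_ideal: "ideal I A \<longleftrightarrow> subring_ideal A (carrier A) I"
proof
  assume "ideal I A"
  then interpret ideal I A .
  show "subring_ideal A (carrier A) I"
    unfolding subring_ideal_def using a_subset I_l_closed by auto
next
  assume I: "subring_ideal A (carrier A) I"
  note D = subring_idealD[OF I]
  have "subgroup I (add_monoid A)"
  proof (rule add.subgroupI)
    show "I \<subseteq> carrier A" using D(1) by auto
    show "I \<noteq> {}" using D(2) by auto
    show "a \<oplus> b \<in> I" if "a \<in> I" "b \<in> I" for a b using D(3) that by auto
    show "\<ominus> a \<in> I" if a: "a \<in> I" for a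
      using D(4)[of "\<ominus> \<one>" a] D(1)[OF a] a by (simp add: l_minus)
  qed
  moreover have "a \<otimes> r \<in> I" if "a \<in> I" "r \<in> carrier A" for a r
    using D(4)[OF that(2,1)] D(1)[OF that(1)] that(2) by (simp add: m_comm)
  ultimately show "ideal I A" using D(4) by (intro idealI ring_axioms) auto
qed

lemma idealD:
  assumes "ideal I A"
  shows "a \<in> I \<Longrightarrow> a \<in> carrier A" "\<zero> \<in> I" "a \<in> I \<Longrightarrow> b \<in> I \<Longrightarrow> a \<oplus> b \<in> I"
    "r \<in> carrier A \<Longrightarrow> a \<in> I \<Longrightarrow> r \<otimes> a \<in> I"
  by (fact subring_idealD[OF assms[unfolded ideal_iff_subring_ideal]])+

lemma ideal_criterion:
  assumes "I \<subseteq> carrier A" "\<zero> \<in> I" "\<And>a b. a \<in> I \<Longrightarrow> b \<in> I \<Longrightarrow> a \<oplus> b \<in> I"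
    and "\<And>r a. r \<in> carrier A \<Longrightarrow> a \<in> I \<Longrightarrow> r \<otimes> a \<in> I"
  shows "ideal I A"
  unfolding ideal_iff_subring_ideal subring_ideal_def using assms by auto

lemma exists_maximal_ideal:
  assumes "\<F> \<noteq> {}" "\<And>I. I \<in> \<F> \<Longrightarrow> ideal I A"
  shows "\<exists>M\<in>\<F>. \<forall>I\<in>\<F>. M \<subseteq> I \<longrightarrow> I = M"
proof (rule ccontr)
  assume *: "\<not> ?thesis"
  have "\<exists>f. \<forall>n::nat. f n \<in> \<F> \<and> f n \<subset> f (Suc n)"
  proof (rule dependent_nat_choice)
    show "\<exists>I. I \<in> \<F>" using assms(1) by auto
    show "\<exists>J. J \<in> \<F> \<and> I \<subset> J" if "I \<in> \<F>" for I using * that by auto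
  qed
  then obtain f where "\<And>n::nat. f n \<in> \<F> \<and> f n \<subset> f (Suc n)" by auto
  then have f: "f n \<in> \<F>" "f n \<subset> f (Suc n)" for n by auto
  have "\<exists>N. \<forall>n\<ge>N. f n = f N"
    by (rule ideal_chains_stabilizeD[OF noetherian])
      (use assms(2) f in \<open>simp_all add: ideal_iff_subring_ideal[symmetric] psubset_imp_subset\<close>)
  then obtain N where "\<forall>n\<ge>N. f n = f N" by (rule exE)
  then have "f (Suc N) = f N" by (rule allE[of _ "Suc N"]) simp
  then show False using f(2)[of N] by auto
qed

text \<open>Applied to the elements \<open>f\<close> of a cover by open sets \<open>D(f)\<close>, this is quasi-compactness: a prime
  that contains the finite subset contains the whole set.\<close>

lemma finite_generating_subset:
  assumes "S \<subseteq> carrier A"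
  shows "\<exists>T. finite T \<and> T \<subseteq> S \<and> (\<forall>I. ideal I A \<and> T \<subseteq> I \<longrightarrow> S \<subseteq> I)"
proof -
  let ?F = "{Idl T | T. finite T \<and> T \<subseteq> S}"
  have ideal: "ideal (Idl T) A" if "T \<subseteq> S" for T using that assms by (intro genideal_ideal) auto
  have "\<exists>M\<in>?F. \<forall>I\<in>?F. M \<subseteq> I \<longrightarrow> I = M"
    by (rule exists_maximal_ideal) (use ideal in auto)
  then obtain T where T: "finite T" "T \<subseteq> S" "\<And>I. I \<in> ?F \<Longrightarrow> Idl T \<subseteq> I \<Longrightarrow> I = Idl T" by auto
  have "s \<in> Idl T" if s: "s \<in> S" for s
  proof -
    have st: "insert s T \<subseteq> carrier A" using s T(2) assms by auto
    have "insert s T \<subseteq> Idl (insert s T)" by (rule genideal_self[OF st])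
    moreover from this have "Idl T \<subseteq> Idl (insert s T)"
      using s T(2) by (intro genideal_minimal ideal) auto
    moreover have "Idl (insert s T) \<in> ?F" using T(1,2) s by auto
    ultimately show ?thesis using T(3) by auto
  qed
  moreover have "Idl T \<subseteq> I" if "ideal I A" "T \<subseteq> I" for I by (rule genideal_minimal[OF that])
  ultimately show ?thesis using T(1,2) by (intro exI[of _ T]) auto
qed

lemma ideal_colon:
  assumes "ideal I A" "x \<in> carrier A"
  shows "ideal {a \<in> carrier A. a \<otimes> x \<in> I} A"
  using assms(2) idealD[OF assms(1)] by (intro ideal_criterion) (auto simp: l_distr m_assoc)

text \<open>An ideal that is maximal among those containing \<open>I\<close> and no power of \<open>f\<close> is prime: if \<open>J\<close> is
  such an ideal and \<open>x y \<in> J\<close> with \<open>x, y \<notin> J\<close>, then \<open>(J : x)\<close> contains \<open>y\<close> and hence a power \<open>f\<^sup>n\<close>, so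
  that \<open>(J : f\<^sup>n)\<close> contains \<open>x\<close> and hence a power of \<open>f\<close> as well.\<close>

lemma radical_eq_Inter_primes:
  assumes "ideal I A" "f \<in> carrier A" "\<And>Q. primeideal Q A \<Longrightarrow> I \<subseteq> Q \<Longrightarrow> f \<in> Q"
  shows "\<exists>n::nat. f [^] n \<in> I"
proof (rule ccontr)
  assume no_power: "\<not> ?thesis"
  let ?F = "{J. ideal J A \<and> I \<subseteq> J \<and> (\<forall>n::nat. f [^] n \<notin> J)}"
  have "\<exists>J\<in>?F. \<forall>J'\<in>?F. J \<subseteq> J' \<longrightarrow> J' = J"
    by (rule exists_maximal_ideal) (use assms(1) no_power in auto)
  then obtain J where J: "ideal J A" "I \<subseteq> J" "\<And>n::nat. f [^] n \<notin> J"
    and max: "\<And>J'. J' \<in> ?F \<Longrightarrow> J \<subseteq> J' \<Longrightarrow> J' = J" by auto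
  have power: "\<exists>n::nat. f [^] n \<otimes> x \<in> J" if x: "x \<in> carrier A" "y \<in> carrier A" "y \<otimes> x \<in> J" "y \<notin> J" for x y
  proof (rule ccontr)
    assume *: "\<not> ?thesis"
    let ?C = "{a \<in> carrier A. a \<otimes> x \<in> J}"
    have "J \<subseteq> ?C" using idealD[OF J(1)] x(1) by (auto simp: m_comm[of _ x])
    moreover have "?C \<in> ?F" using ideal_colon[OF J(1) x(1)] J(2) calculation * by auto
    ultimately have "?C = J" by (intro max)
    then show False using x by auto
  qed
  have "primeideal J A"
  proof (rule primeidealI[OF J(1) is_cring])
    show "carrier A \<noteq> J" using J(3)[of 0] by auto
    fix a b assume ab: "a \<in> carrier A" "b \<in> carrier A" "a \<otimes> b \<in> J"
    show "a \<in> J \<or> b \<in> J"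
    proof (rule ccontr)
      assume no: "\<not> (a \<in> J \<or> b \<in> J)"
      obtain n :: nat where n: "f [^] n \<otimes> b \<in> J" using power[OF ab(2,1,3)] no by auto
      have fn: "f [^] n \<in> carrier A" using assms(2) by simp
      have "b \<otimes> f [^] n \<in> J" using n ab(2) fn by (simp add: m_comm)
      from power[OF fn ab(2) this] obtain m :: nat where "f [^] m \<otimes> f [^] n \<in> J" using no by auto
      then show False using J(3)[of "m + n"] assms(2) by (simp add: nat_pow_mult)
    qed
  qed
  then have "f \<in> J" using assms(3) J(2) by auto
  then show False using J(3)[of 1] assms(2) by simp
qed

lemma power_annihilates:
  assumes "f \<in> carrier A" "a \<in> carrier A"
    and "\<And>Q. primeideal Q A \<Longrightarrow> f \<notin> Q \<Longrightarrow> \<exists>u\<in>carrier A - Q. u \<otimes> a = \<zero>"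
  shows "\<exists>n::nat. f [^] n \<otimes> a = \<zero>"
proof -
  let ?I = "{u \<in> carrier A. u \<otimes> a \<in> {\<zero>}}"
  have "\<exists>n::nat. f [^] n \<in> ?I"
  proof (rule radical_eq_Inter_primes[OF ideal_colon[OF zeroideal assms(2)] assms(1)])
    fix Q assume Q: "primeideal Q A" "?I \<subseteq> Q"
    show "f \<in> Q"
    proof (rule ccontr)
      assume "f \<notin> Q"
      then obtain u where "u \<in> carrier A - Q" "u \<otimes> a = \<zero>" using assms(3)[OF Q(1)] by auto
      then show False using Q(2) by auto
    qed
  qed
  then show ?thesis by auto
qed

end

section \<open>Regular functions on an open subset of an affine variety\<close>

lemma (in primeideal) pow_notin: "f \<in> carrier R \<Longrightarrow> f \<notin> I \<Longrightarrow> f [^] (n::nat) \<in> carrier R - I"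
  by (induction n) (use one_notin mult_notin in auto)

locale quasi_affine_variety = A: field_algebra K A
  for K :: "('k, 'm) ring_scheme" and A :: "('k, 'a, 'n) module_scheme" +
  fixes U :: "'a set set"
  assumes fin_gen: "fin_gen_algebra K A" and U_open: "zariski_open A U"

sublocale quasi_affine_variety \<subseteq> A: noetherian_cring A
  by unfold_locales (rule A.fin_gen_ideal_chains_stabilize[OF fin_gen])

context quasi_affine_variety
begin

abbreviation \<O> where "\<O> \<equiv> structure_sheaf A U"

definition regular_of :: "'a \<Rightarrow> 'a set \<Rightarrow> ('a \<times> 'a) set"
  where "regular_of a = (\<lambda>P\<in>U. loc_frac A P a \<one>\<^bsub>A\<^esub>)"

lemma O_simps:
  "carrier \<O> = regular_functions A U"
  "Q \<in> U \<Longrightarrow> (f \<otimes>\<^bsub>\<O>\<^esub> g) Q = f Q \<otimes>\<^bsub>localization A Q\<^esub> g Q"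
  "Q \<in> U \<Longrightarrow> (f \<oplus>\<^bsub>\<O>\<^esub> g) Q = f Q \<oplus>\<^bsub>localization A Q\<^esub> g Q"
  "Q \<in> U \<Longrightarrow> (c \<odot>\<^bsub>\<O>\<^esub> f) Q = c \<odot>\<^bsub>localization A Q\<^esub> f Q"
  "Q \<in> U \<Longrightarrow> \<zero>\<^bsub>\<O>\<^esub> Q = loc_frac A Q \<zero>\<^bsub>A\<^esub> \<one>\<^bsub>A\<^esub>"
  "Q \<in> U \<Longrightarrow> \<one>\<^bsub>\<O>\<^esub> Q = loc_frac A Q \<one>\<^bsub>A\<^esub> \<one>\<^bsub>A\<^esub>"
  unfolding structure_sheaf_def localization_def by simp_all

lemma algebra_O: "algebra K \<O>"
  by (rule algebra_structure_sheaf[OF A.algebra_axioms U_open])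

lemma prime: "Q \<in> U \<Longrightarrow> primeideal Q A"
  using U_open unfolding zariski_open_def Spec_def by auto

lemma one_notin: "Q \<in> U \<Longrightarrow> \<one>\<^bsub>A\<^esub> \<in> carrier A - Q"
  using primeideal.one_notin[OF prime] by auto

lemma O_eqI:
  assumes "f \<in> carrier \<O>" "g \<in> carrier \<O>" "\<And>Q. Q \<in> U \<Longrightarrow> f Q = g Q"
  shows "f = g"
  using assms(1,2)[unfolded O_simps, THEN regular_functionsD(1)] assms(3) by (rule extensionalityI)

lemma O_fracE:
  assumes "g \<in> carrier \<O>" "Q \<in> U"
  obtains a s where "a \<in> carrier A" "s \<in> carrier A - Q" "g Q = loc_frac A Q a s"
  using regular_functionsD(2)[OF assms(1)[unfolded O_simps] assms(2)] by (rule localization_carrierE)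

lemma O_locally_fracE:
  assumes "g \<in> carrier \<O>" "P \<in> U"
  obtains f a s where "f \<in> carrier A" "a \<in> carrier A" "s \<in> carrier A" "f \<notin> P"
    "\<And>Q. primeideal Q A \<Longrightarrow> f \<notin> Q \<Longrightarrow> Q \<in> U \<and> s \<notin> Q \<and> g Q = loc_frac A Q a s"
proof -
  obtain V a s where V: "zariski_open A V" "P \<in> V" "V \<subseteq> U" "a \<in> carrier A" "s \<in> carrier A"
    "\<forall>Q\<in>V. s \<notin> Q \<and> g Q = loc_frac A Q a s"
    using regular_functionsD(3)[OF assms(1)[unfolded O_simps] assms(2)] by metis
  obtain I where I: "ideal I A" "V = {P \<in> Spec A. \<not> I \<subseteq> P}"
    using V(1) unfolding zariski_open_def by metis
  obtain f where f: "f \<in> I" "f \<notin> P" using V(2) I(2) by auto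
  have "Q \<in> V" if "primeideal Q A" "f \<notin> Q" for Q using that f(1) I(2) by (auto simp: Spec_def)
  then show ?thesis using that[of f a s] A.idealD(1)[OF I(1) f(1)] f(2) V(3-6) by auto
qed

lemma regular_of_closed:
  assumes a: "a \<in> carrier A"
  shows "regular_of a \<in> carrier \<O>"
  unfolding O_simps(1)
proof (rule regular_functionsI)
  show "regular_of a \<in> extensional U" unfolding regular_of_def by simp
  fix P assume P: "P \<in> U"
  show "regular_of a P \<in> carrier (localization A P)"
    using P a one_notin by (simp add: regular_of_def localization_carrierI)
  show "\<exists>V. zariski_open A V \<and> P \<in> V \<and> V \<subseteq> U \<and> (\<exists>b\<in>carrier A. \<exists>s\<in>carrier A.
      \<forall>Q\<in>V. s \<notin> Q \<and> regular_of a Q = loc_frac A Q b s)"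
    by (rule locally_fracI[OF U_open P order_refl a A.B.one_closed])
      (use one_notin in \<open>auto simp: regular_of_def\<close>)
qed

lemma regular_of_apply: "Q \<in> U \<Longrightarrow> regular_of a Q = loc_frac A Q a \<one>\<^bsub>A\<^esub>"
  by (simp add: regular_of_def)

lemma regular_of_mult_apply:
  assumes "Q \<in> U" "h \<in> carrier A" "a \<in> carrier A" "s \<in> carrier A - Q" "g Q = loc_frac A Q a s"
  shows "(regular_of h \<otimes>\<^bsub>\<O>\<^esub> g) Q = loc_frac A Q (h \<otimes>\<^bsub>A\<^esub> a) s"
  using localization_simps(1)[OF A.algebra_axioms prime[OF assms(1)] assms(2) one_notin[OF assms(1)] assms(3,4)]
    assms by (simp add: O_simps regular_of_apply)

lemma O_ring: "cring \<O>"
  using algebra_O by (rule algebra.M_cring)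

lemma regular_of_one: "regular_of \<one>\<^bsub>A\<^esub> = \<one>\<^bsub>\<O>\<^esub>"
proof (rule O_eqI[OF regular_of_closed])
  show "\<one>\<^bsub>\<O>\<^esub> \<in> carrier \<O>" by (rule cring.cring_simprules(6)[OF O_ring])
qed (auto simp: O_simps regular_of_apply)

lemma regular_of_mult:
  assumes "a \<in> carrier A" "b \<in> carrier A"
  shows "regular_of (a \<otimes>\<^bsub>A\<^esub> b) = regular_of a \<otimes>\<^bsub>\<O>\<^esub> regular_of b"
proof (rule O_eqI)
  show "regular_of a \<otimes>\<^bsub>\<O>\<^esub> regular_of b \<in> carrier \<O>"
    by (intro cring.cring_simprules(5)[OF O_ring] regular_of_closed assms)
  show "regular_of (a \<otimes>\<^bsub>A\<^esub> b) Q = (regular_of a \<otimes>\<^bsub>\<O>\<^esub> regular_of b) Q" if Q: "Q \<in> U" for Q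
    using regular_of_mult_apply[of Q a b "\<one>\<^bsub>A\<^esub>" "regular_of b", OF Q assms one_notin[OF Q] regular_of_apply[OF Q]] by (simp add: regular_of_apply Q)
qed (use assms in \<open>auto intro: regular_of_closed\<close>)

lemma regular_of_add:
  assumes "a \<in> carrier A" "b \<in> carrier A"
  shows "regular_of (a \<oplus>\<^bsub>A\<^esub> b) = regular_of a \<oplus>\<^bsub>\<O>\<^esub> regular_of b"
proof (rule O_eqI)
  show "regular_of a \<oplus>\<^bsub>\<O>\<^esub> regular_of b \<in> carrier \<O>"
    by (intro cring.cring_simprules(1)[OF O_ring] regular_of_closed assms)
  show "regular_of (a \<oplus>\<^bsub>A\<^esub> b) Q = (regular_of a \<oplus>\<^bsub>\<O>\<^esub> regular_of b) Q" if Q: "Q \<in> U" for Q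
    using localization_simps(2)[OF A.algebra_axioms prime[OF Q] assms(1) one_notin[OF Q] assms(2) one_notin[OF Q]]
      assms by (simp add: O_simps regular_of_apply Q)
qed (use assms in \<open>auto intro: regular_of_closed\<close>)

lemma regular_of_smult:
  assumes "c \<in> carrier K" "a \<in> carrier A"
  shows "regular_of (c \<odot>\<^bsub>A\<^esub> a) = c \<odot>\<^bsub>\<O>\<^esub> regular_of a"
proof (rule O_eqI)
  show "c \<odot>\<^bsub>\<O>\<^esub> regular_of a \<in> carrier \<O>"
    by (intro module.smult_closed[OF algebra.module[OF algebra_O]] regular_of_closed assms)
  show "regular_of (c \<odot>\<^bsub>A\<^esub> a) Q = (c \<odot>\<^bsub>\<O>\<^esub> regular_of a) Q" if Q: "Q \<in> U" for Q
    using localization_simps(3)[OF A.algebra_axioms prime[OF Q] assms(2) one_notin[OF Q] assms(1)]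
    by (simp add: O_simps regular_of_apply Q)
qed (use assms in \<open>auto intro: regular_of_closed\<close>)

lemma regular_of_pow: "a \<in> carrier A \<Longrightarrow> regular_of (a [^]\<^bsub>A\<^esub> (n::nat)) = regular_of a [^]\<^bsub>\<O>\<^esub> n"
  by (induction n) (simp_all add: regular_of_one regular_of_mult)

lemma vanish_at_iff:
  assumes "Q \<in> U" "a \<in> carrier A" "s \<in> carrier A - Q" "g Q = loc_frac A Q a s"
  shows "g Q = \<zero>\<^bsub>\<O>\<^esub> Q \<longleftrightarrow> (\<exists>u\<in>carrier A - Q. u \<otimes>\<^bsub>A\<^esub> a = \<zero>\<^bsub>A\<^esub>)"
proof -
  interpret P: primeideal Q A by (rule prime[OF assms(1)])
  have "g Q = \<zero>\<^bsub>\<O>\<^esub> Q \<longleftrightarrow> (\<exists>u\<in>carrier A - Q. u \<otimes>\<^bsub>A\<^esub> (a \<otimes>\<^bsub>A\<^esub> \<one>\<^bsub>A\<^esub>) = u \<otimes>\<^bsub>A\<^esub> (\<zero>\<^bsub>A\<^esub> \<otimes>\<^bsub>A\<^esub> s))"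
    unfolding assms(4) O_simps(5)[OF assms(1)]
    by (rule P.loc_frac_eq_iff[OF assms(2,3) _ one_notin[OF assms(1)]]) simp
  also have "\<dots> \<longleftrightarrow> (\<exists>u\<in>carrier A - Q. u \<otimes>\<^bsub>A\<^esub> a = \<zero>\<^bsub>A\<^esub>)"
    by (rule bex_cong[OF refl]) (use assms(2,3) in auto)
  finally show ?thesis .
qed

lemma O_eq_zeroI:
  assumes "g \<in> carrier \<O>" "\<And>Q. Q \<in> U \<Longrightarrow> g Q = \<zero>\<^bsub>\<O>\<^esub> Q"
  shows "g = \<zero>\<^bsub>\<O>\<^esub>"
  by (rule O_eqI[OF assms(1) _ assms(2)]) (rule cring.cring_simprules(2)[OF O_ring])

lemma regular_of_zero: "regular_of \<zero>\<^bsub>A\<^esub> = \<zero>\<^bsub>\<O>\<^esub>"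
  by (rule O_eq_zeroI[OF regular_of_closed]) (auto simp: O_simps(5) regular_of_apply)

text \<open>On each member \<open>D(f)\<close> of a finite cover, \<open>g\<close> is a fraction \<open>a / s\<close>. It vanishes on \<open>D(w f)\<close>,
  which means that a power of \<open>w f\<close> annihilates \<open>a\<close>; the factor \<open>f\<close> is a unit on \<open>D(f)\<close>.\<close>

lemma vanish_on_basic_open:
  assumes g: "g \<in> carrier \<O>" and w: "w \<in> carrier A"
    and zero: "\<And>Q. Q \<in> U \<Longrightarrow> w \<notin> Q \<Longrightarrow> g Q = \<zero>\<^bsub>\<O>\<^esub> Q"
  shows "\<exists>n::nat. regular_of (w [^]\<^bsub>A\<^esub> n) \<otimes>\<^bsub>\<O>\<^esub> g = \<zero>\<^bsub>\<O>\<^esub>"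
proof -
  define is_frac where "is_frac f a s \<longleftrightarrow> a \<in> carrier A \<and> s \<in> carrier A \<and>
    (\<forall>Q. primeideal Q A \<longrightarrow> f \<notin> Q \<longrightarrow> Q \<in> U \<and> s \<notin> Q \<and> g Q = loc_frac A Q a s)" for f a s
  have "\<exists>f. f \<in> carrier A \<and> f \<notin> P \<and> (\<exists>a s. is_frac f a s)" if "P \<in> U" for P
    unfolding is_frac_def by (rule O_locally_fracE[OF g that]) metis
  then obtain f where f: "\<And>P. P \<in> U \<Longrightarrow> f P \<in> carrier A \<and> f P \<notin> P \<and> (\<exists>a s. is_frac (f P) a s)"
    by metis
  then obtain a s where as: "\<And>P. P \<in> U \<Longrightarrow> is_frac (f P) (a P) (s P)" by metis
  have c: "f P \<in> carrier A" "a P \<in> carrier A" "s P \<in> carrier A" "f P \<notin> P" if "P \<in> U" for P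
    using f[OF that] as[OF that] unfolding is_frac_def by auto
  have frac: "Q \<in> U \<and> s P \<notin> Q \<and> g Q = loc_frac A Q (a P) (s P)"
    if "P \<in> U" "primeideal Q A" "f P \<notin> Q" for P Q
    using as[OF that(1)] that(2,3) unfolding is_frac_def by auto
  have "f ` U \<subseteq> carrier A" using c(1) by auto
  from A.finite_generating_subset[OF this]
  obtain T where T: "finite T" "T \<subseteq> f ` U" "\<And>I. ideal I A \<Longrightarrow> T \<subseteq> I \<Longrightarrow> f ` U \<subseteq> I" by metis
  obtain C where C: "finite C" "C \<subseteq> U" "T = f ` C" using finite_subset_image[OF T(1,2)] by metis
  have "\<exists>n::nat. (w \<otimes>\<^bsub>A\<^esub> f P) [^]\<^bsub>A\<^esub> n \<otimes>\<^bsub>A\<^esub> a P = \<zero>\<^bsub>A\<^esub>" if P: "P \<in> C" for P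
  proof (rule A.power_annihilates)
    have PU: "P \<in> U" using P C(2) by auto
    show wf: "w \<otimes>\<^bsub>A\<^esub> f P \<in> carrier A" "a P \<in> carrier A" using w c PU by auto
    fix Q assume Q: "primeideal Q A" "w \<otimes>\<^bsub>A\<^esub> f P \<notin> Q"
    interpret Q: primeideal Q A by fact
    have "w \<notin> Q" "f P \<notin> Q" using Q(2) Q.I_l_closed Q.I_r_closed w c(1)[OF PU] by auto
    then show "\<exists>u\<in>carrier A - Q. u \<otimes>\<^bsub>A\<^esub> a P = \<zero>\<^bsub>A\<^esub>"
      using frac[OF PU Q(1)] vanish_at_iff[of Q "a P" "s P" g] zero[of Q] c(2,3)[OF PU] by auto
  qed
  then obtain n :: "'a set \<Rightarrow> nat" where
    n: "\<And>P. P \<in> C \<Longrightarrow> (w \<otimes>\<^bsub>A\<^esub> f P) [^]\<^bsub>A\<^esub> n P \<otimes>\<^bsub>A\<^esub> a P = \<zero>\<^bsub>A\<^esub>" by metis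
  define N where "N = sum n C"
  have wN: "w [^]\<^bsub>A\<^esub> N \<in> carrier A" using w by simp
  have "(regular_of (w [^]\<^bsub>A\<^esub> N) \<otimes>\<^bsub>\<O>\<^esub> g) Q = \<zero>\<^bsub>\<O>\<^esub> Q" if Q: "Q \<in> U" for Q
  proof -
    interpret Q: primeideal Q A by (rule prime[OF Q])
    have "\<not> T \<subseteq> Q" using T(3)[OF Q.is_ideal] c(4)[OF Q] Q by auto
    then obtain P where P: "P \<in> C" "f P \<notin> Q" using C(3) by auto
    have PU: "P \<in> U" using P C(2) by auto
    note fr = frac[OF PU Q.primeideal P(2)] and cP = c(1-3)[OF PU]
    have "n P \<le> N" unfolding N_def using member_le_sum[OF P(1) _ C(1), of n] by simp
    then obtain k where k: "N = k + n P" using le_Suc_ex by (metis add.commute)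
    let ?wf = "w \<otimes>\<^bsub>A\<^esub> f P"
    have "?wf [^]\<^bsub>A\<^esub> N \<otimes>\<^bsub>A\<^esub> a P = ?wf [^]\<^bsub>A\<^esub> k \<otimes>\<^bsub>A\<^esub> (?wf [^]\<^bsub>A\<^esub> n P \<otimes>\<^bsub>A\<^esub> a P)"
      unfolding k using w cP by (simp add: A.B.nat_pow_mult[symmetric] A.B.m_assoc)
    also have "\<dots> = \<zero>\<^bsub>A\<^esub>" unfolding n[OF P(1)] using w cP by simp
    finally have "f P [^]\<^bsub>A\<^esub> N \<otimes>\<^bsub>A\<^esub> (w [^]\<^bsub>A\<^esub> N \<otimes>\<^bsub>A\<^esub> a P) = \<zero>\<^bsub>A\<^esub>"
      using w cP by (simp add: A.B.nat_pow_distrib A.B.m_ac)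
    moreover have "f P [^]\<^bsub>A\<^esub> N \<in> carrier A - Q" by (rule Q.pow_notin[OF cP(1) P(2)])
    moreover have "(regular_of (w [^]\<^bsub>A\<^esub> N) \<otimes>\<^bsub>\<O>\<^esub> g) Q = loc_frac A Q (w [^]\<^bsub>A\<^esub> N \<otimes>\<^bsub>A\<^esub> a P) (s P)"
      by (rule regular_of_mult_apply[OF Q wN]) (use fr cP in auto)
    ultimately show ?thesis
      using fr cP wN by (subst vanish_at_iff[OF Q, of "w [^]\<^bsub>A\<^esub> N \<otimes>\<^bsub>A\<^esub> a P" "s P"]) auto
  qed
  moreover have "regular_of (w [^]\<^bsub>A\<^esub> N) \<otimes>\<^bsub>\<O>\<^esub> g \<in> carrier \<O>"
    by (rule cring.cring_simprules(5)[OF O_ring regular_of_closed[OF wN] g])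
  ultimately show ?thesis using O_eq_zeroI by metis
qed

text \<open>The elements \<open>h\<close> of \<open>A\<close> such that \<open>h g\<close> comes from \<open>A\<close> form an ideal. It is contained in no
  prime \<open>Q \<in> D(w)\<close>: near \<open>Q\<close>, say on \<open>D(f)\<close>, the function \<open>s g - a\<close> vanishes, so that
  \<open>f\<^sup>n s\<close> belongs to this ideal for some \<open>n\<close>. Hence it contains a power of \<open>w\<close>.\<close>

lemma power_clears_denominators:
  assumes g: "g \<in> carrier \<O>" and w: "w \<in> carrier A" "\<And>Q. primeideal Q A \<Longrightarrow> w \<notin> Q \<Longrightarrow> Q \<in> U"
  shows "\<exists>n::nat. regular_of (w [^]\<^bsub>A\<^esub> n) \<otimes>\<^bsub>\<O>\<^esub> g \<in> regular_of ` carrier A"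
proof -
  interpret \<O>: cring \<O> by (rule O_ring)
  let ?I = "{h \<in> carrier A. regular_of h \<otimes>\<^bsub>\<O>\<^esub> g \<in> regular_of ` carrier A}"
  note [simp] = regular_of_closed g
  have "ideal ?I A"
  proof (rule A.ideal_criterion)
    have "regular_of \<zero>\<^bsub>A\<^esub> \<otimes>\<^bsub>\<O>\<^esub> g = regular_of \<zero>\<^bsub>A\<^esub>" by (simp add: regular_of_zero)
    then show "\<zero>\<^bsub>A\<^esub> \<in> ?I" by auto
    fix h assume "h \<in> ?I"
    then obtain a where a: "a \<in> carrier A" "h \<in> carrier A" "regular_of h \<otimes>\<^bsub>\<O>\<^esub> g = regular_of a" by auto
    show "h \<oplus>\<^bsub>A\<^esub> k \<in> ?I" if "k \<in> ?I" for k
    proof -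
      obtain b where b: "b \<in> carrier A" "k \<in> carrier A" "regular_of k \<otimes>\<^bsub>\<O>\<^esub> g = regular_of b" using \<open>k \<in> ?I\<close> by auto
      have "regular_of (h \<oplus>\<^bsub>A\<^esub> k) \<otimes>\<^bsub>\<O>\<^esub> g = regular_of (a \<oplus>\<^bsub>A\<^esub> b)" using a b by (simp add: regular_of_add \<O>.l_distr)
      then show ?thesis using a b by auto
    qed
    show "r \<otimes>\<^bsub>A\<^esub> h \<in> ?I" if r: "r \<in> carrier A" for r
    proof -
      have "regular_of (r \<otimes>\<^bsub>A\<^esub> h) \<otimes>\<^bsub>\<O>\<^esub> g = regular_of (r \<otimes>\<^bsub>A\<^esub> a)" using a r by (simp add: regular_of_mult \<O>.m_assoc)
      then show ?thesis using a r by auto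
    qed
  qed auto
  have "\<exists>n::nat. w [^]\<^bsub>A\<^esub> n \<in> ?I"
  proof (rule A.radical_eq_Inter_primes[OF \<open>ideal ?I A\<close> w(1)])
    fix Q assume Q: "primeideal Q A" "?I \<subseteq> Q"
    interpret Q: primeideal Q A by fact
    show "w \<in> Q"
    proof (rule ccontr)
      assume "w \<notin> Q"
      then have QU: "Q \<in> U" by (rule w(2)[OF Q(1)])
      obtain f a s where f: "f \<in> carrier A" "a \<in> carrier A" "s \<in> carrier A" "f \<notin> Q"
        and frac: "\<And>P. primeideal P A \<Longrightarrow> f \<notin> P \<Longrightarrow> P \<in> U \<and> s \<notin> P \<and> g P = loc_frac A P a s"
        using O_locally_fracE[OF g QU] by metis
      let ?d = "regular_of s \<otimes>\<^bsub>\<O>\<^esub> g \<oplus>\<^bsub>\<O>\<^esub> regular_of (\<ominus>\<^bsub>A\<^esub> a)"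
      have "?d P = \<zero>\<^bsub>\<O>\<^esub> P" if P: "P \<in> U" "f \<notin> P" for P
      proof -
        interpret P: primeideal P A by (rule prime[OF P(1)])
        have fr: "s \<in> carrier A - P" "g P = loc_frac A P a s" using frac[OF P.primeideal P(2)] f(3) by auto
        have "?d P = loc_frac A P (s \<otimes>\<^bsub>A\<^esub> a) s \<oplus>\<^bsub>localization A P\<^esub> loc_frac A P (\<ominus>\<^bsub>A\<^esub> a) \<one>\<^bsub>A\<^esub>"
          using regular_of_mult_apply[of P s a s g, OF P(1) f(3,2) fr] P(1) by (simp add: O_simps(3) regular_of_apply)
        also have "\<dots> = loc_frac A P (s \<otimes>\<^bsub>A\<^esub> a \<otimes>\<^bsub>A\<^esub> \<one>\<^bsub>A\<^esub> \<oplus>\<^bsub>A\<^esub> (\<ominus>\<^bsub>A\<^esub> a) \<otimes>\<^bsub>A\<^esub> s) (s \<otimes>\<^bsub>A\<^esub> \<one>\<^bsub>A\<^esub>)"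
          by (rule localization_simps(2)[OF A.algebra_axioms P.primeideal _ fr(1) _ one_notin[OF P(1)]])
            (use f in auto)
        also have "s \<otimes>\<^bsub>A\<^esub> a \<otimes>\<^bsub>A\<^esub> \<one>\<^bsub>A\<^esub> \<oplus>\<^bsub>A\<^esub> (\<ominus>\<^bsub>A\<^esub> a) \<otimes>\<^bsub>A\<^esub> s = \<zero>\<^bsub>A\<^esub>"
          using f by (simp add: A.B.l_minus A.B.m_comm[of s] A.B.r_neg)
        finally have d: "?d P = loc_frac A P \<zero>\<^bsub>A\<^esub> s" using f(3) by simp
        show ?thesis
          unfolding vanish_at_iff[of P "\<zero>\<^bsub>A\<^esub>" s ?d, OF P(1) A.B.zero_closed fr(1) d] using fr(1) by auto
      qed
      moreover have "?d \<in> carrier \<O>" using f by auto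
      ultimately obtain n :: nat where n: "regular_of (f [^]\<^bsub>A\<^esub> n) \<otimes>\<^bsub>\<O>\<^esub> ?d = \<zero>\<^bsub>\<O>\<^esub>"
        using vanish_on_basic_open[OF _ f(1)] by metis
      let ?f = "f [^]\<^bsub>A\<^esub> n"
      have fc: "?f \<in> carrier A" using f by simp
      have "regular_of (?f \<otimes>\<^bsub>A\<^esub> s) \<otimes>\<^bsub>\<O>\<^esub> g = regular_of (?f \<otimes>\<^bsub>A\<^esub> a)"
      proof -
        have "regular_of (?f \<otimes>\<^bsub>A\<^esub> a) = regular_of (?f \<otimes>\<^bsub>A\<^esub> a) \<oplus>\<^bsub>\<O>\<^esub> regular_of ?f \<otimes>\<^bsub>\<O>\<^esub> ?d"
          unfolding n using fc f by simp
        also have "\<dots> = regular_of (?f \<otimes>\<^bsub>A\<^esub> s) \<otimes>\<^bsub>\<O>\<^esub> g \<oplus>\<^bsub>\<O>\<^esub> regular_of (?f \<otimes>\<^bsub>A\<^esub> a \<oplus>\<^bsub>A\<^esub> ?f \<otimes>\<^bsub>A\<^esub> (\<ominus>\<^bsub>A\<^esub> a))"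
          using fc f by (simp add: regular_of_mult regular_of_add \<O>.r_distr \<O>.a_ac \<O>.m_assoc)
        also have "?f \<otimes>\<^bsub>A\<^esub> a \<oplus>\<^bsub>A\<^esub> ?f \<otimes>\<^bsub>A\<^esub> (\<ominus>\<^bsub>A\<^esub> a) = \<zero>\<^bsub>A\<^esub>" using fc f by (simp add: A.B.r_minus A.B.r_neg)
        also have "regular_of \<zero>\<^bsub>A\<^esub> = \<zero>\<^bsub>\<O>\<^esub>" by (rule regular_of_zero)
        finally show ?thesis using fc f by simp
      qed
      then have "?f \<otimes>\<^bsub>A\<^esub> s \<in> ?I" using fc f by auto
      moreover have "?f \<otimes>\<^bsub>A\<^esub> s \<in> carrier A - Q"
        using frac[OF Q(1) f(4)] by (intro Q.mult_notin Q.pow_notin) (use f in auto)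
      ultimately show False using Q(2) by auto
    qed
  qed
  then show ?thesis by auto
qed

text \<open>The open set \<open>U\<close> is the union of the \<open>D(t)\<close> for finitely many \<open>t\<close> that generate its ideal, and
  \<open>A\<close> is generated by a finite set, whose image in the ring of regular functions serves as \<open>X\<close>.\<close>

theorem quasi_affine_algebra_O: "\<exists>X F. quasi_affine_algebra K \<O> X F"
proof -
  interpret \<O>: field_algebra K \<O>
    using algebra_O O_ring A.field_K by (intro field_algebra.intro)
  obtain S where S: "finite S" "S \<subseteq> carrier A" "subalg K A hull S = carrier A"
    using fin_gen unfolding fin_gen_algebra_def by metis
  obtain I where I: "ideal I A" "U = {P \<in> Spec A. \<not> I \<subseteq> P}"
    using U_open unfolding zariski_open_def by metis
  have "I \<subseteq> carrier A" using A.idealD(1)[OF I(1)] by auto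
  from A.finite_generating_subset[OF this]
  obtain T where T: "finite T" "T \<subseteq> I" "\<And>J. ideal J A \<Longrightarrow> T \<subseteq> J \<Longrightarrow> I \<subseteq> J" by metis
  have Tc: "t \<in> carrier A" if "t \<in> T" for t using that T(2) A.idealD(1)[OF I(1)] by auto
  have TU: "Q \<in> U" if "t \<in> T" "primeideal Q A" "t \<notin> Q" for t Q
    using that T(2) I(2) by (auto simp: Spec_def)
  let ?E = "subalg K \<O> hull (regular_of ` S)"
  have Sc: "regular_of ` S \<subseteq> carrier \<O>" using S(2) regular_of_closed by auto
  have E: "subalg K \<O> ?E" by (rule \<O>.subalg_subalg_hull[OF Sc])
  have regular_of_E: "regular_of a \<in> ?E" if a: "a \<in> carrier A" for a
  proof -
    have "subalg K A {a \<in> carrier A. regular_of a \<in> ?E}"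
      using \<O>.subalgD(2-5)[OF E]
      by (intro A.subalg_criterion) (auto simp: regular_of_one regular_of_add regular_of_mult regular_of_smult)
    moreover have "S \<subseteq> {a \<in> carrier A. regular_of a \<in> ?E}" using S(2) hull_subset[of "regular_of ` S"] by auto
    ultimately have "subalg K A hull S \<subseteq> {a \<in> carrier A. regular_of a \<in> ?E}"
      by (rule A.subalg_hull_minimal[rotated])
    then show ?thesis using a S(3) by auto
  qed
  have "quasi_affine_algebra K \<O> (regular_of ` S) (regular_of ` T)"
  proof (intro quasi_affine_algebra.intro quasi_affine_algebra_axioms.intro)
    show "field_algebra K \<O>" ..
    show "finite (regular_of ` S)" "finite (regular_of ` T)" using S(1) T(1) by auto
    show "regular_of ` S \<subseteq> carrier \<O>" by (rule Sc)
    show "regular_of ` T \<subseteq> ?E" using Tc regular_of_E by auto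
  next
    fix g assume g: "g \<in> carrier \<O>"
    have "\<exists>n::nat. regular_of (t [^]\<^bsub>A\<^esub> n) \<otimes>\<^bsub>\<O>\<^esub> g \<in> regular_of ` carrier A" if "t \<in> T" for t
      by (rule power_clears_denominators[OF g Tc[OF that] TU[OF that]])
    then obtain n :: "'a \<Rightarrow> nat" where
      n: "\<And>t. t \<in> T \<Longrightarrow> regular_of (t [^]\<^bsub>A\<^esub> n t) \<otimes>\<^bsub>\<O>\<^esub> g \<in> regular_of ` carrier A" by metis
    define N where "N = sum n T"
    have "regular_of t [^]\<^bsub>\<O>\<^esub> N \<otimes>\<^bsub>\<O>\<^esub> g \<in> ?E" if t: "t \<in> T" for t
    proof -
      have "n t \<le> N" unfolding N_def using member_le_sum[OF t _ T(1), of n] by simp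
      then obtain k where k: "N = k + n t" using le_Suc_ex by (metis add.commute)
      have tc: "regular_of t \<in> carrier \<O>" by (rule regular_of_closed[OF Tc[OF t]])
      have "regular_of t [^]\<^bsub>\<O>\<^esub> k \<in> ?E" by (rule \<O>.subalg_pow[OF E regular_of_E[OF Tc[OF t]]])
      moreover have "regular_of t [^]\<^bsub>\<O>\<^esub> n t \<otimes>\<^bsub>\<O>\<^esub> g \<in> ?E"
        using n[OF t] regular_of_E by (auto simp: regular_of_pow[OF Tc[OF t]])
      ultimately have "regular_of t [^]\<^bsub>\<O>\<^esub> k \<otimes>\<^bsub>\<O>\<^esub> (regular_of t [^]\<^bsub>\<O>\<^esub> n t \<otimes>\<^bsub>\<O>\<^esub> g) \<in> ?E" by (rule \<O>.subalgD(4)[OF E])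
      then show ?thesis unfolding k using tc g by (simp add: \<O>.B.nat_pow_mult[symmetric] \<O>.B.m_assoc)
    qed
    then show "\<exists>n::nat. \<forall>f\<in>regular_of ` T. f [^]\<^bsub>\<O>\<^esub> n \<otimes>\<^bsub>\<O>\<^esub> g \<in> ?E" by auto
  next
    fix g and n :: nat
    assume g: "g \<in> carrier \<O>" and zero: "\<And>f. f \<in> regular_of ` T \<Longrightarrow> f [^]\<^bsub>\<O>\<^esub> n \<otimes>\<^bsub>\<O>\<^esub> g = \<zero>\<^bsub>\<O>\<^esub>"
    show "g = \<zero>\<^bsub>\<O>\<^esub>"
    proof (rule O_eq_zeroI[OF g])
      fix Q assume Q: "Q \<in> U"
      interpret Q: primeideal Q A by (rule prime[OF Q])
      have "\<not> T \<subseteq> Q" using T(3)[OF Q.is_ideal] Q I(2) by auto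
      then obtain t where t: "t \<in> T" "t \<notin> Q" by auto
      obtain a s where as: "a \<in> carrier A" "s \<in> carrier A - Q" "g Q = loc_frac A Q a s"
        using O_fracE[OF g Q] .
      let ?t = "t [^]\<^bsub>A\<^esub> n"
      have tn: "?t \<in> carrier A - Q" by (rule Q.pow_notin[OF Tc[OF t(1)] t(2)])
      then have tc: "?t \<in> carrier A" by simp
      have "regular_of ?t \<otimes>\<^bsub>\<O>\<^esub> g = \<zero>\<^bsub>\<O>\<^esub>" using zero t(1) by (simp add: regular_of_pow[OF Tc[OF t(1)]])
      then have "(regular_of ?t \<otimes>\<^bsub>\<O>\<^esub> g) Q = \<zero>\<^bsub>\<O>\<^esub> Q" by simp
      then obtain u where u: "u \<in> carrier A - Q" "u \<otimes>\<^bsub>A\<^esub> (?t \<otimes>\<^bsub>A\<^esub> a) = \<zero>\<^bsub>A\<^esub>"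
        using vanish_at_iff[of Q "?t \<otimes>\<^bsub>A\<^esub> a" s "regular_of ?t \<otimes>\<^bsub>\<O>\<^esub> g", OF Q _ as(2)
            regular_of_mult_apply[of Q ?t a s g, OF Q tc as]] tc as(1) by auto
      have "(u \<otimes>\<^bsub>A\<^esub> ?t) \<otimes>\<^bsub>A\<^esub> a = \<zero>\<^bsub>A\<^esub>" using u tc as(1) by (simp add: A.B.m_assoc)
      then show "g Q = \<zero>\<^bsub>\<O>\<^esub> Q"
        unfolding vanish_at_iff[of Q a s g, OF Q as] using Q.mult_notin[OF u(1) tn] by auto
    qed
  qed
  then show ?thesis by auto
qed

end

theorem corollary4:
  fixes K :: "('k, 'm) ring_scheme"
    and A :: "('k, 'a, 'n) module_scheme"
    and U :: "'a set set"
    and L :: "(('a set \<Rightarrow> ('a \<times> 'a) set) \<Rightarrow> ('a set \<Rightarrow> ('a \<times> 'a) set)) set"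
  defines "B \<equiv> structure_sheaf A U"
  assumes "field K"
    and "fin_gen_algebra K A"
    and "zariski_open A U"
    and "lie_subalgebra K (Der K B) L"
    and "lie_solvable K (Der K B) L"
    and "\<forall>D\<in>L. locally_finite K B {D}"
  shows "weakly_locally_finite K B L \<and>
    (\<exists>F :: nat \<Rightarrow> _ set.
      (\<forall>n. lie_subalgebra K (Der K B) (F n) \<and> locally_finite K B (F n) \<and> F n \<subseteq> F (Suc n)) \<and>
      L = (\<Union>n. F n))"
proof -
  have alg: "algebra K A" using assms(3) unfolding fin_gen_algebra_def by auto
  interpret V: quasi_affine_variety K A U
    using algebra.M_cring[OF alg] alg assms(2-4)
    by (intro quasi_affine_variety.intro quasi_affine_variety_axioms.intro field_algebra.intro)
  obtain X F where "quasi_affine_algebra K B X F"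
    using V.quasi_affine_algebra_O unfolding B_def by metis
  then interpret B: quasi_affine_algebra K B X F .
  have w: "weakly_locally_finite K B L"
  proof (rule B.solvable_weakly_locally_finite[OF B.finite_X B.X])
    show "D = \<zero>\<^bsub>Der K B\<^esub>" if "D \<in> carrier (Der K B)" "\<And>s. s \<in> X \<Longrightarrow> D s = \<zero>\<^bsub>B\<^esub>" for D
      using that by (rule B.derivation_eq_zeroI)
  qed (use assms(5-7) in auto)
  obtain G :: "nat \<Rightarrow> _ set" where "\<And>n. lie_subalgebra K (Der K B) (G n)"
    "\<And>n. locally_finite K B (G n)" "\<And>n. G n \<subseteq> G (Suc n)" "L = (\<Union>n. G n)"
    using B.weakly_locally_finite_filtration[OF assms(5) w] by metis
  then show ?thesis using w by (intro conjI exI[of _ G]) auto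
qed

end
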